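(* Suppose the category $\mathcal{E}$ has small hom-sets and all finite limits, satisfies Giraud's axioms (i)--(v), and its small set of generators (axiom (v)) is $\mathcal{C}$. Then $\mathcal{E}$ is equivalent to $Sh(\mathcal{C}, C)$, where $C$ is the canonical topology on $\mathcal{C}$.
   Context: The canonical topology on a category is the largest Grothendieck topology for which all representable presheaves are sheaves. $Sh(\mathcal{D},J)$ denotes the category of sheaves on the category $\mathcal{D}$ under the Grothendieck topology $J$. The generating set $\mathcal{C}$ is regarded as a full subcategory of $\mathcal{E}$. Giraud's axioms for $\mathcal{E}$ are: (i) $\mathcal{E}$ has small coproducts which are disjoint and stable under pullback; (ii) every epimorphism in $\mathcal{E}$ is a coequalizer; (iii) every equivalence relation $R\rightrightarrows E$ in $\mathcal{E}$ is a kernel pair and has a quotient; (iv) every exact fork $R\rightrightarrows E\to Q$ is stably exact; (v) there is a small set of objects of $\mathcal{E}$ which generates $\mathcal{E}$. Definitions. A coproduct $E=\coprod_\alpha E_\alpha$ is disjoint if every coproduct inclusion $E_\alpha\to E$ is a monomorphism and $E_\alpha\times_E E_\beta$ is the initial object whenever $\alpha\neq\beta$; it is stable if for every $f\colon D\to E$ the projections $D\times_E E_\alpha\to D$ induce an isomorphism $\coprod_\alpha (D\times_E E_\alpha)\cong D$. A morphism $f\colon Y\to Z$ is a coequalizer if it is the coequalizer of some parallel pair $X\rightrightarrows Y$. A pair $\partial_0,\partial_1\colon X\to Y$ is a kernel pair for $f\colon Y\to Z$ if $X$ with $\partial_0,\partial_1$ is the pullback of $f$ along $f$. An equivalence relation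 on $E$ is a subobject $(\partial_0,\partial_1)\colon R\to E\times E$ such that the diagonal $E\to E\times E$ factors through it (reflexive), $(\partial_1,\partial_0)$ factors through it (symmetric), and, with $R\times_E R$ the pullback of $\partial_1$ (first factor, projection $\pi_0$) and $\partial_0$ (second factor, projection $\pi_1$), the map $(\partial_1\pi_1,\partial_0\pi_0)\colon R\times_E R\to E\times E$ factors through $R$ (transitive). Its quotient is the coequalizer of $\partial_0,\partial_1$, if it exists. A fork $X\rightrightarrows Y\xrightarrow{q} Z$ is exact if the parallel pair is the kernel pair of $q$ and $q$ is the coequalizer of the pair; it is stably exact if its pullback along any morphism $Z'\to Z$ is an exact fork. A set of objects $\{A_i\}_{i\in I}$ generates $\mathcal{E}$ if for every object $E$ the family of morphisms $A_i\to E$, $i\in I$, is an epimorphic family: any two parallel arrows $u,v\colon E\to E'$ with $uw=vw$ for every $w$ in the family are equal.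
   Formalization: The canonical topology on C is taken to be the largest one for which all presheaves Hom(-,X) restricted to C, with X any object of E (not only of C), are sheaves; with representables of C alone the claim fails, e.g. for E = Set and C = {1}. *)

theory Defs
  imports Main "HOL-Library.FuncSet" "HOL-Library.Equipollence"
begin

section \<open>Smallness\<close>

text \<open>
  A Grothendieck universe is represented by a set \<open>U\<close> whose cardinality is that of the universe: a
  set is small iff its cardinality is less than that of \<open>U\<close>, i.e. iff it is in bijection with an
  element of the universe.  The closure conditions say that the cardinality of \<open>U\<close> is a strong limit
  and regular.  Infinite rather than uncountable is required, so the universe of hereditarily finite
  sets (\<open>U = (UNIV :: nat set)\<close>) is admitted along with the inaccessible ones.
\<close>

definition small :: "'u set \<Rightarrow> 'x set \<Rightarrow> bool" where
  "small U X \<longleftrightarrow> X \<prec> U"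

definition universe :: "'u set \<Rightarrow> bool" where
  "universe U \<longleftrightarrow>
     infinite U \<and>
     (\<forall>X\<subseteq>U. small U X \<longrightarrow> small U (Pow X)) \<and>
     (\<forall>\<X>\<subseteq>Pow U. small U \<X> \<and> (\<forall>X\<in>\<X>. small U X) \<longrightarrow> small U (\<Union>\<X>))"

section \<open>Categories, functors, equivalence\<close>

record ('o, 'a) category =
  Obj :: "'o set"
  Arr :: "'a set"
  Dom :: "'a \<Rightarrow> 'o"
  Cod :: "'a \<Rightarrow> 'o"
  Id :: "'o \<Rightarrow> 'a"
  Comp :: "'a \<Rightarrow> 'a \<Rightarrow> 'a"  (infixr "\<cdot>\<index>" 70)  \<comment> \<open>\<open>g \<cdot> f\<close>: first \<open>f\<close>, then \<open>g\<close>\<close>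

definition hom :: "('o, 'a) category \<Rightarrow> 'o \<Rightarrow> 'o \<Rightarrow> 'a set" where
  "hom C X Y = {f \<in> Arr C. Dom C f = X \<and> Cod C f = Y}"

locale category =
  fixes C :: "('o, 'a) category" (structure)
  assumes Dom_in_Obj: "f \<in> Arr C \<Longrightarrow> Dom C f \<in> Obj C"
    and Cod_in_Obj: "f \<in> Arr C \<Longrightarrow> Cod C f \<in> Obj C"
    and Id_in_hom: "X \<in> Obj C \<Longrightarrow> Id C X \<in> hom C X X"
    and Comp_in_hom: "f \<in> hom C X Y \<Longrightarrow> g \<in> hom C Y Z \<Longrightarrow> g \<cdot> f \<in> hom C X Z"
    and Comp_assoc: "f \<in> hom C W X \<Longrightarrow> g \<in> hom C X Y \<Longrightarrow> h \<in> hom C Y Z \<Longrightarrow>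
      (h \<cdot> g) \<cdot> f = h \<cdot> (g \<cdot> f)"
    and Comp_Id_left: "f \<in> hom C X Y \<Longrightarrow> Id C Y \<cdot> f = f"
    and Comp_Id_right: "f \<in> hom C X Y \<Longrightarrow> f \<cdot> Id C X = f"

definition op_cat :: "('o, 'a) category \<Rightarrow> ('o, 'a) category" where
  "op_cat C = C\<lparr>Dom := Cod C, Cod := Dom C, Comp := (\<lambda>g f. Comp C f g)\<rparr>"

definition full_subcat :: "('o, 'a) category \<Rightarrow> 'o set \<Rightarrow> ('o, 'a) category" where
  "full_subcat C S = C\<lparr>Obj := S, Arr := {f \<in> Arr C. Dom C f \<in> S \<and> Cod C f \<in> S}\<rparr>"

record ('o, 'a, 'p, 'b) fctr =
  FObj :: "'o \<Rightarrow> 'p"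
  FArr :: "'a \<Rightarrow> 'b"

definition is_functor ::
    "('o, 'a) category \<Rightarrow> ('p, 'b) category \<Rightarrow> ('o, 'a, 'p, 'b) fctr \<Rightarrow> bool" where
  "is_functor C D F \<longleftrightarrow>
     (\<forall>X\<in>Obj C. FObj F X \<in> Obj D) \<and>
     (\<forall>f\<in>Arr C. FArr F f \<in> hom D (FObj F (Dom C f)) (FObj F (Cod C f))) \<and>
     (\<forall>X\<in>Obj C. FArr F (Id C X) = Id D (FObj F X)) \<and>
     (\<forall>f\<in>Arr C. \<forall>g\<in>Arr C. Cod C f = Dom C g \<longrightarrow>
        FArr F (g \<cdot>\<^bsub>C\<^esub> f) = FArr F g \<cdot>\<^bsub>D\<^esub> FArr F f)"

definition id_fctr :: "('o, 'a, 'o, 'a) fctr" where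
  "id_fctr = \<lparr>FObj = (\<lambda>X. X), FArr = (\<lambda>f. f)\<rparr>"

definition comp_fctr ::
    "('p, 'b, 'q, 'c) fctr \<Rightarrow> ('o, 'a, 'p, 'b) fctr \<Rightarrow> ('o, 'a, 'q, 'c) fctr" where
  "comp_fctr G F = \<lparr>FObj = (\<lambda>X. FObj G (FObj F X)), FArr = (\<lambda>f. FArr G (FArr F f))\<rparr>"

definition nat_trans ::
    "('o, 'a) category \<Rightarrow> ('p, 'b) category \<Rightarrow> ('o, 'a, 'p, 'b) fctr \<Rightarrow> ('o, 'a, 'p, 'b) fctr \<Rightarrow>
     ('o \<Rightarrow> 'b) \<Rightarrow> bool" where
  "nat_trans C D F G \<tau> \<longleftrightarrow>
     (\<forall>X\<in>Obj C. \<tau> X \<in> hom D (FObj F X) (FObj G X)) \<and>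
     (\<forall>f\<in>Arr C. \<tau> (Cod C f) \<cdot>\<^bsub>D\<^esub> FArr F f = FArr G f \<cdot>\<^bsub>D\<^esub> \<tau> (Dom C f))"

definition iso :: "('o, 'a) category \<Rightarrow> 'a \<Rightarrow> bool" where
  "iso C f \<longleftrightarrow> f \<in> Arr C \<and>
     (\<exists>g\<in>hom C (Cod C f) (Dom C f). g \<cdot>\<^bsub>C\<^esub> f = Id C (Dom C f) \<and> f \<cdot>\<^bsub>C\<^esub> g = Id C (Cod C f))"

definition nat_iso ::
    "('o, 'a) category \<Rightarrow> ('p, 'b) category \<Rightarrow> ('o, 'a, 'p, 'b) fctr \<Rightarrow> ('o, 'a, 'p, 'b) fctr \<Rightarrow>
     ('o \<Rightarrow> 'b) \<Rightarrow> bool" where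
  "nat_iso C D F G \<tau> \<longleftrightarrow> nat_trans C D F G \<tau> \<and> (\<forall>X\<in>Obj C. iso D (\<tau> X))"

definition equivalent_categories :: "('o, 'a) category \<Rightarrow> ('p, 'b) category \<Rightarrow> bool" where
  "equivalent_categories C D \<longleftrightarrow>
     (\<exists>F G \<eta> \<epsilon>. is_functor C D F \<and> is_functor D C G \<and>
        nat_iso C C id_fctr (comp_fctr G F) \<eta> \<and> nat_iso D D (comp_fctr F G) id_fctr \<epsilon>)"

section \<open>Limits, colimits and the notions occurring in Giraud's axioms\<close>

definition monic :: "('o, 'a) category \<Rightarrow> 'a \<Rightarrow> bool" where
  "monic C m \<longleftrightarrow> m \<in> Arr C \<and>
     (\<forall>W\<in>Obj C. \<forall>u\<in>hom C W (Dom C m). \<forall>v\<in>hom C W (Dom C m). m \<cdot>\<^bsub>C\<^esub> u = m \<cdot>\<^bsub>C\<^esub> v \<longrightarrow> u = v)"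

definition epic :: "('o, 'a) category \<Rightarrow> 'a \<Rightarrow> bool" where
  "epic C e \<longleftrightarrow> e \<in> Arr C \<and>
     (\<forall>W\<in>Obj C. \<forall>u\<in>hom C (Cod C e) W. \<forall>v\<in>hom C (Cod C e) W. u \<cdot>\<^bsub>C\<^esub> e = v \<cdot>\<^bsub>C\<^esub> e \<longrightarrow> u = v)"

definition is_initial :: "('o, 'a) category \<Rightarrow> 'o \<Rightarrow> bool" where
  "is_initial C Z \<longleftrightarrow> Z \<in> Obj C \<and> (\<forall>X\<in>Obj C. \<exists>!f. f \<in> hom C Z X)"

definition is_cone ::
    "('j, 'k) category \<Rightarrow> ('o, 'a) category \<Rightarrow> ('j, 'k, 'o, 'a) fctr \<Rightarrow> 'o \<Rightarrow> ('j \<Rightarrow> 'a) \<Rightarrow> bool" where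
  "is_cone J C D L \<pi> \<longleftrightarrow> L \<in> Obj C \<and>
     (\<forall>j\<in>Obj J. \<pi> j \<in> hom C L (FObj D j)) \<and>
     (\<forall>u\<in>Arr J. FArr D u \<cdot>\<^bsub>C\<^esub> \<pi> (Dom J u) = \<pi> (Cod J u))"

definition is_limit ::
    "('j, 'k) category \<Rightarrow> ('o, 'a) category \<Rightarrow> ('j, 'k, 'o, 'a) fctr \<Rightarrow> 'o \<Rightarrow> ('j \<Rightarrow> 'a) \<Rightarrow> bool" where
  "is_limit J C D L \<pi> \<longleftrightarrow> is_cone J C D L \<pi> \<and>
     (\<forall>M \<rho>. is_cone J C D M \<rho> \<longrightarrow>
        (\<exists>!h. h \<in> hom C M L \<and> (\<forall>j\<in>Obj J. \<pi> j \<cdot>\<^bsub>C\<^esub> h = \<rho> j)))"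

text \<open>Every finite category is isomorphic to one whose objects and arrows are natural numbers.\<close>

definition has_finite_limits :: "('o, 'a) category \<Rightarrow> bool" where
  "has_finite_limits C \<longleftrightarrow>
     (\<forall>(J :: (nat, nat) category) D.
        category J \<and> finite (Obj J) \<and> finite (Arr J) \<and> is_functor J C D \<longrightarrow>
        (\<exists>L \<pi>. is_limit J C D L \<pi>))"

definition is_product :: "('o, 'a) category \<Rightarrow> 'o \<Rightarrow> 'o \<Rightarrow> 'o \<Rightarrow> 'a \<Rightarrow> 'a \<Rightarrow> bool" where
  "is_product C X Y P p q \<longleftrightarrow> P \<in> Obj C \<and> p \<in> hom C P X \<and> q \<in> hom C P Y \<and>
     (\<forall>W\<in>Obj C. \<forall>f\<in>hom C W X. \<forall>g\<in>hom C W Y.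
        \<exists>!h. h \<in> hom C W P \<and> p \<cdot>\<^bsub>C\<^esub> h = f \<and> q \<cdot>\<^bsub>C\<^esub> h = g)"

text \<open>\<open>is_pullback C f g P p q\<close>: \<open>P\<close> is the pullback of \<open>f\<close> and \<open>g\<close>, with \<open>f \<cdot> p = g \<cdot> q\<close>.\<close>

definition is_pullback ::
    "('o, 'a) category \<Rightarrow> 'a \<Rightarrow> 'a \<Rightarrow> 'o \<Rightarrow> 'a \<Rightarrow> 'a \<Rightarrow> bool" where
  "is_pullback C f g P p q \<longleftrightarrow>
     f \<in> Arr C \<and> g \<in> Arr C \<and> Cod C f = Cod C g \<and>
     P \<in> Obj C \<and> p \<in> hom C P (Dom C f) \<and> q \<in> hom C P (Dom C g) \<and> f \<cdot>\<^bsub>C\<^esub> p = g \<cdot>\<^bsub>C\<^esub> q \<and>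
     (\<forall>W\<in>Obj C. \<forall>u\<in>hom C W (Dom C f). \<forall>v\<in>hom C W (Dom C g). f \<cdot>\<^bsub>C\<^esub> u = g \<cdot>\<^bsub>C\<^esub> v \<longrightarrow>
        (\<exists>!h. h \<in> hom C W P \<and> p \<cdot>\<^bsub>C\<^esub> h = u \<and> q \<cdot>\<^bsub>C\<^esub> h = v))"

definition is_coproduct ::
    "('o, 'a) category \<Rightarrow> 'i set \<Rightarrow> ('i \<Rightarrow> 'o) \<Rightarrow> 'o \<Rightarrow> ('i \<Rightarrow> 'a) \<Rightarrow> bool" where
  "is_coproduct C I X S \<iota> \<longleftrightarrow> S \<in> Obj C \<and> (\<forall>i\<in>I. X i \<in> Obj C \<and> \<iota> i \<in> hom C (X i) S) \<and>
     (\<forall>Y\<in>Obj C. \<forall>f. (\<forall>i\<in>I. f i \<in> hom C (X i) Y) \<longrightarrow>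
        (\<exists>!h. h \<in> hom C S Y \<and> (\<forall>i\<in>I. h \<cdot>\<^bsub>C\<^esub> \<iota> i = f i)))"

definition disjoint_coproduct ::
    "('o, 'a) category \<Rightarrow> 'i set \<Rightarrow> ('i \<Rightarrow> 'o) \<Rightarrow> 'o \<Rightarrow> ('i \<Rightarrow> 'a) \<Rightarrow> bool" where
  "disjoint_coproduct C I X S \<iota> \<longleftrightarrow>
     (\<forall>i\<in>I. monic C (\<iota> i)) \<and>
     (\<forall>i\<in>I. \<forall>j\<in>I. i \<noteq> j \<longrightarrow> (\<forall>P p q. is_pullback C (\<iota> i) (\<iota> j) P p q \<longrightarrow> is_initial C P))"

text \<open>
  Stability: for all choices of the pullbacks \<open>P i\<close> (with projections \<open>p i\<close> to \<open>D = Dom C f\<close>) and of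
  their coproduct \<open>Q\<close>, the comparison map \<open>Q \<rightarrow> D\<close> induced by the \<open>p i\<close> is an isomorphism.
\<close>

definition stable_coproduct ::
    "('o, 'a) category \<Rightarrow> 'i set \<Rightarrow> ('i \<Rightarrow> 'o) \<Rightarrow> 'o \<Rightarrow> ('i \<Rightarrow> 'a) \<Rightarrow> bool" where
  "stable_coproduct C I X S \<iota> \<longleftrightarrow>
     (\<forall>f P p q Q \<kappa> h.
        f \<in> Arr C \<and> Cod C f = S \<and>
        (\<forall>i\<in>I. is_pullback C f (\<iota> i) (P i) (p i) (q i)) \<and>
        is_coproduct C I P Q \<kappa> \<and>
        h \<in> hom C Q (Dom C f) \<and> (\<forall>i\<in>I. h \<cdot>\<^bsub>C\<^esub> \<kappa> i = p i) \<longrightarrow>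
        iso C h)"

definition parallel_pair :: "('o, 'a) category \<Rightarrow> 'a \<Rightarrow> 'a \<Rightarrow> bool" where
  "parallel_pair C d0 d1 \<longleftrightarrow>
     d0 \<in> Arr C \<and> d1 \<in> Arr C \<and> Dom C d0 = Dom C d1 \<and> Cod C d0 = Cod C d1"

definition is_coequalizer :: "('o, 'a) category \<Rightarrow> 'a \<Rightarrow> 'a \<Rightarrow> 'a \<Rightarrow> bool" where
  "is_coequalizer C d0 d1 q \<longleftrightarrow> parallel_pair C d0 d1 \<and>
     q \<in> Arr C \<and> Dom C q = Cod C d0 \<and> q \<cdot>\<^bsub>C\<^esub> d0 = q \<cdot>\<^bsub>C\<^esub> d1 \<and>
     (\<forall>W\<in>Obj C. \<forall>f\<in>hom C (Cod C d0) W. f \<cdot>\<^bsub>C\<^esub> d0 = f \<cdot>\<^bsub>C\<^esub> d1 \<longrightarrow>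
        (\<exists>!h. h \<in> hom C (Cod C q) W \<and> h \<cdot>\<^bsub>C\<^esub> q = f))"

definition is_kernel_pair :: "('o, 'a) category \<Rightarrow> 'a \<Rightarrow> 'a \<Rightarrow> 'a \<Rightarrow> bool" where
  "is_kernel_pair C d0 d1 f \<longleftrightarrow> parallel_pair C d0 d1 \<and> is_pullback C f f (Dom C d0) d0 d1"

definition factors_through :: "('o, 'a) category \<Rightarrow> 'a \<Rightarrow> 'a \<Rightarrow> bool" where
  "factors_through C f m \<longleftrightarrow> (\<exists>k\<in>hom C (Dom C f) (Dom C m). m \<cdot>\<^bsub>C\<^esub> k = f)"

text \<open>
  Below \<open>(P, p, q)\<close> is a product \<open>E \<times> E\<close> and \<open>r = (d0, d1)\<close>; arrows into \<open>P\<close> are described by their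
  two components.
\<close>

definition is_equivalence_relation ::
    "('o, 'a) category \<Rightarrow> 'o \<Rightarrow> 'a \<Rightarrow> 'a \<Rightarrow> bool" where
  "is_equivalence_relation C E d0 d1 \<longleftrightarrow> parallel_pair C d0 d1 \<and> Cod C d0 = E \<and>
     (\<exists>P p q r. is_product C E E P p q \<and>
        r \<in> hom C (Dom C d0) P \<and> p \<cdot>\<^bsub>C\<^esub> r = d0 \<and> q \<cdot>\<^bsub>C\<^esub> r = d1 \<and> monic C r \<and>
        (\<forall>\<delta>\<in>hom C E P. p \<cdot>\<^bsub>C\<^esub> \<delta> = Id C E \<and> q \<cdot>\<^bsub>C\<^esub> \<delta> = Id C E \<longrightarrow> factors_through C \<delta> r) \<and>
        (\<forall>s\<in>hom C (Dom C d0) P. p \<cdot>\<^bsub>C\<^esub> s = d1 \<and> q \<cdot>\<^bsub>C\<^esub> s = d0 \<longrightarrow> factors_through C s r) \<and>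
        (\<forall>T \<pi>0 \<pi>1. is_pullback C d1 d0 T \<pi>0 \<pi>1 \<longrightarrow>
           (\<forall>t\<in>hom C T P. p \<cdot>\<^bsub>C\<^esub> t = d1 \<cdot>\<^bsub>C\<^esub> \<pi>1 \<and> q \<cdot>\<^bsub>C\<^esub> t = d0 \<cdot>\<^bsub>C\<^esub> \<pi>0 \<longrightarrow> factors_through C t r)))"

definition exact_fork :: "('o, 'a) category \<Rightarrow> 'a \<Rightarrow> 'a \<Rightarrow> 'a \<Rightarrow> bool" where
  "exact_fork C d0 d1 q \<longleftrightarrow> is_kernel_pair C d0 d1 q \<and> is_coequalizer C d0 d1 q"

text \<open>
  The pullback of the fork \<open>X \<rightrightarrows> Y \<rightarrow> Z\<close> along \<open>g : Z' \<rightarrow> Z\<close> consists of the pullbacks \<open>X'\<close> and \<open>Y'\<close>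
  of \<open>X \<rightarrow> Z\<close> and \<open>Y \<rightarrow> Z\<close> along \<open>g\<close>, the induced arrows \<open>d0', d1' : X' \<rightarrow> Y'\<close>, and the
  projection \<open>q' : Y' \<rightarrow> Z'\<close>.
\<close>

definition pullback_fork ::
    "('o, 'a) category \<Rightarrow> 'a \<Rightarrow> 'a \<Rightarrow> 'a \<Rightarrow> 'a \<Rightarrow> 'a \<Rightarrow> 'a \<Rightarrow> 'a \<Rightarrow> bool" where
  "pullback_fork C d0 d1 q g d0' d1' q' \<longleftrightarrow>
     (\<exists>X' Y' x w y. is_pullback C (q \<cdot>\<^bsub>C\<^esub> d0) g X' x w \<and> is_pullback C q g Y' y q' \<and>
        d0' \<in> hom C X' Y' \<and> y \<cdot>\<^bsub>C\<^esub> d0' = d0 \<cdot>\<^bsub>C\<^esub> x \<and> q' \<cdot>\<^bsub>C\<^esub> d0' = w \<and>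
        d1' \<in> hom C X' Y' \<and> y \<cdot>\<^bsub>C\<^esub> d1' = d1 \<cdot>\<^bsub>C\<^esub> x \<and> q' \<cdot>\<^bsub>C\<^esub> d1' = w)"

definition stably_exact :: "('o, 'a) category \<Rightarrow> 'a \<Rightarrow> 'a \<Rightarrow> 'a \<Rightarrow> bool" where
  "stably_exact C d0 d1 q \<longleftrightarrow>
     (\<forall>g d0' d1' q'. g \<in> Arr C \<and> Cod C g = Cod C q \<and> pullback_fork C d0 d1 q g d0' d1' q' \<longrightarrow>
        exact_fork C d0' d1' q')"

definition generates :: "('o, 'a) category \<Rightarrow> 'o set \<Rightarrow> bool" where
  "generates C G \<longleftrightarrow>
     (\<forall>X\<in>Obj C. \<forall>Y\<in>Obj C. \<forall>u\<in>hom C X Y. \<forall>v\<in>hom C X Y.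
        (\<forall>A\<in>G. \<forall>w\<in>hom C A X. u \<cdot>\<^bsub>C\<^esub> w = v \<cdot>\<^bsub>C\<^esub> w) \<longrightarrow> u = v)"

section \<open>Giraud's axioms\<close>

definition small_homs :: "'u set \<Rightarrow> ('o, 'a) category \<Rightarrow> bool" where
  "small_homs U E \<longleftrightarrow> (\<forall>X\<in>Obj E. \<forall>Y\<in>Obj E. small U (hom E X Y))"

text \<open>Every small index set is in bijection with a small subset of \<open>U\<close>.\<close>

definition giraud_i :: "'u set \<Rightarrow> ('o, 'a) category \<Rightarrow> bool" where
  "giraud_i U E \<longleftrightarrow>
     (\<forall>I X. I \<subseteq> U \<and> small U I \<and> (\<forall>i\<in>I. X i \<in> Obj E) \<longrightarrow>
        (\<exists>S \<iota>. is_coproduct E I X S \<iota>) \<and>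
        (\<forall>S \<iota>. is_coproduct E I X S \<iota> \<longrightarrow>
           disjoint_coproduct E I X S \<iota> \<and> stable_coproduct E I X S \<iota>))"

definition giraud_ii :: "('o, 'a) category \<Rightarrow> bool" where
  "giraud_ii E \<longleftrightarrow> (\<forall>f. epic E f \<longrightarrow> (\<exists>d0 d1. is_coequalizer E d0 d1 f))"

definition giraud_iii :: "('o, 'a) category \<Rightarrow> bool" where
  "giraud_iii E \<longleftrightarrow>
     (\<forall>X\<in>Obj E. \<forall>d0 d1. is_equivalence_relation E X d0 d1 \<longrightarrow>
        (\<exists>f. is_kernel_pair E d0 d1 f) \<and> (\<exists>q. is_coequalizer E d0 d1 q))"

definition giraud_iv :: "('o, 'a) category \<Rightarrow> bool" where
  "giraud_iv E \<longleftrightarrow> (\<forall>d0 d1 q. exact_fork E d0 d1 q \<longrightarrow> stably_exact E d0 d1 q)"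

definition giraud_v :: "'u set \<Rightarrow> ('o, 'a) category \<Rightarrow> 'o set \<Rightarrow> bool" where
  "giraud_v U E G \<longleftrightarrow> G \<subseteq> Obj E \<and> small U G \<and> generates E G"

section \<open>Presheaves, Grothendieck topologies, sheaves\<close>

text \<open>
  The category of sets belonging to \<open>\<V>\<close>.  An arrow \<open>(A, B, f)\<close> is a function \<open>f : A \<rightarrow> B\<close>, taken to
  be \<open>undefined\<close> outside \<open>A\<close>.
\<close>

definition set_cat :: "'x set set \<Rightarrow> ('x set, 'x set \<times> 'x set \<times> ('x \<Rightarrow> 'x)) category" where
  "set_cat \<V> =
     \<lparr>Obj = \<V>,
      Arr = {(A, B, f). A \<in> \<V> \<and> B \<in> \<V> \<and> f \<in> A \<rightarrow>\<^sub>E B},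
      Dom = (\<lambda>(A, B, f). A),
      Cod = (\<lambda>(A, B, f). B),
      Id = (\<lambda>A. (A, A, \<lambda>x\<in>A. x)),
      Comp = (\<lambda>(B', D, g) (A, B, f). (A, D, \<lambda>x\<in>A. g (f x)))\<rparr>"

abbreviation fn :: "'x set \<times> 'x set \<times> ('x \<Rightarrow> 'x) \<Rightarrow> 'x \<Rightarrow> 'x" where
  "fn m \<equiv> snd (snd m)"

text \<open>
  Every small set is in bijection with a small subset of \<open>U\<close>, so these form a category of sets
  equivalent to that of all small sets.
\<close>

definition small_sets :: "'u set \<Rightarrow> 'u set set" where
  "small_sets U = {A. A \<subseteq> U \<and> small U A}"

type_synonym ('o, 'a, 'x) presheaf = "('o, 'a, 'x set, 'x set \<times> 'x set \<times> ('x \<Rightarrow> 'x)) fctr"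

definition hom_presheaf :: "('o, 'a) category \<Rightarrow> 'o \<Rightarrow> ('o, 'a, 'a) presheaf" where
  "hom_presheaf C X =
     \<lparr>FObj = (\<lambda>A. hom C A X),
      FArr = (\<lambda>f. (hom C (Cod C f) X, hom C (Dom C f) X, \<lambda>g\<in>hom C (Cod C f) X. g \<cdot>\<^bsub>C\<^esub> f))\<rparr>"

definition sieve :: "('o, 'a) category \<Rightarrow> 'o \<Rightarrow> 'a set \<Rightarrow> bool" where
  "sieve C X S \<longleftrightarrow> S \<subseteq> {f \<in> Arr C. Cod C f = X} \<and>
     (\<forall>f\<in>S. \<forall>g\<in>Arr C. Cod C g = Dom C f \<longrightarrow> f \<cdot>\<^bsub>C\<^esub> g \<in> S)"

definition pullback_sieve :: "('o, 'a) category \<Rightarrow> 'a \<Rightarrow> 'a set \<Rightarrow> 'a set" where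
  "pullback_sieve C f S = {g \<in> Arr C. Cod C g = Dom C f \<and> f \<cdot>\<^bsub>C\<^esub> g \<in> S}"

definition grothendieck_topology :: "('o, 'a) category \<Rightarrow> ('o \<Rightarrow> 'a set set) \<Rightarrow> bool" where
  "grothendieck_topology C J \<longleftrightarrow>
     (\<forall>X\<in>Obj C. \<forall>S\<in>J X. sieve C X S) \<and>
     (\<forall>X\<in>Obj C. {f \<in> Arr C. Cod C f = X} \<in> J X) \<and>
     (\<forall>f\<in>Arr C. \<forall>S\<in>J (Cod C f). pullback_sieve C f S \<in> J (Dom C f)) \<and>
     (\<forall>X\<in>Obj C. \<forall>S\<in>J X. \<forall>R. sieve C X R \<and> (\<forall>f\<in>S. pullback_sieve C f R \<in> J (Dom C f)) \<longrightarrow> R \<in> J X)"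

definition matching_family ::
    "('o, 'a) category \<Rightarrow> ('o, 'a, 'x) presheaf \<Rightarrow> 'a set \<Rightarrow> ('a \<Rightarrow> 'x) \<Rightarrow> bool" where
  "matching_family C F S x \<longleftrightarrow>
     (\<forall>f\<in>S. x f \<in> FObj F (Dom C f)) \<and>
     (\<forall>f\<in>S. \<forall>g\<in>Arr C. Cod C g = Dom C f \<longrightarrow> fn (FArr F g) (x f) = x (f \<cdot>\<^bsub>C\<^esub> g))"

definition is_sheaf ::
    "('o, 'a) category \<Rightarrow> ('o \<Rightarrow> 'a set set) \<Rightarrow> ('o, 'a, 'x) presheaf \<Rightarrow> bool" where
  "is_sheaf C J F \<longleftrightarrow> is_functor (op_cat C) (set_cat UNIV) F \<and>
     (\<forall>X\<in>Obj C. \<forall>S\<in>J X. \<forall>x. matching_family C F S x \<longrightarrow>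
        (\<exists>!a. a \<in> FObj F X \<and> (\<forall>f\<in>S. fn (FArr F f) a = x f)))"

text \<open>
  Sheaves of small sets and natural transformations.  Functors and transformations are taken to be
  \<open>undefined\<close> off the objects and arrows of \<open>C\<close>, so that equality is the intended one.
\<close>

definition sheaves ::
    "'u set \<Rightarrow> ('o, 'a) category \<Rightarrow> ('o \<Rightarrow> 'a set set) \<Rightarrow> ('o, 'a, 'u) presheaf set" where
  "sheaves U C J = {F. is_functor (op_cat C) (set_cat (small_sets U)) F \<and> is_sheaf C J F \<and>
     FObj F \<in> extensional (Obj C) \<and> FArr F \<in> extensional (Arr C)}"

definition Sh ::
    "'u set \<Rightarrow> ('o, 'a) category \<Rightarrow> ('o \<Rightarrow> 'a set set) \<Rightarrow>
     (('o, 'a, 'u) presheaf,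
      ('o, 'a, 'u) presheaf \<times> ('o, 'a, 'u) presheaf \<times> ('o \<Rightarrow> 'u set \<times> 'u set \<times> ('u \<Rightarrow> 'u)))
     category" where
  "Sh U C J =
     \<lparr>Obj = sheaves U C J,
      Arr = {(F, G, \<tau>). F \<in> sheaves U C J \<and> G \<in> sheaves U C J \<and>
        nat_trans (op_cat C) (set_cat (small_sets U)) F G \<tau> \<and> \<tau> \<in> extensional (Obj C)},
      Dom = (\<lambda>(F, G, \<tau>). F),
      Cod = (\<lambda>(F, G, \<tau>). G),
      Id = (\<lambda>F. (F, F, \<lambda>X\<in>Obj C. Id (set_cat (small_sets U)) (FObj F X))),
      Comp = (\<lambda>(G', H, \<sigma>) (F, G, \<tau>). (F, H, \<lambda>X\<in>Obj C. \<sigma> X \<cdot>\<^bsub>set_cat (small_sets U)\<^esub> \<tau> X))\<rparr>"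

text \<open>
  The canonical topology of \<open>E\<close> on the full subcategory on a set \<open>G\<close> of objects: the largest
  Grothendieck topology on that subcategory for which all presheaves represented by objects of the
  ambient category \<open>E\<close> are sheaves.  For \<open>G = Obj E\<close> this is the canonical topology of \<open>E\<close>.

  Testing only against the objects of \<open>G\<close> would not do.  If \<open>E\<close> is the category of sets and \<open>G\<close>
  consists of a one-point set, the only presheaf represented by an object of \<open>G\<close> is the constant one
  with value a point; it is a sheaf even if the empty sieve covers, and for the resulting topology
  the category of sheaves is trivial rather than equivalent to \<open>E\<close>.
\<close>

definition ambient_subcanonical ::
    "('o, 'a) category \<Rightarrow> 'o set \<Rightarrow> ('o \<Rightarrow> 'a set set) \<Rightarrow> bool" where
  "ambient_subcanonical E G J \<longleftrightarrow> grothendieck_topology (full_subcat E G) J \<and>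
     (\<forall>X\<in>Obj E. is_sheaf (full_subcat E G) J (hom_presheaf E X))"

definition is_canonical_topology_on ::
    "('o, 'a) category \<Rightarrow> 'o set \<Rightarrow> ('o \<Rightarrow> 'a set set) \<Rightarrow> bool" where
  "is_canonical_topology_on E G J \<longleftrightarrow> ambient_subcanonical E G J \<and>
     (\<forall>J'. ambient_subcanonical E G J' \<longrightarrow> (\<forall>A\<in>G. J' A \<subseteq> J A))"

end

theory Submission
  imports Defs
begin

text \<open>
  The equivalence sends an object \<open>X\<close> of \<open>E\<close> to the presheaf \<open>A \<mapsto> hom(A, X)\<close> on the generators.
  Everything rests on treating the arrows from generators as points: by axiom (v) two arrows, and by
  \<open>factors_through_monic_locally\<close> membership in a subobject, are determined by what happens at
  points, even at jointly epic families of points only.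

  Two facts about jointly epic families carry the argument.  A small jointly
  epic family on \<open>X\<close> is an epimorphism from a coproduct onto \<open>X\<close>.  As epimorphisms coequalize their
  kernel pairs, (i) and (iv) make the pullback of the family along any arrow jointly epic
  (\<open>lifting_points_jointly_epic\<close>).  By (ii) the family is effective: compatible arrows on its members
  glue to an arrow out of \<open>X\<close> (\<open>glue_arrows\<close>).  Hence the jointly epic sieves are a topology for which
  all presheaves \<open>hom(-, X)\<close> are sheaves.  No such topology can have a covering sieve that is not
  jointly epic, so this is the canonical one (\<open>canonical_is_canonical\<close>).

  The functor is faithful because the points of \<open>X\<close> are jointly epic, and full because a natural
  transformation \<open>hom(-, X) \<rightarrow> hom(-, Y)\<close> is a compatible family of arrows on the points of \<open>X\<close>, which
  glues.  For essential surjectivity, a sheaf \<open>F\<close> is presented by generators and relations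
  (\<open>sheaf_representable\<close>).  Let \<open>S\<close> be the coproduct of a copy of \<open>A\<close> for every section \<open>a \<in> F(A)\<close>.
  Coproducts being disjoint, a point of \<open>S\<close> lies locally in an essentially unique summand, so the
  sheaf property yields a natural map \<open>\<phi>\<close> from the points of \<open>S\<close> to the sections of \<open>F\<close>
  (\<open>extend_to_points\<close>).  The pairs of points with equal image under \<open>\<phi>\<close> are the points of a subobject
  \<open>R\<close> of \<open>S \<times> S\<close>, obtained as the image of a coproduct of generators; images exist as quotients by
  kernel pairs, by (iii).  By (iii) again \<open>R\<close> is the kernel pair of a quotient \<open>S \<rightarrow> X\<close>, and \<open>\<phi>\<close>
  induces a bijection from the points of \<open>X\<close> to the sections of \<open>F\<close>.
\<close>

section \<open>Small sets\<close>

lemma small_subset: "X \<subseteq> Y \<Longrightarrow> small U Y \<Longrightarrow> small U X"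
  unfolding small_def by (meson lesspoll_trans1 subset_imp_lepoll)

lemma small_image: "small U X \<Longrightarrow> small U (f ` X)"
  unfolding small_def by (meson image_lepoll lesspoll_trans1)

lemma small_finite: "universe U \<Longrightarrow> finite X \<Longrightarrow> small U X"
  unfolding small_def universe_def by (simp add: finite_lesspoll_infinite)

lemma small_embedding:
  assumes "small U X"
  obtains f where "inj_on f X" "f ` X \<subseteq> U"
  using assms unfolding small_def lesspoll_def lepoll_def by blast

lemma small_of_inj_on_image: "inj_on f X \<Longrightarrow> small U (f ` X) \<Longrightarrow> small U X"
  unfolding small_def by simp

lemma square_embedding:
  assumes "infinite U"
  obtains p where "inj_on p (U \<times> U)" "p ` (U \<times> U) \<subseteq> U"
  using card_of_Times_same_infinite[OF assms] unfolding card_of_ordIso[symmetric] bij_betw_def by blast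

text \<open>
  The union axiom of a universe only speaks of sets of subsets of \<open>U\<close>.  Since \<open>U \<times> U\<close> embeds
  into the infinite set \<open>U\<close>, the summands of a disjoint union can be realised inside \<open>U\<close> so that
  they stay disjoint, and the axiom applies.
\<close>

lemma small_Sigma:
  assumes U: "universe U" and I: "small U I" and Y: "\<And>i. i \<in> I \<Longrightarrow> small U (Y i)"
  shows "small U (Sigma I Y)"
proof -
  obtain e where e: "inj_on e I" "e ` I \<subseteq> U"
    using I by (rule small_embedding)
  have "\<exists>f. inj_on f (Y i) \<and> f ` Y i \<subseteq> U" if "i \<in> I" for i
    using Y[OF that] by (meson small_embedding)
  then obtain f where f: "\<And>i. i \<in> I \<Longrightarrow> inj_on (f i) (Y i) \<and> f i ` Y i \<subseteq> U"
    by metis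
  obtain p where p: "inj_on p (U \<times> U)" "p ` (U \<times> U) \<subseteq> U"
    using U square_embedding unfolding universe_def by blast
  define c where "c = (\<lambda>(i, y). p (e i, f i y))"
  have inj: "inj_on c (Sigma I Y)"
  proof (rule inj_onI)
    fix z z' assume "z \<in> Sigma I Y" "z' \<in> Sigma I Y" and "c z = c z'"
    then obtain i y i' y' where z: "z = (i, y)" "i \<in> I" "y \<in> Y i" "z' = (i', y')" "i' \<in> I" "y' \<in> Y i'"
      by blast
    then have "p (e i, f i y) = p (e i', f i' y')"
      using \<open>c z = c z'\<close> by (simp add: c_def)
    then have "(e i, f i y) = (e i', f i' y')"
      by (rule inj_onD[OF p(1)]) (use z e f in auto)
    then show "z = z'"
      using z e f by (auto dest: inj_onD)
  qed
  let ?X = "(\<lambda>i. c ` ({i} \<times> Y i)) ` I"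
  have "?X \<subseteq> Pow U"
    using p e f by (auto simp: c_def image_subset_iff)
  moreover have "small U ?X"
    using I by (rule small_image)
  moreover have "small U X" if X: "X \<in> ?X" for X
  proof -
    obtain i where i: "i \<in> I" "X = c ` ({i} \<times> Y i)"
      using X by blast
    have "X = (c \<circ> Pair i) ` Y i"
      using i by (auto simp: image_iff)
    then show ?thesis
      using small_image[OF Y] i by simp
  qed
  ultimately have "small U (\<Union>?X)"
    using U unfolding universe_def by blast
  moreover have "c ` Sigma I Y = \<Union>?X"
    by auto
  ultimately show ?thesis
    using small_of_inj_on_image[OF inj] by simp
qed

section \<open>Arrows, limits and equivalences in a category\<close>

lemma homD: "f \<in> hom C X Y \<Longrightarrow> f \<in> Arr C \<and> Dom C f = X \<and> Cod C f = Y"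
  by (simp add: hom_def)

lemma Arr_hom: "f \<in> Arr C \<Longrightarrow> f \<in> hom C (Dom C f) (Cod C f)"
  by (simp add: hom_def)

context category
begin

lemma hom_Obj: "f \<in> hom C X Y \<Longrightarrow> X \<in> Obj C \<and> Y \<in> Obj C"
  using Dom_in_Obj Cod_in_Obj by (auto simp: hom_def)

lemma Dom_Comp [simp]: "f \<in> Arr C \<Longrightarrow> g \<in> Arr C \<Longrightarrow> Cod C f = Dom C g \<Longrightarrow> Dom C (g \<cdot> f) = Dom C f"
  and Cod_Comp [simp]: "f \<in> Arr C \<Longrightarrow> g \<in> Arr C \<Longrightarrow> Cod C f = Dom C g \<Longrightarrow> Cod C (g \<cdot> f) = Cod C g"
  and Comp_Arr [simp]: "f \<in> Arr C \<Longrightarrow> g \<in> Arr C \<Longrightarrow> Cod C f = Dom C g \<Longrightarrow> g \<cdot> f \<in> Arr C"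
  using Comp_in_hom[of f "Dom C f" "Cod C f" g "Cod C g"] by (auto simp: hom_def)

lemma Id_simps [simp]: "X \<in> Obj C \<Longrightarrow> Dom C (Id C X) = X"
    "X \<in> Obj C \<Longrightarrow> Cod C (Id C X) = X" "X \<in> Obj C \<Longrightarrow> Id C X \<in> Arr C"
    "f \<in> Arr C \<Longrightarrow> Cod C f = X \<Longrightarrow> Id C X \<cdot> f = f" "f \<in> Arr C \<Longrightarrow> Dom C f = X \<Longrightarrow> f \<cdot> Id C X = f"
  using Id_in_hom Comp_Id_left Comp_Id_right by (auto simp: hom_def)

lemma isoI:
  assumes "f \<in> hom C X Y" "g \<in> hom C Y X" "g \<cdot> f = Id C X" "f \<cdot> g = Id C Y"
  shows "iso C f"
  using assms unfolding iso_def by (auto simp: hom_def)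

lemma isoE:
  assumes "iso C f" "f \<in> hom C X Y"
  obtains g where "g \<in> hom C Y X" "g \<cdot> f = Id C X" "f \<cdot> g = Id C Y"
  using assms unfolding iso_def by (auto simp: hom_def)

lemma monicD: "monic C m \<Longrightarrow> m \<in> hom C X Y \<Longrightarrow> u \<in> hom C W X \<Longrightarrow> v \<in> hom C W X \<Longrightarrow>
    m \<cdot> u = m \<cdot> v \<Longrightarrow> u = v"
  unfolding monic_def using hom_Obj[of u W X] homD[of m C X Y] by blast

lemma productE:
  assumes "is_product C X Y P p q" "f \<in> hom C W X" "g \<in> hom C W Y"
  obtains h where "h \<in> hom C W P" "p \<cdot> h = f" "q \<cdot> h = g"
proof -
  have "\<exists>!h. h \<in> hom C W P \<and> p \<cdot> h = f \<and> q \<cdot> h = g"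
    using assms hom_Obj unfolding is_product_def by blast
  then show ?thesis
    using that by blast
qed

lemma product_hom: "is_product C X Y P p q \<Longrightarrow> p \<in> hom C P X \<and> q \<in> hom C P Y"
  unfolding is_product_def by blast

lemma product_eq:
  assumes "is_product C X Y P p q" "h \<in> hom C W P" "h' \<in> hom C W P" "p \<cdot> h = p \<cdot> h'" "q \<cdot> h = q \<cdot> h'"
  shows "h = h'"
proof -
  have "p \<cdot> h' \<in> hom C W X" "q \<cdot> h' \<in> hom C W Y"
    using assms product_hom Comp_in_hom by blast+
  then have "\<exists>!k. k \<in> hom C W P \<and> p \<cdot> k = p \<cdot> h' \<and> q \<cdot> k = q \<cdot> h'"
    using assms(1,2) hom_Obj unfolding is_product_def by blast
  then show ?thesis
    using assms by blast
qed

lemma pullback_hom: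
  assumes "is_pullback C f g P p q" "f \<in> hom C X Z" "g \<in> hom C Y Z"
  shows "p \<in> hom C P X" "q \<in> hom C P Y" "f \<cdot> p = g \<cdot> q"
  using assms unfolding is_pullback_def by (auto dest: homD)

lemma pullbackE:
  assumes "is_pullback C f g P p q" "f \<in> hom C X Z" "g \<in> hom C Y Z"
    and "u \<in> hom C W X" "v \<in> hom C W Y" "f \<cdot> u = g \<cdot> v"
  obtains h where "h \<in> hom C W P" "p \<cdot> h = u" "q \<cdot> h = v"
proof -
  have "W \<in> Obj C" "u \<in> hom C W (Dom C f)" "v \<in> hom C W (Dom C g)"
    using assms hom_Obj by (auto dest: homD)
  then have "\<exists>!h. h \<in> hom C W P \<and> p \<cdot> h = u \<and> q \<cdot> h = v"
    using assms(1,6) unfolding is_pullback_def by blast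
  then show ?thesis
    using that by blast
qed

lemma pullback_eq:
  assumes "is_pullback C f g P p q" and h: "h \<in> hom C W P" "h' \<in> hom C W P" "p \<cdot> h = p \<cdot> h'" "q \<cdot> h = q \<cdot> h'"
  shows "h = h'"
proof -
  have pq: "p \<in> hom C P (Dom C f)" "q \<in> hom C P (Dom C g)" "f \<cdot> p = g \<cdot> q"
      "f \<in> Arr C" "g \<in> Arr C" "Cod C f = Cod C g"
    using assms(1) unfolding is_pullback_def by auto
  have 1: "p \<cdot> h' \<in> hom C W (Dom C f)" "q \<cdot> h' \<in> hom C W (Dom C g)"
    using pq h Comp_in_hom by blast+
  have 2: "f \<cdot> (p \<cdot> h') = g \<cdot> (q \<cdot> h')"
    using Comp_assoc[OF h(2) pq(1) Arr_hom[OF pq(4)]] Comp_assoc[OF h(2) pq(2) Arr_hom[OF pq(5)]] pq(3) by simp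
  have "\<exists>!k. k \<in> hom C W P \<and> p \<cdot> k = p \<cdot> h' \<and> q \<cdot> k = q \<cdot> h'"
    using assms(1) hom_Obj[OF h(1)] 1 2 unfolding is_pullback_def by blast
  then show ?thesis
    using h by blast
qed

lemma coproduct_hom: "is_coproduct C I X S \<iota> \<Longrightarrow> i \<in> I \<Longrightarrow> \<iota> i \<in> hom C (X i) S"
  unfolding is_coproduct_def by blast

lemma coproduct_Obj: "is_coproduct C I X S \<iota> \<Longrightarrow> S \<in> Obj C"
  unfolding is_coproduct_def by blast

lemma coproduct_ex1:
  assumes "is_coproduct C I X S \<iota>" "Y \<in> Obj C" "\<And>i. i \<in> I \<Longrightarrow> f i \<in> hom C (X i) Y"
  shows "\<exists>!h. h \<in> hom C S Y \<and> (\<forall>i\<in>I. h \<cdot> \<iota> i = f i)"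
  using assms unfolding is_coproduct_def by blast

lemma coproductE:
  assumes "is_coproduct C I X S \<iota>" "Y \<in> Obj C" "\<And>i. i \<in> I \<Longrightarrow> f i \<in> hom C (X i) Y"
  obtains h where "h \<in> hom C S Y" "\<And>i. i \<in> I \<Longrightarrow> h \<cdot> \<iota> i = f i"
  using coproduct_ex1[OF assms] that by blast

lemma coproduct_eq:
  assumes "is_coproduct C I X S \<iota>" "h \<in> hom C S Y" "h' \<in> hom C S Y" "\<And>i. i \<in> I \<Longrightarrow> h \<cdot> \<iota> i = h' \<cdot> \<iota> i"
  shows "h = h'"
proof -
  have "Y \<in> Obj C"
    using hom_Obj[OF assms(2)] by blast
  moreover have "\<And>i. i \<in> I \<Longrightarrow> h \<cdot> \<iota> i \<in> hom C (X i) Y"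
    using assms(2) coproduct_hom[OF assms(1)] Comp_in_hom by blast
  ultimately have "\<exists>!k. k \<in> hom C S Y \<and> (\<forall>i\<in>I. k \<cdot> \<iota> i = h \<cdot> \<iota> i)"
    by (rule coproduct_ex1[OF assms(1)])
  moreover have "h \<in> hom C S Y \<and> (\<forall>i\<in>I. h \<cdot> \<iota> i = h \<cdot> \<iota> i)"
      "h' \<in> hom C S Y \<and> (\<forall>i\<in>I. h' \<cdot> \<iota> i = h \<cdot> \<iota> i)"
    using assms(2-4) by auto
  ultimately show ?thesis
    by blast
qed

text \<open>
  Axiom (i) only speaks of index sets contained in \<open>U\<close>; coproducts over any other small index set,
  such as a set of arrows, are obtained by renaming the indices.
\<close>

lemma coproduct_reindex:
  assumes g: "bij_betw g K K'" and K': "is_coproduct C K' X' S \<iota>'"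
    and X: "\<And>k. k \<in> K \<Longrightarrow> X k = X' (g k)" and \<iota>: "\<And>k. k \<in> K \<Longrightarrow> \<iota> k = \<iota>' (g k)"
  shows "is_coproduct C K X S \<iota>"
  unfolding is_coproduct_def
proof (intro conjI ballI allI impI)
  have gK: "k \<in> K \<Longrightarrow> g k \<in> K'" for k
    using g by (auto simp: bij_betw_def)
  show "S \<in> Obj C"
    using K' by (rule coproduct_Obj)
  show h: "X k \<in> Obj C" "\<iota> k \<in> hom C (X k) S" if "k \<in> K" for k
    using K' X \<iota> gK that unfolding is_coproduct_def by auto
  fix Y f assume Y: "Y \<in> Obj C" and f: "\<forall>i\<in>K. f i \<in> hom C (X i) Y"
  have inv: "k' \<in> K' \<Longrightarrow> inv_into K g k' \<in> K \<and> g (inv_into K g k') = k'" for k'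
    using g by (metis bij_betw_imp_surj_on f_inv_into_f inv_into_into)
  obtain h where h: "h \<in> hom C S Y" "\<And>i. i \<in> K' \<Longrightarrow> h \<cdot> \<iota>' i = f (inv_into K g i)"
    using coproductE[OF K' Y, of "\<lambda>k'. f (inv_into K g k')"] f X inv by metis
  have hk: "h \<cdot> \<iota> k = f k" if "k \<in> K" for k
    using h(2)[OF gK[OF that]] \<iota>[OF that] bij_betw_inv_into_left[OF g that] by simp
  show "\<exists>!h. h \<in> hom C S Y \<and> (\<forall>i\<in>K. h \<cdot> \<iota> i = f i)"
  proof (rule ex1I)
    show "h \<in> hom C S Y \<and> (\<forall>i\<in>K. h \<cdot> \<iota> i = f i)"
      using h hk by blast
    fix h' assume h': "h' \<in> hom C S Y \<and> (\<forall>i\<in>K. h' \<cdot> \<iota> i = f i)"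
    have "h' \<cdot> \<iota>' k' = h \<cdot> \<iota>' k'" if "k' \<in> K'" for k'
      using inv[OF that] \<iota> h' hk by metis
    then show "h' = h"
      using coproduct_eq[OF K' _ h(1)] h' by blast
  qed
qed

lemma pullback_exists:
  assumes "has_finite_limits C" and f: "f \<in> hom C X Z" and g: "g \<in> hom C Y Z"
  obtains P p q where "is_pullback C f g P p q"
proof -
  (* The cospan: objects 0, 1, 2 with their identities, and the arrows 3 : 0 -> 2 and 4 : 1 -> 2. *)
  define J :: "(nat, nat) category" where "J =
    \<lparr>Obj = {0, 1, 2}, Arr = {0, 1, 2, 3, 4},
     Dom = (\<lambda>a. if a = 3 then 0 else if a = 4 then 1 else a), Cod = (\<lambda>a. if a \<ge> 3 then 2 else a),
     Id = (\<lambda>x. x), Comp = (\<lambda>b a. if b \<le> 2 then a else b)\<rparr>"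
  define D where "D = \<lparr>FObj = (\<lambda>n::nat. if n = 0 then X else if n = 1 then Y else Z),
    FArr = (\<lambda>a::nat. if a = 0 then Id C X else if a = 1 then Id C Y else if a = 2 then Id C Z
      else if a = 3 then f else g)\<rparr>"
  have obj: "X \<in> Obj C" "Y \<in> Obj C" "Z \<in> Obj C"
    using f g hom_Obj by auto
  have fg: "f \<in> Arr C" "g \<in> Arr C" "Dom C f = X" "Dom C g = Y" "Cod C f = Z" "Cod C g = Z"
    using f g by (auto dest: homD)
  have "category J"
    by unfold_locales (auto simp: J_def hom_def)
  moreover have "is_functor J C D"
    using f g obj fg unfolding is_functor_def
    by (auto simp: J_def D_def Id_in_hom)
  moreover have "finite (Obj J)" "finite (Arr J)"
    by (auto simp: J_def)
  ultimately obtain L \<pi> where L: "is_limit J C D L \<pi>"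
    using assms(1) unfolding has_finite_limits_def by blast
  have cone: "L \<in> Obj C" "\<pi> 0 \<in> hom C L X" "\<pi> 1 \<in> hom C L Y" "\<pi> 2 \<in> hom C L Z"
      "f \<cdot> \<pi> 0 = \<pi> 2" "g \<cdot> \<pi> 1 = \<pi> 2"
    using L unfolding is_limit_def is_cone_def by (auto simp: J_def D_def)
  have "is_pullback C f g L (\<pi> 0) (\<pi> 1)"
    unfolding is_pullback_def
  proof (intro conjI ballI impI)
    fix W u v assume W: "W \<in> Obj C" and uv: "u \<in> hom C W (Dom C f)" "v \<in> hom C W (Dom C g)" "f \<cdot> u = g \<cdot> v"
    let ?\<rho> = "\<lambda>j::nat. if j = 0 then u else if j = 1 then v else f \<cdot> u"
    have "f \<cdot> u \<in> hom C W Z"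
      using uv f fg Comp_in_hom by metis
    then have "is_cone J C D W ?\<rho>"
      using W uv fg unfolding is_cone_def
      by (auto simp: J_def D_def dest: homD)
    then have "\<exists>!h. h \<in> hom C W L \<and> (\<forall>j\<in>Obj J. \<pi> j \<cdot> h = ?\<rho> j)"
      using L unfolding is_limit_def by blast
    moreover have "(\<forall>j\<in>Obj J. \<pi> j \<cdot> h = ?\<rho> j) \<longleftrightarrow> \<pi> 0 \<cdot> h = u \<and> \<pi> 1 \<cdot> h = v" if "h \<in> hom C W L" for h
    proof -
      have "\<pi> 2 \<cdot> h = f \<cdot> (\<pi> 0 \<cdot> h)"
        using cone that f Comp_assoc by metis
      then show ?thesis
        by (auto simp: J_def)
    qed
    ultimately show "\<exists>!h. h \<in> hom C W L \<and> \<pi> 0 \<cdot> h = u \<and> \<pi> 1 \<cdot> h = v"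
      by metis
  qed (use cone fg in auto)
  then show ?thesis
    by (rule that)
qed

lemma product_exists:
  assumes "has_finite_limits C" and obj: "X \<in> Obj C" "Y \<in> Obj C"
  obtains P p q where "is_product C X Y P p q"
proof -
  (* The discrete category on 0 and 1. *)
  define J :: "(nat, nat) category" where "J =
    \<lparr>Obj = {0, 1}, Arr = {0, 1}, Dom = (\<lambda>a. a), Cod = (\<lambda>a. a), Id = (\<lambda>x. x), Comp = (\<lambda>b a. a)\<rparr>"
  define D where "D = \<lparr>FObj = (\<lambda>n::nat. if n = 0 then X else Y),
    FArr = (\<lambda>a::nat. if a = 0 then Id C X else Id C Y)\<rparr>"
  have "category J"
    by unfold_locales (auto simp: J_def hom_def)
  moreover have "is_functor J C D"
    using obj unfolding is_functor_def by (auto simp: J_def D_def Id_in_hom)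
  moreover have "finite (Obj J)" "finite (Arr J)"
    by (auto simp: J_def)
  ultimately obtain L \<pi> where L: "is_limit J C D L \<pi>"
    using assms(1) unfolding has_finite_limits_def by blast
  have cone: "L \<in> Obj C" "\<pi> 0 \<in> hom C L X" "\<pi> 1 \<in> hom C L Y"
    using L unfolding is_limit_def is_cone_def by (auto simp: J_def D_def)
  have "is_product C X Y L (\<pi> 0) (\<pi> 1)"
    unfolding is_product_def
  proof (intro conjI ballI)
    fix W u v assume W: "W \<in> Obj C" and uv: "u \<in> hom C W X" "v \<in> hom C W Y"
    let ?\<rho> = "\<lambda>j::nat. if j = 0 then u else v"
    have "is_cone J C D W ?\<rho>"
      using W uv unfolding is_cone_def by (auto simp: J_def D_def dest: homD)
    then have "\<exists>!h. h \<in> hom C W L \<and> (\<forall>j\<in>Obj J. \<pi> j \<cdot> h = ?\<rho> j)"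
      using L unfolding is_limit_def by blast
    then show "\<exists>!h. h \<in> hom C W L \<and> \<pi> 0 \<cdot> h = u \<and> \<pi> 1 \<cdot> h = v"
      by (simp add: J_def)
  qed (use cone in auto)
  then show ?thesis
    by (rule that)
qed

end

text \<open>
  A quasi-inverse chooses for every object \<open>Y\<close> of \<open>D\<close> an object \<open>GY\<close> and an isomorphism
  \<open>e Y : F(GY) \<rightarrow> Y\<close>; everything else is forced by full faithfulness of \<open>F\<close>.
\<close>

lemma equivalence_of_fully_faithful_essentially_surjective:
  assumes C: "category C" and D: "category D" and F: "is_functor C D F"
    and faithful: "\<And>X Y f g. f \<in> hom C X Y \<Longrightarrow> g \<in> hom C X Y \<Longrightarrow> FArr F f = FArr F g \<Longrightarrow> f = g"
    and full: "\<And>X Y t. X \<in> Obj C \<Longrightarrow> Y \<in> Obj C \<Longrightarrow> t \<in> hom D (FObj F X) (FObj F Y) \<Longrightarrow>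
      \<exists>f\<in>hom C X Y. FArr F f = t"
    and ess: "\<And>Y. Y \<in> Obj D \<Longrightarrow> \<exists>X\<in>Obj C. \<exists>e\<in>hom D (FObj F X) Y. iso D e"
  shows "equivalent_categories C D"
proof -
  interpret C: category C by (rule C)
  interpret D: category D by (rule D)
  have FO: "X \<in> Obj C \<Longrightarrow> FObj F X \<in> Obj D" for X
    using F unfolding is_functor_def by blast
  have FA: "f \<in> hom C X Y \<Longrightarrow> FArr F f \<in> hom D (FObj F X) (FObj F Y)" for f X Y
    using F unfolding is_functor_def hom_def by auto
  have FI: "X \<in> Obj C \<Longrightarrow> FArr F (Id C X) = Id D (FObj F X)" for X
    using F unfolding is_functor_def by blast
  have FC: "f \<in> hom C X Y \<Longrightarrow> g \<in> hom C Y Z \<Longrightarrow> FArr F (g \<cdot>\<^bsub>C\<^esub> f) = FArr F g \<cdot>\<^bsub>D\<^esub> FArr F f" for f g X Y Z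
    using F unfolding is_functor_def hom_def by auto
  obtain G e where G: "\<And>Y. Y \<in> Obj D \<Longrightarrow> G Y \<in> Obj C"
    and e: "\<And>Y. Y \<in> Obj D \<Longrightarrow> e Y \<in> hom D (FObj F (G Y)) Y" and iso_e: "\<And>Y. Y \<in> Obj D \<Longrightarrow> iso D (e Y)"
    using ess by metis
  have "\<exists>k. k \<in> hom D Y (FObj F (G Y)) \<and> k \<cdot>\<^bsub>D\<^esub> e Y = Id D (FObj F (G Y)) \<and> e Y \<cdot>\<^bsub>D\<^esub> k = Id D Y"
    if "Y \<in> Obj D" for Y
    using D.isoE[OF iso_e e] that by metis
  then obtain k where k: "\<And>Y. Y \<in> Obj D \<Longrightarrow> k Y \<in> hom D Y (FObj F (G Y))"
    and ke: "\<And>Y. Y \<in> Obj D \<Longrightarrow> k Y \<cdot>\<^bsub>D\<^esub> e Y = Id D (FObj F (G Y))"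
    and ek: "\<And>Y. Y \<in> Obj D \<Longrightarrow> e Y \<cdot>\<^bsub>D\<^esub> k Y = Id D Y"
    by metis
  define conj where "conj t = k (Cod D t) \<cdot>\<^bsub>D\<^esub> (t \<cdot>\<^bsub>D\<^esub> e (Dom D t))" for t
  have conj: "conj t \<in> hom D (FObj F (G X)) (FObj F (G Y))" if "t \<in> hom D X Y" for t X Y
  proof -
    have "t \<cdot>\<^bsub>D\<^esub> e X \<in> hom D (FObj F (G X)) Y"
      using that e D.hom_Obj D.Comp_in_hom by metis
    then show ?thesis
      using that k D.hom_Obj D.Comp_in_hom unfolding conj_def by (metis homD)
  qed
  have "\<exists>f. t \<in> Arr D \<longrightarrow> f \<in> hom C (G (Dom D t)) (G (Cod D t)) \<and> FArr F f = conj t" for t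
    using full[of "G (Dom D t)" "G (Cod D t)" "conj t"] conj[OF Arr_hom] G D.Dom_in_Obj D.Cod_in_Obj
    by metis
  then obtain g where g': "\<And>t. t \<in> Arr D \<Longrightarrow> g t \<in> hom C (G (Dom D t)) (G (Cod D t)) \<and> FArr F (g t) = conj t"
    by metis
  have g: "g t \<in> hom C (G X) (G Y)" "FArr F (g t) = conj t" if "t \<in> hom D X Y" for t X Y
    using g'[of t] that by (auto dest: homD)
  have e_conj: "e Y \<cdot>\<^bsub>D\<^esub> conj t = t \<cdot>\<^bsub>D\<^esub> e X" if t: "t \<in> hom D X Y" for t X Y
  proof -
    have XY: "X \<in> Obj D" "Y \<in> Obj D"
      using D.hom_Obj[OF t] by auto
    have te: "t \<cdot>\<^bsub>D\<^esub> e X \<in> hom D (FObj F (G X)) Y"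
      using t e[OF XY(1)] D.Comp_in_hom by blast
    have "e Y \<cdot>\<^bsub>D\<^esub> conj t = (e Y \<cdot>\<^bsub>D\<^esub> k Y) \<cdot>\<^bsub>D\<^esub> (t \<cdot>\<^bsub>D\<^esub> e X)"
      using D.Comp_assoc[OF te k e] XY homD[OF t] unfolding conj_def by simp
    then show ?thesis
      using ek[OF XY(2)] D.Comp_Id_left[OF te] by simp
  qed
  have cancel_e: "a = b" if "a \<in> hom D W (FObj F (G Y))" "b \<in> hom D W (FObj F (G Y))"
      "e Y \<cdot>\<^bsub>D\<^esub> a = e Y \<cdot>\<^bsub>D\<^esub> b" "Y \<in> Obj D" for a b W Y
    using that D.Comp_assoc[OF that(1) e k] D.Comp_assoc[OF that(2) e k] ke D.Comp_Id_left by metis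
  define GF where "GF = \<lparr>FObj = G, FArr = g\<rparr>"
  have G_functor: "is_functor D C GF"
    unfolding is_functor_def
  proof (intro conjI ballI impI)
    fix Y assume Y: "Y \<in> Obj D"
    show "FObj GF Y \<in> Obj C"
      using G Y by (simp add: GF_def)
    have I: "Id D Y \<in> hom D Y Y"
      using Y by (rule D.Id_in_hom)
    have "conj (Id D Y) = Id D (FObj F (G Y))"
      using Y D.Comp_Id_left[OF e[OF Y]] ke[OF Y] by (simp add: conj_def)
    then have "FArr F (g (Id D Y)) = FArr F (Id C (G Y))"
      using g[OF I] FI[OF G[OF Y]] by simp
    then show "FArr GF (Id D Y) = Id C (FObj GF Y)"
      using faithful g[OF I] C.Id_in_hom[OF G[OF Y]] by (auto simp: GF_def)
  next
    fix t assume "t \<in> Arr D"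
    then show "FArr GF t \<in> hom C (FObj GF (Dom D t)) (FObj GF (Cod D t))"
      using g' by (simp add: GF_def)
  next
    fix s t assume st: "s \<in> Arr D" "t \<in> Arr D" "Cod D s = Dom D t"
    define X Y Z where "X = Dom D s" and "Y = Dom D t" and "Z = Cod D t"
    have s: "s \<in> hom D X Y" and t: "t \<in> hom D Y Z"
      using st by (auto simp: hom_def X_def Y_def Z_def)
    have ts: "t \<cdot>\<^bsub>D\<^esub> s \<in> hom D X Z"
      using s t by (rule D.Comp_in_hom)
    have XYZ: "X \<in> Obj D" "Y \<in> Obj D" "Z \<in> Obj D"
      using s t D.hom_Obj by auto
    have "e Z \<cdot>\<^bsub>D\<^esub> (conj t \<cdot>\<^bsub>D\<^esub> conj s) = (t \<cdot>\<^bsub>D\<^esub> e Y) \<cdot>\<^bsub>D\<^esub> conj s"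
      using e_conj[OF t] D.Comp_assoc[OF conj[OF s] conj[OF t] e[OF XYZ(3)]] by simp
    also have "\<dots> = t \<cdot>\<^bsub>D\<^esub> (s \<cdot>\<^bsub>D\<^esub> e X)"
      using D.Comp_assoc[OF conj[OF s] e[OF XYZ(2)] t] e_conj[OF s] by simp
    also have "\<dots> = e Z \<cdot>\<^bsub>D\<^esub> conj (t \<cdot>\<^bsub>D\<^esub> s)"
      using D.Comp_assoc[OF e[OF XYZ(1)] s t] e_conj[OF ts] by simp
    finally have "conj t \<cdot>\<^bsub>D\<^esub> conj s = conj (t \<cdot>\<^bsub>D\<^esub> s)"
      using cancel_e[OF D.Comp_in_hom[OF conj[OF s] conj[OF t]] conj[OF ts]] XYZ by blast
    then have "FArr F (g t \<cdot>\<^bsub>C\<^esub> g s) = FArr F (g (t \<cdot>\<^bsub>D\<^esub> s))"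
      using FC[OF g(1)[OF s] g(1)[OF t]] g(2)[OF s] g(2)[OF t] g(2)[OF ts] by simp
    then show "FArr GF (t \<cdot>\<^bsub>D\<^esub> s) = FArr GF t \<cdot>\<^bsub>C\<^esub> FArr GF s"
      using faithful[OF C.Comp_in_hom[OF g(1)[OF s] g(1)[OF t]] g(1)[OF ts]] by (simp add: GF_def)
  qed
  have "\<exists>n. X \<in> Obj C \<longrightarrow> n \<in> hom C X (G (FObj F X)) \<and> FArr F n = k (FObj F X)" for X
    using full[of X "G (FObj F X)" "k (FObj F X)"] k G FO by blast
  then obtain n where n: "\<And>X. X \<in> Obj C \<Longrightarrow> n X \<in> hom C X (G (FObj F X))"
    and Fn: "\<And>X. X \<in> Obj C \<Longrightarrow> FArr F (n X) = k (FObj F X)"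
    by metis
  have n_iso: "iso C (n X)" if X: "X \<in> Obj C" for X
  proof -
    obtain m where m: "m \<in> hom C (G (FObj F X)) X" "FArr F m = e (FObj F X)"
      using full[OF G X e] FO X by blast
    have "FArr F (m \<cdot>\<^bsub>C\<^esub> n X) = FArr F (Id C X)"
      using FC[OF n m(1)] Fn m(2) ek FO FI X by simp
    then have 1: "m \<cdot>\<^bsub>C\<^esub> n X = Id C X"
      using faithful C.Comp_in_hom[OF n m(1)] C.Id_in_hom X by blast
    have "FArr F (n X \<cdot>\<^bsub>C\<^esub> m) = FArr F (Id C (G (FObj F X)))"
      using FC[OF m(1) n] Fn m(2) ke FO FI G X by simp
    then have "n X \<cdot>\<^bsub>C\<^esub> m = Id C (G (FObj F X))"
      using faithful C.Comp_in_hom[OF m(1) n] C.Id_in_hom[OF G] FO X by blast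
    then show ?thesis
      using C.isoI[OF n m(1) 1] X by blast
  qed
  have "nat_iso C C id_fctr (comp_fctr GF F) n"
    unfolding nat_iso_def nat_trans_def
  proof (intro conjI ballI)
    fix f assume "f \<in> Arr C"
    define X Y where "X = Dom C f" and "Y = Cod C f"
    have f: "f \<in> hom C X Y"
      using \<open>f \<in> Arr C\<close> by (simp add: hom_def X_def Y_def)
    have XY: "X \<in> Obj C" "Y \<in> Obj C"
      using C.hom_Obj[OF f] by auto
    note Ff = FA[OF f] and gf = g[OF FA[OF f]]
    have "k (FObj F Y) \<cdot>\<^bsub>D\<^esub> FArr F f = conj (FArr F f) \<cdot>\<^bsub>D\<^esub> k (FObj F X)"
    proof (rule cancel_e)
      have FX: "FObj F X \<in> Obj D" and FY: "FObj F Y \<in> Obj D"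
        using FO XY by auto
      show "k (FObj F Y) \<cdot>\<^bsub>D\<^esub> FArr F f \<in> hom D (FObj F X) (FObj F (G (FObj F Y)))"
        using D.Comp_in_hom[OF Ff k[OF FY]] .
      show "conj (FArr F f) \<cdot>\<^bsub>D\<^esub> k (FObj F X) \<in> hom D (FObj F X) (FObj F (G (FObj F Y)))"
        using D.Comp_in_hom[OF k[OF FX] conj[OF Ff]] .
      have "e (FObj F Y) \<cdot>\<^bsub>D\<^esub> (k (FObj F Y) \<cdot>\<^bsub>D\<^esub> FArr F f) = FArr F f"
        using D.Comp_assoc[OF Ff k[OF FY] e[OF FY]] ek[OF FY] D.Comp_Id_left[OF Ff] by simp
      moreover have "e (FObj F Y) \<cdot>\<^bsub>D\<^esub> (conj (FArr F f) \<cdot>\<^bsub>D\<^esub> k (FObj F X)) =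
          FArr F f \<cdot>\<^bsub>D\<^esub> (e (FObj F X) \<cdot>\<^bsub>D\<^esub> k (FObj F X))"
        using D.Comp_assoc[OF k[OF FX] conj[OF Ff] e[OF FY]] e_conj[OF Ff]
          D.Comp_assoc[OF k[OF FX] e[OF FX] Ff] by simp
      ultimately show "e (FObj F Y) \<cdot>\<^bsub>D\<^esub> (k (FObj F Y) \<cdot>\<^bsub>D\<^esub> FArr F f) =
          e (FObj F Y) \<cdot>\<^bsub>D\<^esub> (conj (FArr F f) \<cdot>\<^bsub>D\<^esub> k (FObj F X))"
        using ek[OF FX] D.Comp_Id_right[OF Ff] by simp
      show "FObj F Y \<in> Obj D"
        by (rule FY)
    qed
    then have "FArr F (n Y \<cdot>\<^bsub>C\<^esub> f) = FArr F (g (FArr F f) \<cdot>\<^bsub>C\<^esub> n X)"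
      using FC[OF f n[OF XY(2)]] FC[OF n[OF XY(1)] gf(1)] Fn XY gf(2) by simp
    then have "n Y \<cdot>\<^bsub>C\<^esub> f = g (FArr F f) \<cdot>\<^bsub>C\<^esub> n X"
      using faithful C.Comp_in_hom[OF f n[OF XY(2)]] C.Comp_in_hom[OF n[OF XY(1)] gf(1)] by blast
    then show "n (Cod C f) \<cdot>\<^bsub>C\<^esub> FArr id_fctr f = FArr (comp_fctr GF F) f \<cdot>\<^bsub>C\<^esub> n (Dom C f)"
      by (simp add: id_fctr_def comp_fctr_def GF_def X_def Y_def)
  qed (use n n_iso in \<open>auto simp: id_fctr_def comp_fctr_def GF_def\<close>)
  moreover have "nat_iso D D (comp_fctr F GF) id_fctr e"
    unfolding nat_iso_def nat_trans_def
  proof (intro conjI ballI)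
    fix t assume "t \<in> Arr D"
    then show "e (Cod D t) \<cdot>\<^bsub>D\<^esub> FArr (comp_fctr F GF) t = FArr id_fctr t \<cdot>\<^bsub>D\<^esub> e (Dom D t)"
      using e_conj[OF Arr_hom] g' by (simp add: id_fctr_def comp_fctr_def GF_def)
  qed (use e iso_e in \<open>auto simp: id_fctr_def comp_fctr_def GF_def\<close>)
  ultimately show ?thesis
    using F G_functor unfolding equivalent_categories_def by blast
qed

section \<open>Jointly epic families\<close>

definition jointly_epic :: "('o, 'a) category \<Rightarrow> 'o \<Rightarrow> 'a set \<Rightarrow> bool" where
  "jointly_epic C X H \<longleftrightarrow> X \<in> Obj C \<and> H \<subseteq> {f \<in> Arr C. Cod C f = X} \<and>
     (\<forall>Y. \<forall>u\<in>hom C X Y. \<forall>v\<in>hom C X Y. (\<forall>f\<in>H. u \<cdot>\<^bsub>C\<^esub> f = v \<cdot>\<^bsub>C\<^esub> f) \<longrightarrow> u = v)"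

context category
begin

lemma jointly_epic_hom: "jointly_epic C X H \<Longrightarrow> f \<in> H \<Longrightarrow> f \<in> hom C (Dom C f) X"
  unfolding jointly_epic_def hom_def by blast

lemma jointly_epic_Obj: "jointly_epic C X H \<Longrightarrow> X \<in> Obj C"
  unfolding jointly_epic_def by blast

lemma jointly_epicD:
  assumes "jointly_epic C X H" "u \<in> hom C X Y" "v \<in> hom C X Y" "\<And>f. f \<in> H \<Longrightarrow> u \<cdot> f = v \<cdot> f"
  shows "u = v"
  using assms unfolding jointly_epic_def by blast

lemma jointly_epicI:
  assumes "X \<in> Obj C" "\<And>f. f \<in> H \<Longrightarrow> f \<in> hom C (Dom C f) X"
    and "\<And>Y u v. u \<in> hom C X Y \<Longrightarrow> v \<in> hom C X Y \<Longrightarrow> (\<And>f. f \<in> H \<Longrightarrow> u \<cdot> f = v \<cdot> f) \<Longrightarrow> u = v"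
  shows "jointly_epic C X H"
  using assms unfolding jointly_epic_def by (auto dest: homD)

lemma jointly_epic_mono:
  assumes "jointly_epic C X H" "H \<subseteq> H'" "\<And>f. f \<in> H' \<Longrightarrow> f \<in> hom C (Dom C f) X"
  shows "jointly_epic C X H'"
  using assms(3) by (intro jointly_epicI jointly_epic_Obj[OF assms(1)])
    (use assms(2) jointly_epicD[OF assms(1)] in blast)+

lemma jointly_epic_trans:
  assumes H: "jointly_epic C X H" and L: "\<And>f. f \<in> H \<Longrightarrow> jointly_epic C (Dom C f) (L f)"
    and K: "\<And>f l. f \<in> H \<Longrightarrow> l \<in> L f \<Longrightarrow> f \<cdot> l \<in> K" "\<And>f. f \<in> K \<Longrightarrow> f \<in> hom C (Dom C f) X"
  shows "jointly_epic C X K"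
proof (rule jointly_epicI[OF jointly_epic_Obj[OF H] K(2)])
  fix Y u v assume uv: "u \<in> hom C X Y" "v \<in> hom C X Y" and eq: "\<And>f. f \<in> K \<Longrightarrow> u \<cdot> f = v \<cdot> f"
  show "u = v"
  proof (rule jointly_epicD[OF H uv])
    fix f assume f: "f \<in> H"
    note f' = jointly_epic_hom[OF H f]
    show "u \<cdot> f = v \<cdot> f"
    proof (rule jointly_epicD[OF L[OF f] Comp_in_hom[OF f' uv(1)] Comp_in_hom[OF f' uv(2)]])
      fix l assume l: "l \<in> L f"
      show "(u \<cdot> f) \<cdot> l = (v \<cdot> f) \<cdot> l"
        using eq[OF K(1)[OF f l]] Comp_assoc[OF jointly_epic_hom[OF L[OF f] l] f'] uv by metis
    qed
  qed
qed

lemma epicI: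
  assumes "e \<in> hom C X Y" "\<And>Z u v. u \<in> hom C Y Z \<Longrightarrow> v \<in> hom C Y Z \<Longrightarrow> u \<cdot> e = v \<cdot> e \<Longrightarrow> u = v"
  shows "epic C e"
  using assms unfolding epic_def by (auto dest: homD)

lemma epicD: "epic C e \<Longrightarrow> e \<in> hom C X Y \<Longrightarrow> u \<in> hom C Y Z \<Longrightarrow> v \<in> hom C Y Z \<Longrightarrow> u \<cdot> e = v \<cdot> e \<Longrightarrow> u = v"
  unfolding epic_def using hom_Obj[of u Y Z] homD[of e C X Y] by blast

lemma epic_jointly_epic: "epic C e \<Longrightarrow> e \<in> hom C X Y \<Longrightarrow> jointly_epic C Y {e}"
  using hom_Obj[of e X Y] epicD[of e X Y] by (intro jointly_epicI) (auto dest: homD intro: Arr_hom)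

lemma coequalizer_epic:
  assumes "is_coequalizer C d0 d1 q"
  shows "epic C q"
proof -
  define X where "X = Cod C q"
  have q: "q \<in> hom C (Cod C d0) X" and eq: "q \<cdot> d0 = q \<cdot> d1"
    and d: "d0 \<in> hom C (Dom C d0) (Cod C d0)" "d1 \<in> hom C (Dom C d0) (Cod C d0)"
    using assms unfolding is_coequalizer_def parallel_pair_def by (auto simp: hom_def X_def)
  show ?thesis
  proof (rule epicI[OF q])
    fix Z u v assume uv: "u \<in> hom C X Z" "v \<in> hom C X Z" "u \<cdot> q = v \<cdot> q"
    have "u \<cdot> q \<in> hom C (Cod C d0) Z" "(u \<cdot> q) \<cdot> d0 = (u \<cdot> q) \<cdot> d1"
      using Comp_in_hom[OF q uv(1)] Comp_assoc[OF d(1) q uv(1)] Comp_assoc[OF d(2) q uv(1)] eq by simp_all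
    then have "\<exists>!h. h \<in> hom C X Z \<and> h \<cdot> q = u \<cdot> q"
      using assms hom_Obj[OF uv(1)] unfolding is_coequalizer_def X_def by blast
    then show "u = v"
      using uv by auto
  qed
qed

lemma coequalizerE:
  assumes "is_coequalizer C d0 d1 q" "d0 \<in> hom C X Y" "q \<in> hom C Y Z" "f \<in> hom C Y W" "f \<cdot> d0 = f \<cdot> d1"
  obtains h where "h \<in> hom C Z W" "h \<cdot> q = f"
proof -
  have "Cod C d0 = Y" "Cod C q = Z" "W \<in> Obj C"
    using assms hom_Obj by (auto dest: homD)
  then have "\<exists>!h. h \<in> hom C Z W \<and> h \<cdot> q = f"
    using assms unfolding is_coequalizer_def by blast
  then show ?thesis
    using that by blast
qed

text \<open>
  An epimorphism which coequalizes anything coequalizes its kernel pair, since the given pair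
  factors through the kernel pair.
\<close>

lemma coequalizer_kernel_pair_exact:
  assumes q: "is_coequalizer C d0 d1 q" and k: "is_pullback C q q N k0 k1"
  shows "exact_fork C k0 k1 q"
proof -
  define X Y Z where "X = Dom C d0" and "Y = Cod C d0" and "Z = Cod C q"
  have d: "d0 \<in> hom C X Y" "d1 \<in> hom C X Y" and qh: "q \<in> hom C Y Z" and eq: "q \<cdot> d0 = q \<cdot> d1"
    using q unfolding is_coequalizer_def parallel_pair_def by (auto simp: hom_def X_def Y_def Z_def)
  note k' = pullback_hom[OF k qh qh]
  obtain h where h: "h \<in> hom C X N" "k0 \<cdot> h = d0" "k1 \<cdot> h = d1"
    using pullbackE[OF k qh qh d eq] .
  have "parallel_pair C k0 k1"
    using k' unfolding parallel_pair_def by (auto dest: homD)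
  moreover have "is_coequalizer C k0 k1 q"
    unfolding is_coequalizer_def
  proof (intro conjI ballI impI)
    fix W f assume "W \<in> Obj C" and f: "f \<in> hom C (Cod C k0) W" "f \<cdot> k0 = f \<cdot> k1"
    have f': "f \<in> hom C Y W"
      using f k' by (auto dest: homD)
    have "f \<cdot> d0 = f \<cdot> d1"
      using h Comp_assoc[OF h(1) k'(1) f'] Comp_assoc[OF h(1) k'(2) f'] f(2) by simp
    then obtain g where g: "g \<in> hom C Z W" "g \<cdot> q = f"
      using coequalizerE[OF q d(1) qh f'] by blast
    show "\<exists>!h. h \<in> hom C (Cod C q) W \<and> h \<cdot> q = f"
    proof (rule ex1I)
      show "g \<in> hom C (Cod C q) W \<and> g \<cdot> q = f"
        using g by (simp add: Z_def)
      show "g' = g" if "g' \<in> hom C (Cod C q) W \<and> g' \<cdot> q = f" for g'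
        using epicD[OF coequalizer_epic[OF q] qh _ g(1)] that g(2) by (simp add: Z_def)
    qed
  qed (use k' qh \<open>parallel_pair C k0 k1\<close> in \<open>auto dest: homD\<close>)
  moreover have "Dom C k0 = N"
    using k' by (auto dest: homD)
  ultimately show ?thesis
    using k unfolding exact_fork_def is_kernel_pair_def by simp
qed

end

section \<open>Giraud's axioms: covers by generators\<close>

text \<open>
  Arrows \<open>w : A \<rightarrow> X\<close> with \<open>A\<close> a generator are treated as the points of \<open>X\<close>: axiom (v) says
  that the points of every object are jointly epic.  The points of \<open>Dom g\<close> at which \<open>g\<close> lifts through
  a family \<open>H\<close> generalise the pullback of a sieve along \<open>g\<close>.
\<close>

locale giraud = category E for E :: "('o, 'a) category" (structure) +
  fixes U :: "'u set" and G :: "'o set"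
  assumes universe: "universe U"
    and small_homs: "small_homs U E"
    and finite_limits: "has_finite_limits E"
    and giraud_i: "giraud_i U E"
    and giraud_ii: "giraud_ii E"
    and giraud_iii: "giraud_iii E"
    and giraud_iv: "giraud_iv E"
    and giraud_v: "giraud_v U E G"
begin

definition points :: "'o \<Rightarrow> 'a set" where
  "points X = {w \<in> Arr E. Dom E w \<in> G \<and> Cod E w = X}"

definition lifting_points :: "'a \<Rightarrow> 'a set \<Rightarrow> 'a set" where
  "lifting_points g H =
     {w \<in> points (Dom E g). \<exists>h\<in>H. \<exists>u\<in>hom E (Dom E w) (Dom E h). g \<cdot> w = h \<cdot> u}"

lemma G_Obj: "A \<in> G \<Longrightarrow> A \<in> Obj E"
  using giraud_v unfolding giraud_v_def by blast

lemma points_hom: "w \<in> points X \<Longrightarrow> w \<in> hom E (Dom E w) X"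
  unfolding points_def hom_def by simp

lemma points_G: "w \<in> points X \<Longrightarrow> Dom E w \<in> G"
  unfolding points_def by simp

lemma pointsI: "w \<in> hom E A X \<Longrightarrow> A \<in> G \<Longrightarrow> w \<in> points X"
  unfolding points_def hom_def by auto

lemma Comp_points: "w \<in> points X \<Longrightarrow> g \<in> hom E X Y \<Longrightarrow> g \<cdot> w \<in> points Y"
  using Comp_in_hom pointsI points_hom points_G by metis

lemma Dom_Comp_points: "w \<in> points X \<Longrightarrow> g \<in> hom E X Y \<Longrightarrow> Dom E (g \<cdot> w) = Dom E w"
  using Comp_in_hom points_hom homD by metis

lemma points_jointly_epic:
  assumes "X \<in> Obj E"
  shows "jointly_epic E X (points X)"
proof (rule jointly_epicI[OF assms points_hom])
  fix Y u v assume uv: "u \<in> hom E X Y" "v \<in> hom E X Y" and eq: "\<And>f. f \<in> points X \<Longrightarrow> u \<cdot> f = v \<cdot> f"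
  have "\<forall>A\<in>G. \<forall>w\<in>hom E A X. u \<cdot> w = v \<cdot> w"
    using eq pointsI by blast
  then show "u = v"
    using giraud_v uv hom_Obj[OF uv(1)] unfolding giraud_v_def generates_def by blast
qed

lemma small_points:
  assumes "X \<in> Obj E"
  shows "small U (points X)"
proof -
  have "small U (Sigma G (\<lambda>A. hom E A X))"
    using giraud_v small_homs assms G_Obj unfolding giraud_v_def small_homs_def
    by (intro small_Sigma[OF universe]) auto
  then have "small U (snd ` Sigma G (\<lambda>A. hom E A X))"
    by (rule small_image)
  moreover have "points X \<subseteq> snd ` Sigma G (\<lambda>A. hom E A X)"
    unfolding points_def hom_def by force
  ultimately show ?thesis
    using small_subset by blast
qed

subsection \<open>Coproducts indexed by arbitrary small sets\<close>

lemma small_index_bijection: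
  assumes "small U K"
  obtains g I where "bij_betw g I K" "I \<subseteq> U" "small U I"
proof -
  obtain f where f: "inj_on f K" "f ` K \<subseteq> U"
    using assms by (rule small_embedding)
  have "bij_betw (inv_into K f) (f ` K) K"
    using f by (simp add: bij_betw_inv_into inj_on_imp_bij_betw)
  then show ?thesis
    using that f small_image[OF assms] by blast
qed

lemma coproduct_exists:
  assumes K: "small U K" and X: "\<And>k. k \<in> K \<Longrightarrow> X k \<in> Obj E"
  obtains S \<iota> where "is_coproduct E K X S \<iota>"
proof -
  obtain g I where g: "bij_betw g I K" "I \<subseteq> U" "small U I"
    using small_index_bijection[OF K] .
  have "\<forall>i\<in>I. (X \<circ> g) i \<in> Obj E"
    using X g(1) by (auto simp: bij_betw_def)
  then obtain S \<iota> where S: "is_coproduct E I (X \<circ> g) S \<iota>"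
    using giraud_i g unfolding giraud_i_def by blast
  have "is_coproduct E K X S (\<iota> \<circ> inv_into I g)"
    by (rule coproduct_reindex[OF bij_betw_inv_into[OF g(1)] S])
      (use bij_betw_inv_into_right[OF g(1)] in auto)
  then show ?thesis
    by (rule that)
qed

lemma coproduct_disjoint_stable:
  assumes K: "small U K" and S: "is_coproduct E K X S \<iota>"
  shows "disjoint_coproduct E K X S \<iota>" "stable_coproduct E K X S \<iota>"
proof -
  obtain g I where g: "bij_betw g I K" "I \<subseteq> U" "small U I"
    using small_index_bijection[OF K] .
  have gI: "g ` I = K" "inj_on g I"
    using g(1) by (auto simp: bij_betw_def)
  have "is_coproduct E I (X \<circ> g) S (\<iota> \<circ> g)"
    by (rule coproduct_reindex[OF g(1) S]) auto
  moreover have "\<forall>i\<in>I. (X \<circ> g) i \<in> Obj E"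
    using S gI unfolding is_coproduct_def by auto
  ultimately have ds: "disjoint_coproduct E I (X \<circ> g) S (\<iota> \<circ> g)" "stable_coproduct E I (X \<circ> g) S (\<iota> \<circ> g)"
    using giraud_i g unfolding giraud_i_def by blast+
  show "disjoint_coproduct E K X S \<iota>"
    using ds(1) unfolding disjoint_coproduct_def gI(1)[symmetric]
    by (simp add: inj_on_eq_iff[OF gI(2)])
  show "stable_coproduct E K X S \<iota>"
    unfolding stable_coproduct_def
  proof (intro allI impI, elim conjE)
    fix f P p q Q \<kappa> h
    assume f: "f \<in> Arr E" "Cod E f = S" and P: "\<forall>i\<in>K. is_pullback E f (\<iota> i) (P i) (p i) (q i)"
      and Q: "is_coproduct E K P Q \<kappa>" and h: "h \<in> hom E Q (Dom E f)" "\<forall>i\<in>K. h \<cdot> \<kappa> i = p i"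
    have "is_coproduct E I (P \<circ> g) Q (\<kappa> \<circ> g)"
      by (rule coproduct_reindex[OF g(1) Q]) auto
    moreover have "\<forall>i\<in>I. is_pullback E f ((\<iota> \<circ> g) i) ((P \<circ> g) i) ((p \<circ> g) i) ((q \<circ> g) i)"
      using P gI by auto
    moreover have "\<forall>i\<in>I. h \<cdot> (\<kappa> \<circ> g) i = (p \<circ> g) i"
      using h gI by auto
    ultimately show "iso E h"
      using ds(2) f h(1) unfolding stable_coproduct_def by blast
  qed
qed

text \<open>
  Stability, in terms of points: pulling a coproduct back along \<open>s\<close> exhibits \<open>W\<close> as a coproduct of
  the pullbacks of the summands, and the points of these pullbacks are jointly epic on \<open>W\<close>.
\<close>

lemma coproduct_points_jointly_epic:
  assumes K: "small U K" and S: "is_coproduct E K X S \<iota>" and s: "s \<in> hom E W S"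
  shows "jointly_epic E W {w \<in> points W. \<exists>k\<in>K. \<exists>u\<in>hom E (Dom E w) (X k). s \<cdot> w = \<iota> k \<cdot> u}"
    (is "jointly_epic E W ?H")
proof (rule jointly_epicI)
  show W: "W \<in> Obj E"
    using hom_Obj[OF s] by blast
  have "\<exists>P p q. is_pullback E s (\<iota> k) P p q" if "k \<in> K" for k
    by (rule pullback_exists[OF finite_limits s coproduct_hom[OF S that]]) blast
  then obtain P p q where pb: "\<And>k. k \<in> K \<Longrightarrow> is_pullback E s (\<iota> k) (P k) (p k) (q k)"
    by metis
  have pq: "p k \<in> hom E (P k) W" "q k \<in> hom E (P k) (X k)" "s \<cdot> p k = \<iota> k \<cdot> q k" if "k \<in> K" for k
    using pullback_hom[OF pb[OF that] s coproduct_hom[OF S that]] .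
  obtain Q \<kappa> where Q: "is_coproduct E K P Q \<kappa>"
  proof (rule coproduct_exists[OF K])
    show "P k \<in> Obj E" if "k \<in> K" for k
      using hom_Obj[OF pq(1)[OF that]] by blast
  qed
  obtain h where h: "h \<in> hom E Q W" "\<And>k. k \<in> K \<Longrightarrow> h \<cdot> \<kappa> k = p k"
    by (rule coproductE[OF Q W pq(1)]) blast+
  have "s \<in> Arr E \<and> Cod E s = S \<and> (\<forall>k\<in>K. is_pullback E s (\<iota> k) (P k) (p k) (q k)) \<and>
      is_coproduct E K P Q \<kappa> \<and> h \<in> hom E Q (Dom E s) \<and> (\<forall>k\<in>K. h \<cdot> \<kappa> k = p k)"
    using s pb Q h homD[OF s] by simp
  then have "iso E h"
    by (rule coproduct_disjoint_stable(2)[OF K S, unfolded stable_coproduct_def, rule_format])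
  then obtain h' where h': "h' \<in> hom E W Q" "h \<cdot> h' = Id E W"
    by (rule isoE[OF _ h(1)])
  fix Y u v assume uv: "u \<in> hom E W Y" "v \<in> hom E W Y" and eq: "\<And>w. w \<in> ?H \<Longrightarrow> u \<cdot> w = v \<cdot> w"
  have up: "u \<cdot> p k = v \<cdot> p k" if k: "k \<in> K" for k
  proof (rule jointly_epicD[OF points_jointly_epic])
    note pk = pq(1)[OF k] and qk = pq(2)[OF k] and \<iota>k = coproduct_hom[OF S k]
    show "P k \<in> Obj E"
      using hom_Obj[OF pk] by blast
    show "u \<cdot> p k \<in> hom E (P k) Y" "v \<cdot> p k \<in> hom E (P k) Y"
      using Comp_in_hom[OF pk] uv by auto
    fix w assume w: "w \<in> points (P k)"
    note w' = points_hom[OF w]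
    have "s \<cdot> (p k \<cdot> w) = (s \<cdot> p k) \<cdot> w"
      using Comp_assoc[OF w' pk s] by simp
    also have "\<dots> = \<iota> k \<cdot> (q k \<cdot> w)"
      using pq(3)[OF k] Comp_assoc[OF w' qk \<iota>k] by simp
    finally have "p k \<cdot> w \<in> ?H"
      using Comp_points[OF w pk] k Comp_in_hom[OF w' qk] Dom_Comp_points[OF w pk] by auto
    then have "u \<cdot> (p k \<cdot> w) = v \<cdot> (p k \<cdot> w)"
      by (rule eq)
    then show "(u \<cdot> p k) \<cdot> w = (v \<cdot> p k) \<cdot> w"
      using Comp_assoc[OF w' pk uv(1)] Comp_assoc[OF w' pk uv(2)] by simp
  qed
  have "u \<cdot> h = v \<cdot> h"
  proof (rule coproduct_eq[OF Q Comp_in_hom[OF h(1) uv(1)] Comp_in_hom[OF h(1) uv(2)]])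
    fix k assume k: "k \<in> K"
    show "(u \<cdot> h) \<cdot> \<kappa> k = (v \<cdot> h) \<cdot> \<kappa> k"
      using up[OF k] h(2)[OF k] Comp_assoc[OF coproduct_hom[OF Q k] h(1) uv(1)]
        Comp_assoc[OF coproduct_hom[OF Q k] h(1) uv(2)] by simp
  qed
  then have "(u \<cdot> h) \<cdot> h' = (v \<cdot> h) \<cdot> h'"
    by simp
  then show "u = v"
    using Comp_assoc[OF h'(1) h(1) uv(1)] Comp_assoc[OF h'(1) h(1) uv(2)] h'(2)
      Comp_Id_right[OF uv(1)] Comp_Id_right[OF uv(2)] by simp
qed (use points_hom in auto)

lemma coproduct_injections_jointly_epic:
  assumes S: "is_coproduct E K X S \<iota>"
  shows "jointly_epic E S (\<iota> ` K)"
proof (rule jointly_epicI[OF coproduct_Obj[OF S]])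
  show "f \<in> hom E (Dom E f) S" if "f \<in> \<iota> ` K" for f
    using that coproduct_hom[OF S] by (auto dest: homD simp: hom_def)
qed (use coproduct_eq[OF S] in blast)

text \<open>
  Two different summands meet in the initial object, and an object mapping to an initial object
  is initial by stability of the empty coproduct.  So an object whose arrows to two different
  summands agree in the coproduct is covered by the empty family.
\<close>

lemma coproduct_injections_disjoint:
  assumes K: "small U K" and S: "is_coproduct E K X S \<iota>"
    and k: "k \<in> K" "l \<in> K" "u \<in> hom E W (X k)" "v \<in> hom E W (X l)" "\<iota> k \<cdot> u = \<iota> l \<cdot> v"
  shows "k = l \<and> u = v \<or> jointly_epic E W {}"
proof (cases "k = l")
  case True
  then have "u = v"
    using coproduct_disjoint_stable(1)[OF K S] k monicD[OF _ coproduct_hom[OF S k(1)] k(3)]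
    unfolding disjoint_coproduct_def by blast
  then show ?thesis
    using True by blast
next
  case False
  obtain P p q where P: "is_pullback E (\<iota> k) (\<iota> l) P p q"
    by (rule pullback_exists[OF finite_limits coproduct_hom[OF S k(1)] coproduct_hom[OF S k(2)]])
  have init: "is_initial E P"
    using coproduct_disjoint_stable(1)[OF K S] k(1,2) False P unfolding disjoint_coproduct_def by blast
  obtain f where f: "f \<in> hom E W P"
    by (rule pullbackE[OF P coproduct_hom[OF S k(1)] coproduct_hom[OF S k(2)] k(3-5)])
  (* P is the coproduct of the empty family, so by stability the empty family covers every object
     that has an arrow to P. *)
  define I :: "'u set" where "I = {}"
  have "is_coproduct E I (\<lambda>_. P) P (\<lambda>_. Id E P)"
    using init unfolding is_coproduct_def is_initial_def I_def by simp
  moreover have "small U I"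
    unfolding I_def using small_finite[OF universe] by blast
  ultimately have "jointly_epic E W
      {w \<in> points W. \<exists>k\<in>I. \<exists>u\<in>hom E (Dom E w) P. f \<cdot> w = Id E P \<cdot> u}"
    using coproduct_points_jointly_epic f by fast
  then show ?thesis
    by (simp add: I_def)
qed

text \<open>
  This turns a small jointly epic family into a single epimorphism, to which axioms (ii) and (iv)
  apply.
\<close>

lemma coproduct_cover:
  assumes H: "small U H" "jointly_epic E X H"
  obtains S \<iota> e where "is_coproduct E H (Dom E) S \<iota>" "e \<in> hom E S X" "epic E e" "\<And>f. f \<in> H \<Longrightarrow> e \<cdot> \<iota> f = f"
proof -
  have f: "f \<in> H \<Longrightarrow> f \<in> hom E (Dom E f) X" for f
    using jointly_epic_hom[OF H(2)] .
  obtain S \<iota> where S: "is_coproduct E H (Dom E) S \<iota>"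
    by (rule coproduct_exists[OF H(1), of "Dom E"]) (use f hom_Obj in blast)+
  obtain e where e: "e \<in> hom E S X" "\<And>f. f \<in> H \<Longrightarrow> e \<cdot> \<iota> f = f"
    by (rule coproductE[OF S jointly_epic_Obj[OF H(2)], of "\<lambda>f. f"]) (use f in blast)+
  have "epic E e"
  proof (rule epicI[OF e(1)])
    fix Z u v assume uv: "u \<in> hom E X Z" "v \<in> hom E X Z" "u \<cdot> e = v \<cdot> e"
    show "u = v"
    proof (rule jointly_epicD[OF H(2) uv(1,2)])
      fix f assume f: "f \<in> H"
      show "u \<cdot> f = v \<cdot> f"
        using e(2)[OF f] Comp_assoc[OF coproduct_hom[OF S f] e(1) uv(1)]
          Comp_assoc[OF coproduct_hom[OF S f] e(1) uv(2)] uv(3) by simp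
    qed
  qed
  then show ?thesis
    using that S e by blast
qed

subsection \<open>Stability and effectivity of jointly epic families\<close>

text \<open>
  The kernel pair of an epimorphism \<open>e\<close> and \<open>e\<close> form an exact fork.  Its pullback along \<open>g\<close> is exact
  by axiom (iv), and ends in the pullback of \<open>e\<close>, which is therefore a coequalizer.
\<close>

lemma epic_pullback:
  assumes e: "epic E e" and P: "is_pullback E e g P y q"
  shows "epic E q"
proof -
  define S X Y where "S = Dom E e" and "X = Cod E e" and "Y = Dom E g"
  have eh: "e \<in> hom E S X" and g: "g \<in> hom E Y X"
    using P unfolding is_pullback_def by (auto simp: hom_def S_def X_def Y_def)
  note yq = pullback_hom[OF P eh g]
  obtain d0 d1 where "is_coequalizer E d0 d1 e"
    using giraud_ii e unfolding giraud_ii_def by blast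
  moreover obtain N k0 k1 where N: "is_pullback E e e N k0 k1"
    using pullback_exists[OF finite_limits eh eh] .
  ultimately have "stably_exact E k0 k1 e"
    using coequalizer_kernel_pair_exact giraud_iv unfolding giraud_iv_def by blast
  moreover note k = pullback_hom[OF N eh eh]
  note ek0 = Comp_in_hom[OF k(1) eh]
  obtain X' x w where X': "is_pullback E (e \<cdot> k0) g X' x w"
    using pullback_exists[OF finite_limits ek0 g] .
  note xw = pullback_hom[OF X' ek0 g]
  have "e \<cdot> (k0 \<cdot> x) = g \<cdot> w" "e \<cdot> (k1 \<cdot> x) = g \<cdot> w"
    using Comp_assoc[OF xw(1) k(1) eh] Comp_assoc[OF xw(1) k(2) eh] k(3) xw(3) by simp_all
  then obtain d0' d1' where "d0' \<in> hom E X' P" "y \<cdot> d0' = k0 \<cdot> x" "q \<cdot> d0' = w"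
      "d1' \<in> hom E X' P" "y \<cdot> d1' = k1 \<cdot> x" "q \<cdot> d1' = w"
    by (elim pullbackE[OF P eh g Comp_in_hom[OF xw(1) k(1)] xw(2)]
      pullbackE[OF P eh g Comp_in_hom[OF xw(1) k(2)] xw(2)])
  then have "pullback_fork E k0 k1 e g d0' d1' q"
    using X' P unfolding pullback_fork_def by blast
  ultimately have "exact_fork E d0' d1' q"
    using P unfolding stably_exact_def is_pullback_def by metis
  then show ?thesis
    using coequalizer_epic unfolding exact_fork_def by blast
qed

text \<open>
  A jointly epic family \<open>H\<close> on \<open>X\<close> amounts to an epimorphism from a coproduct onto \<open>X\<close>.  Its
  pullback along \<open>g\<close> is an epimorphism, and the points of the pullback at which the projection to
  the coproduct lifts to a summand give points of \<open>Y\<close> at which \<open>g\<close> lifts through \<open>H\<close>.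
\<close>

lemma lifting_points_jointly_epic:
  assumes H: "small U H" "jointly_epic E X H" and g: "g \<in> hom E Y X"
  shows "jointly_epic E Y (lifting_points g H)"
proof -
  obtain S \<iota> e where S: "is_coproduct E H (Dom E) S \<iota>" and e: "e \<in> hom E S X" "epic E e"
    and e\<iota>: "\<And>f. f \<in> H \<Longrightarrow> e \<cdot> \<iota> f = f"
    by (rule coproduct_cover[OF H]) blast
  obtain P y q where P: "is_pullback E e g P y q"
    using pullback_exists[OF finite_limits e(1) g] .
  note yq = pullback_hom[OF P e(1) g]
  let ?L = "{w \<in> points P. \<exists>f\<in>H. \<exists>u\<in>hom E (Dom E w) (Dom E f). y \<cdot> w = \<iota> f \<cdot> u}"
  show ?thesis
  proof (rule jointly_epic_trans[OF epic_jointly_epic[OF epic_pullback[OF e(2) P] yq(2)]])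
    show "jointly_epic E (Dom E f) ?L" if "f \<in> {q}" for f
      using coproduct_points_jointly_epic[OF H(1) S yq(1)] homD[OF yq(2)] that by simp
    show "f \<in> hom E (Dom E f) Y" if "f \<in> lifting_points g H" for f
      using that points_hom homD[OF g] unfolding lifting_points_def by auto
    fix f w assume "f \<in> {q}" and w: "w \<in> ?L"
    then obtain h u where h: "h \<in> H" "u \<in> hom E (Dom E w) (Dom E h)" "y \<cdot> w = \<iota> h \<cdot> u"
      by blast
    have wP: "w \<in> points P"
      using w by blast
    note w' = points_hom[OF wP]
    have "g \<cdot> (q \<cdot> w) = e \<cdot> (y \<cdot> w)"
      using Comp_assoc[OF w' yq(2) g] Comp_assoc[OF w' yq(1) e(1)] yq(3) by simp
    also have "\<dots> = h \<cdot> u"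
      using Comp_assoc[OF h(2) coproduct_hom[OF S h(1)] e(1)] h(3) e\<iota>[OF h(1)] by simp
    finally show "f \<cdot> w \<in> lifting_points g H"
      using \<open>f \<in> {q}\<close> h Comp_points[OF wP yq(2)] Dom_Comp_points[OF wP yq(2)] homD[OF g]
      unfolding lifting_points_def by auto
  qed
qed

text \<open>
  Axiom (ii) makes a jointly epic family \<open>H\<close> effective: arrows given on the members of \<open>H\<close> that are
  compatible at the points of their overlaps glue.  They induce an arrow \<open>c\<close> on the coproduct, which
  has to equalize every pair that \<open>e\<close> equalizes, and this is checked at points at which both arrows
  of the pair land in a summand.
\<close>

lemma glue_arrows:
  assumes H: "small U H" "jointly_epic E X H" and x: "\<And>f. f \<in> H \<Longrightarrow> x f \<in> hom E (Dom E f) Y"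
    and Y: "Y \<in> Obj E"
    and compat: "\<And>f g A a b. f \<in> H \<Longrightarrow> g \<in> H \<Longrightarrow> A \<in> G \<Longrightarrow> a \<in> hom E A (Dom E f) \<Longrightarrow>
      b \<in> hom E A (Dom E g) \<Longrightarrow> f \<cdot> a = g \<cdot> b \<Longrightarrow> x f \<cdot> a = x g \<cdot> b"
  obtains h where "h \<in> hom E X Y" "\<And>f. f \<in> H \<Longrightarrow> h \<cdot> f = x f"
proof -
  obtain S \<iota> e where S: "is_coproduct E H (Dom E) S \<iota>" and e: "e \<in> hom E S X" "epic E e"
    and e\<iota>: "\<And>f. f \<in> H \<Longrightarrow> e \<cdot> \<iota> f = f"
    by (rule coproduct_cover[OF H]) blast
  obtain c where c: "c \<in> hom E S Y" "\<And>f. f \<in> H \<Longrightarrow> c \<cdot> \<iota> f = x f"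
    by (rule coproductE[OF S Y x]) blast+
  obtain d0 d1 where d: "is_coequalizer E d0 d1 e"
    using giraud_ii e(2) unfolding giraud_ii_def by blast
  define T where "T = Dom E d0"
  have dh: "d0 \<in> hom E T S" "d1 \<in> hom E T S" and ed: "e \<cdot> d0 = e \<cdot> d1"
    using d homD[OF e(1)] unfolding is_coequalizer_def parallel_pair_def by (auto simp: hom_def T_def)
  let ?L = "\<lambda>W s. {w \<in> points W. \<exists>f\<in>H. \<exists>u\<in>hom E (Dom E w) (Dom E f). s \<cdot> w = \<iota> f \<cdot> u}"
  have same: "c \<cdot> s = c \<cdot> t" if s: "s \<in> hom E A S" and t: "t \<in> hom E A S" and est: "e \<cdot> s = e \<cdot> t" for s t A
  proof (rule jointly_epicD[OF coproduct_points_jointly_epic[OF H(1) S s] Comp_in_hom[OF s c(1)] Comp_in_hom[OF t c(1)]])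
    fix w assume "w \<in> ?L A s"
    then obtain f u where w: "w \<in> points A" and f: "f \<in> H" "u \<in> hom E (Dom E w) (Dom E f)" "s \<cdot> w = \<iota> f \<cdot> u"
      by blast
    note w' = points_hom[OF w]
    note sw = Comp_in_hom[OF w' s] and tw = Comp_in_hom[OF w' t]
    have "c \<cdot> (s \<cdot> w) = c \<cdot> (t \<cdot> w)"
    proof (rule jointly_epicD[OF coproduct_points_jointly_epic[OF H(1) S tw] Comp_in_hom[OF sw c(1)] Comp_in_hom[OF tw c(1)]])
      fix v assume "v \<in> ?L (Dom E w) (t \<cdot> w)"
      then obtain g b where v: "v \<in> points (Dom E w)" and g: "g \<in> H" "b \<in> hom E (Dom E v) (Dom E g)"
          "(t \<cdot> w) \<cdot> v = \<iota> g \<cdot> b"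
        by blast
      note v' = points_hom[OF v]
      note uv = Comp_in_hom[OF v' f(2)]
      have 1: "(s \<cdot> w) \<cdot> v = \<iota> f \<cdot> (u \<cdot> v)"
        using Comp_assoc[OF v' f(2) coproduct_hom[OF S f(1)]] f(3) by simp
      have "f \<cdot> (u \<cdot> v) = e \<cdot> ((s \<cdot> w) \<cdot> v)"
        using Comp_assoc[OF uv coproduct_hom[OF S f(1)] e(1)] e\<iota>[OF f(1)] 1 by simp
      also have "\<dots> = e \<cdot> ((t \<cdot> w) \<cdot> v)"
        using Comp_assoc[OF v' sw e(1)] Comp_assoc[OF v' tw e(1)] Comp_assoc[OF w' s e(1)]
          Comp_assoc[OF w' t e(1)] est by simp
      also have "\<dots> = g \<cdot> b"
        using Comp_assoc[OF g(2) coproduct_hom[OF S g(1)] e(1)] e\<iota>[OF g(1)] g(3) by simp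
      finally have "x f \<cdot> (u \<cdot> v) = x g \<cdot> b"
        using compat[OF f(1) g(1) points_G[OF v] uv g(2)] by blast
      then show "(c \<cdot> (s \<cdot> w)) \<cdot> v = (c \<cdot> (t \<cdot> w)) \<cdot> v"
        using Comp_assoc[OF v' sw c(1)] Comp_assoc[OF v' tw c(1)] 1 g(3) c(2)[OF f(1)] c(2)[OF g(1)]
          Comp_assoc[OF uv coproduct_hom[OF S f(1)] c(1)] Comp_assoc[OF g(2) coproduct_hom[OF S g(1)] c(1)]
        by simp
    qed
    then show "(c \<cdot> s) \<cdot> w = (c \<cdot> t) \<cdot> w"
      using Comp_assoc[OF w' s c(1)] Comp_assoc[OF w' t c(1)] by simp
  qed
  obtain h where h: "h \<in> hom E X Y" "h \<cdot> e = c"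
    using coequalizerE[OF d dh(1) e(1) c(1) same[OF dh ed]] .
  have "h \<cdot> f = x f" if "f \<in> H" for f
    using Comp_assoc[OF coproduct_hom[OF S that] e(1) h(1)] h(2) c(2)[OF that] e\<iota>[OF that] by simp
  then show ?thesis
    using that h(1) by blast
qed

text \<open>
  Being in a subobject is a local property: the local factorizations are compatible because \<open>m\<close> is
  monic, hence glue.
\<close>

lemma factors_through_monic_locally:
  assumes m: "monic E m" "m \<in> hom E R P" and f: "f \<in> hom E W P" and H: "small U H" "jointly_epic E W H"
    and loc: "\<And>w. w \<in> H \<Longrightarrow> \<exists>r\<in>hom E (Dom E w) R. m \<cdot> r = f \<cdot> w"
  shows "factors_through E f m"
proof -
  obtain r where r: "\<And>w. w \<in> H \<Longrightarrow> r w \<in> hom E (Dom E w) R" "\<And>w. w \<in> H \<Longrightarrow> m \<cdot> r w = f \<cdot> w"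
    using loc by metis
  note w' = jointly_epic_hom[OF H(2)]
  obtain h where h: "h \<in> hom E W R" "\<And>w. w \<in> H \<Longrightarrow> h \<cdot> w = r w"
  proof (rule glue_arrows[OF H])
    show "w \<in> H \<Longrightarrow> r w \<in> hom E (Dom E w) R" for w
      by (rule r(1))
    show "R \<in> Obj E"
      using hom_Obj[OF m(2)] by blast
    fix w v A a b assume wv: "w \<in> H" "v \<in> H" and "A \<in> G"
      and ab: "a \<in> hom E A (Dom E w)" "b \<in> hom E A (Dom E v)" "w \<cdot> a = v \<cdot> b"
    show "r w \<cdot> a = r v \<cdot> b"
    proof (rule monicD[OF m Comp_in_hom[OF ab(1) r(1)[OF wv(1)]] Comp_in_hom[OF ab(2) r(1)[OF wv(2)]]])
      have "m \<cdot> (r w \<cdot> a) = f \<cdot> (w \<cdot> a)"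
        using Comp_assoc[OF ab(1) r(1)[OF wv(1)] m(2)] Comp_assoc[OF ab(1) w'[OF wv(1)] f] r(2)[OF wv(1)] by simp
      also have "\<dots> = m \<cdot> (r v \<cdot> b)"
        using Comp_assoc[OF ab(2) r(1)[OF wv(2)] m(2)] Comp_assoc[OF ab(2) w'[OF wv(2)] f] r(2)[OF wv(2)] ab(3)
        by simp
      finally show "m \<cdot> (r w \<cdot> a) = m \<cdot> (r v \<cdot> b)" .
    qed
  qed (use that in blast)
  have "m \<cdot> h = f"
  proof (rule jointly_epicD[OF H(2) Comp_in_hom[OF h(1) m(2)] f])
    fix w assume w: "w \<in> H"
    show "(m \<cdot> h) \<cdot> w = f \<cdot> w"
      using Comp_assoc[OF w'[OF w] h(1) m(2)] h(2)[OF w] r(2)[OF w] by simp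
  qed
  then show ?thesis
    using h(1) homD[OF f] homD[OF m(2)] unfolding factors_through_def by blast
qed

end

section \<open>Presheaves of sets\<close>

lemma full_subcat_simps [simp]:
  "Obj (full_subcat C S) = S" "Dom (full_subcat C S) = Dom C" "Cod (full_subcat C S) = Cod C"
  "Id (full_subcat C S) = Id C" "Comp (full_subcat C S) = Comp C"
  "f \<in> Arr (full_subcat C S) \<longleftrightarrow> f \<in> Arr C \<and> Dom C f \<in> S \<and> Cod C f \<in> S"
  by (auto simp: full_subcat_def)

lemma op_cat_simps [simp]:
  "Obj (op_cat C) = Obj C" "Arr (op_cat C) = Arr C" "Dom (op_cat C) = Cod C" "Cod (op_cat C) = Dom C"
  "Id (op_cat C) = Id C" "Comp (op_cat C) g f = Comp C f g"
  by (auto simp: op_cat_def)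

lemma set_cat_simps [simp]:
  "Obj (set_cat \<V>) = \<V>" "Id (set_cat \<V>) A = (A, A, \<lambda>x\<in>A. x)"
  "Comp (set_cat \<V>) (B', D, g) (A, B, f) = (A, D, \<lambda>x\<in>A. g (f x))"
  by (auto simp: set_cat_def)

lemma set_cat_hom:
  "m \<in> hom (set_cat \<V>) A B \<longleftrightarrow> A \<in> \<V> \<and> B \<in> \<V> \<and> fst m = A \<and> fst (snd m) = B \<and> fn m \<in> A \<rightarrow>\<^sub>E B"
  by (cases m) (auto simp: set_cat_def hom_def)

lemma presheaf_restriction_hom:
  assumes "is_functor (op_cat C) (set_cat \<V>) F" "w \<in> Arr C"
  shows "FArr F w \<in> hom (set_cat \<V>) (FObj F (Cod C w)) (FObj F (Dom C w))"
  using assms unfolding is_functor_def by simp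

lemma presheaf_restriction_in:
  assumes "is_functor (op_cat C) (set_cat \<V>) F" "w \<in> Arr C" "a \<in> FObj F (Cod C w)"
  shows "fn (FArr F w) a \<in> FObj F (Dom C w)"
  using presheaf_restriction_hom[OF assms(1,2)] assms(3) by (auto simp: set_cat_hom)

lemma presheaf_restriction_Comp:
  assumes F: "is_functor (op_cat C) (set_cat \<V>) F" and fg: "f \<in> Arr C" "g \<in> Arr C" "Cod C g = Dom C f"
    and a: "a \<in> FObj F (Cod C f)"
  shows "fn (FArr F (f \<cdot>\<^bsub>C\<^esub> g)) a = fn (FArr F g) (fn (FArr F f) a)"
proof -
  have "FArr F (f \<cdot>\<^bsub>C\<^esub> g) = FArr F g \<cdot>\<^bsub>set_cat \<V>\<^esub> FArr F f"
    using F fg unfolding is_functor_def by simp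
  moreover obtain h k where "FArr F f = (FObj F (Cod C f), FObj F (Dom C f), h)"
      "FArr F g = (FObj F (Cod C g), FObj F (Dom C g), k)"
    using presheaf_restriction_hom[OF F fg(1)] presheaf_restriction_hom[OF F fg(2)]
    by (metis prod.collapse set_cat_hom)
  ultimately show ?thesis
    using a by simp
qed

lemma presheaf_restriction_Id:
  assumes "is_functor (op_cat C) (set_cat \<V>) F" "A \<in> Obj C" "a \<in> FObj F A"
  shows "fn (FArr F (Id C A)) a = a"
  using assms unfolding is_functor_def by simp

section \<open>The canonical topology\<close>

context giraud
begin

text \<open>
  The canonical topology consists of all sieves that are jointly epic, where the test objects for
  epimorphy range over the whole of \<open>E\<close> and not only over the generators.
\<close>

definition canonical :: "'o \<Rightarrow> 'a set set" where
  "canonical A = {S. sieve (full_subcat E G) A S \<and> jointly_epic E A S}"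

lemma sieve_iff_points:
  assumes "A \<in> G"
  shows "sieve (full_subcat E G) A S \<longleftrightarrow> S \<subseteq> points A \<and> (\<forall>f\<in>S. \<forall>g\<in>points (Dom E f). f \<cdot> g \<in> S)"
  using assms unfolding sieve_def points_def by (auto 4 4)

lemma pullback_sieve_eq_points:
  "Dom E f \<in> G \<Longrightarrow> pullback_sieve (full_subcat E G) f S = {g \<in> points (Dom E f). f \<cdot> g \<in> S}"
  unfolding pullback_sieve_def points_def by auto

lemma jointly_epic_pullback_sieve:
  assumes A: "A \<in> G" and S: "sieve (full_subcat E G) A S" "jointly_epic E A S" and g: "g \<in> hom E B A"
  shows "jointly_epic E B {w \<in> points B. g \<cdot> w \<in> S}"
proof (rule jointly_epic_mono)
  have S': "S \<subseteq> points A" "\<And>f h. f \<in> S \<Longrightarrow> h \<in> points (Dom E f) \<Longrightarrow> f \<cdot> h \<in> S"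
    using S(1) sieve_iff_points[OF A] by blast+
  have "small U S"
    using small_subset[OF S'(1) small_points[OF G_Obj[OF A]]] .
  then show "jointly_epic E B (lifting_points g S)"
    using lifting_points_jointly_epic S(2) g by blast
  show "lifting_points g S \<subseteq> {w \<in> points B. g \<cdot> w \<in> S}"
    using S'(2) homD[OF g] pointsI points_G unfolding lifting_points_def by auto
qed (use points_hom in auto)

lemma canonical_topology: "grothendieck_topology (full_subcat E G) canonical"
  unfolding grothendieck_topology_def
proof (intro conjI ballI allI impI)
  fix A S assume "A \<in> Obj (full_subcat E G)" "S \<in> canonical A"
  then show "sieve (full_subcat E G) A S"
    by (simp add: canonical_def)
next
  fix A assume "A \<in> Obj (full_subcat E G)"
  then have A: "A \<in> G"
    by simp
  have "{f \<in> Arr (full_subcat E G). Cod (full_subcat E G) f = A} = points A"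
    using A by (auto simp: points_def)
  moreover have "points A \<in> canonical A"
    using A points_jointly_epic[OF G_Obj[OF A]] Comp_points points_hom
    by (auto simp: canonical_def sieve_iff_points)
  ultimately show "{f \<in> Arr (full_subcat E G). Cod (full_subcat E G) f = A} \<in> canonical A"
    by simp
next
  fix f S assume "f \<in> Arr (full_subcat E G)" and S: "S \<in> canonical (Cod (full_subcat E G) f)"
  then have f: "f \<in> Arr E" "Dom E f \<in> G" "Cod E f \<in> G"
    by auto
  have S': "sieve (full_subcat E G) (Cod E f) S" "jointly_epic E (Cod E f) S"
    using S by (auto simp: canonical_def)
  have "sieve (full_subcat E G) (Dom E f) {w \<in> points (Dom E f). f \<cdot> w \<in> S}"
    unfolding sieve_iff_points[OF f(2)]
  proof (intro conjI ballI)
    fix w g assume "w \<in> {w \<in> points (Dom E f). f \<cdot> w \<in> S}" and g: "g \<in> points (Dom E w)"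
    then have w: "w \<in> points (Dom E f)" "f \<cdot> w \<in> S"
      by auto
    have "(f \<cdot> w) \<cdot> g \<in> S"
      using S'(1) w g Dom_Comp_points[OF w(1) Arr_hom[OF f(1)]] unfolding sieve_iff_points[OF f(3)] by simp
    then show "w \<cdot> g \<in> {w \<in> points (Dom E f). f \<cdot> w \<in> S}"
      using Comp_points[OF g points_hom[OF w(1)]]
        Comp_assoc[OF points_hom[OF g] points_hom[OF w(1)] Arr_hom[OF f(1)]] by simp
  qed blast
  then show "pullback_sieve (full_subcat E G) f S \<in> canonical (Dom (full_subcat E G) f)"
    using jointly_epic_pullback_sieve[OF f(3) S' Arr_hom[OF f(1)]] pullback_sieve_eq_points[OF f(2)]
    by (simp add: canonical_def)
next
  fix A S R assume "A \<in> Obj (full_subcat E G)" and S: "S \<in> canonical A"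
    and R: "sieve (full_subcat E G) A R \<and>
      (\<forall>f\<in>S. pullback_sieve (full_subcat E G) f R \<in> canonical (Dom (full_subcat E G) f))"
  then have A: "A \<in> G"
    by simp
  have S': "jointly_epic E A S" "S \<subseteq> points A"
    using S by (auto simp: canonical_def sieve_iff_points[OF A])
  have "jointly_epic E A R"
  proof (rule jointly_epic_trans[OF S'(1)])
    fix f assume f: "f \<in> S"
    show "jointly_epic E (Dom E f) (pullback_sieve (full_subcat E G) f R)"
      using R f by (simp add: canonical_def)
    show "f \<cdot> l \<in> R" if "l \<in> pullback_sieve (full_subcat E G) f R" for l
      using that by (simp add: pullback_sieve_def)
  next
    show "f \<in> hom E (Dom E f) A" if "f \<in> R" for f
      using that R points_hom unfolding sieve_iff_points[OF A] by blast
  qed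
  then show "R \<in> canonical A"
    using R by (simp add: canonical_def)
qed

lemma hom_presheaf_functor:
  assumes X: "X \<in> Obj E"
  shows "is_functor (op_cat (full_subcat E G)) (set_cat UNIV) (hom_presheaf E X)"
  unfolding is_functor_def
proof (intro conjI ballI impI)
  fix f assume "f \<in> Arr (op_cat (full_subcat E G))"
  then show "FArr (hom_presheaf E X) f \<in> hom (set_cat UNIV) (FObj (hom_presheaf E X) (Dom (op_cat (full_subcat E G)) f))
      (FObj (hom_presheaf E X) (Cod (op_cat (full_subcat E G)) f))"
    using Comp_in_hom[OF Arr_hom] by (auto simp: hom_presheaf_def set_cat_hom)
next
  fix A assume "A \<in> Obj (op_cat (full_subcat E G))"
  then have A: "A \<in> Obj E"
    using G_Obj by simp
  show "FArr (hom_presheaf E X) (Id (op_cat (full_subcat E G)) A) = Id (set_cat UNIV) (FObj (hom_presheaf E X) A)"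
    using A Comp_Id_right by (auto simp: hom_presheaf_def fun_eq_iff)
next
  fix f g assume "f \<in> Arr (op_cat (full_subcat E G))" "g \<in> Arr (op_cat (full_subcat E G))"
    "Cod (op_cat (full_subcat E G)) f = Dom (op_cat (full_subcat E G)) g"
  then have fg: "f \<in> hom E (Dom E f) (Cod E f)" "g \<in> hom E (Dom E g) (Dom E f)" "f \<in> Arr E" "g \<in> Arr E"
      "Cod E g = Dom E f"
    by (auto simp: hom_def)
  then show "FArr (hom_presheaf E X) (g \<cdot>\<^bsub>op_cat (full_subcat E G)\<^esub> f) =
      FArr (hom_presheaf E X) g \<cdot>\<^bsub>set_cat UNIV\<^esub> FArr (hom_presheaf E X) f"
    using Comp_in_hom[OF fg(1)] Comp_assoc[OF fg(2,1)] by (auto simp: hom_presheaf_def fun_eq_iff)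
qed simp

lemma hom_presheaf_simps [simp]:
  "FObj (hom_presheaf C X) A = hom C A X"
  "g \<in> hom C (Cod C f) X \<Longrightarrow> fn (FArr (hom_presheaf C X) f) g = g \<cdot>\<^bsub>C\<^esub> f"
  by (auto simp: hom_presheaf_def)

lemma hom_presheaf_sheaf:
  assumes X: "X \<in> Obj E"
  shows "is_sheaf (full_subcat E G) canonical (hom_presheaf E X)"
  unfolding is_sheaf_def
proof (intro conjI ballI allI impI hom_presheaf_functor[OF X])
  fix A S x assume "A \<in> Obj (full_subcat E G)" "S \<in> canonical A"
    and x: "matching_family (full_subcat E G) (hom_presheaf E X) S x"
  then have A: "A \<in> G" and S: "S \<subseteq> points A" "jointly_epic E A S"
    using sieve_iff_points by (auto simp: canonical_def)
  have f: "f \<in> hom E (Dom E f) A" if "f \<in> S" for f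
    using that S(1) points_hom by blast
  have xf: "x f \<in> hom E (Dom E f) X" if "f \<in> S" for f
    using x that unfolding matching_family_def by simp
  have xg: "x f \<cdot> a = x (f \<cdot> a)" if "f \<in> S" "B \<in> G" "a \<in> hom E B (Dom E f)" for f a B
  proof -
    have "a \<in> Arr (full_subcat E G)" "Cod E a = Dom E f"
      using that homD[OF that(3)] points_G S(1) by auto
    then have "fn (FArr (hom_presheaf E X) a) (x f) = x (f \<cdot> a)"
      using x that(1) unfolding matching_family_def by auto
    then show ?thesis
      using xf[OF that(1)] homD[OF that(3)] by simp
  qed
  have "\<exists>h\<in>hom E A X. \<forall>f\<in>S. h \<cdot> f = x f"
  proof (rule glue_arrows[OF small_subset[OF S(1) small_points[OF G_Obj[OF A]]] S(2) _ X])
    show "\<And>f. f \<in> S \<Longrightarrow> x f \<in> hom E (Dom E f) X"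
      by (rule xf)
    fix f g B a b assume fg: "f \<in> S" "g \<in> S" and B: "B \<in> G"
      and ab: "a \<in> hom E B (Dom E f)" "b \<in> hom E B (Dom E g)" "f \<cdot> a = g \<cdot> b"
    show "x f \<cdot> a = x g \<cdot> b"
      using xg[OF fg(1) B ab(1)] xg[OF fg(2) B ab(2)] ab(3) by simp
  qed blast
  then obtain h where h: "h \<in> hom E A X" "\<And>f. f \<in> S \<Longrightarrow> h \<cdot> f = x f"
    by blast
  show "\<exists>!a. a \<in> FObj (hom_presheaf E X) A \<and> (\<forall>f\<in>S. fn (FArr (hom_presheaf E X) f) a = x f)"
  proof (rule ex1I)
    have Cod: "Cod E f = A" if "f \<in> S" for f
      using homD[OF f[OF that]] by simp
    show "h \<in> FObj (hom_presheaf E X) A \<and> (\<forall>f\<in>S. fn (FArr (hom_presheaf E X) f) h = x f)"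
      using h Cod by simp
    fix k assume k: "k \<in> FObj (hom_presheaf E X) A \<and> (\<forall>f\<in>S. fn (FArr (hom_presheaf E X) f) k = x f)"
    then have "k \<in> hom E A X"
      by simp
    then show "k = h"
    proof (rule jointly_epicD[OF S(2) _ h(1)])
      show "k \<cdot> f = h \<cdot> f" if "f \<in> S" for f
        using k Cod[OF that] h(2)[OF that] that by auto
    qed
  qed
qed

text \<open>
  If all presheaves represented by objects of \<open>E\<close> are separated for a covering sieve, two arrows
  that agree on the sieve are equal, i.e. the sieve is jointly epic.  So no subcanonical topology
  has more covering sieves.
\<close>

theorem canonical_is_canonical: "is_canonical_topology_on E G canonical"
  unfolding is_canonical_topology_on_def ambient_subcanonical_def
proof (intro conjI ballI allI impI canonical_topology hom_presheaf_sheaf subsetI)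
  fix J A S
  assume "grothendieck_topology (full_subcat E G) J \<and>
      (\<forall>X\<in>Obj E. is_sheaf (full_subcat E G) J (hom_presheaf E X))"
    and A: "A \<in> G" and S: "S \<in> J A"
  then have J: "grothendieck_topology (full_subcat E G) J"
    and sheaf: "\<forall>X\<in>Obj E. is_sheaf (full_subcat E G) J (hom_presheaf E X)"
    by auto
  have sieve: "sieve (full_subcat E G) A S"
    using J A S unfolding grothendieck_topology_def by simp
  then have S': "S \<subseteq> points A" "\<And>f g. f \<in> S \<Longrightarrow> g \<in> points (Dom E f) \<Longrightarrow> f \<cdot> g \<in> S"
    unfolding sieve_iff_points[OF A] by auto
  have f: "f \<in> hom E (Dom E f) A" if "f \<in> S" for f
    using that S' points_hom by blast
  have "jointly_epic E A S"
  proof (rule jointly_epicI[OF G_Obj[OF A] f])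
    fix Y u v assume uv: "u \<in> hom E A Y" "v \<in> hom E A Y" and eq: "\<And>f. f \<in> S \<Longrightarrow> u \<cdot> f = v \<cdot> f"
    have glue: "\<exists>!a. a \<in> hom E A Y \<and> (\<forall>f\<in>S. fn (FArr (hom_presheaf E Y) f) a = x f)"
      if "matching_family (full_subcat E G) (hom_presheaf E Y) S x" for x
      using sheaf A S hom_Obj[OF uv(1)] that unfolding is_sheaf_def by simp
    have "matching_family (full_subcat E G) (hom_presheaf E Y) S (\<lambda>f. u \<cdot> f)"
      unfolding matching_family_def
    proof (intro conjI ballI impI)
      fix f assume fS: "f \<in> S"
      show "u \<cdot> f \<in> FObj (hom_presheaf E Y) (Dom (full_subcat E G) f)"
        using Comp_in_hom[OF f[OF fS] uv(1)] by simp
      fix g assume "g \<in> Arr (full_subcat E G)" "Cod (full_subcat E G) g = Dom (full_subcat E G) f"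
      then have "g \<in> hom E (Dom E g) (Dom E f)"
        by (auto simp: hom_def)
      then show "fn (FArr (hom_presheaf E Y) g) (u \<cdot> f) =
          u \<cdot> f \<cdot>\<^bsub>full_subcat E G\<^esub> g"
        using Comp_in_hom[OF f[OF fS] uv(1)] Comp_assoc[OF _ f[OF fS] uv(1)] homD[of g E] by auto
    qed
    note ex1 = glue[OF this]
    have "fn (FArr (hom_presheaf E Y) f) u = u \<cdot> f" "fn (FArr (hom_presheaf E Y) f) v = u \<cdot> f"
      if "f \<in> S" for f
      using uv eq[OF that] homD[OF f[OF that]] by simp_all
    then have "u \<in> hom E A Y \<and> (\<forall>f\<in>S. fn (FArr (hom_presheaf E Y) f) u = u \<cdot> f)"
        "v \<in> hom E A Y \<and> (\<forall>f\<in>S. fn (FArr (hom_presheaf E Y) f) v = u \<cdot> f)"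
      using uv by simp_all
    then show "u = v"
      using ex1 by blast
  qed
  then show "S \<in> canonical A"
    using sieve by (simp add: canonical_def)
qed

end

section \<open>Equivalence relations, images and quotients\<close>

context giraud
begin

text \<open>
  Since equality and membership in a subobject can be tested on points, a pair of arrows is an
  equivalence relation as soon as its points are the kernel of some function on the points of \<open>S\<close>.
\<close>

lemma equivalence_relation_of_points:
  assumes d: "d0 \<in> hom E R S" "d1 \<in> hom E R S"
    and P: "is_product E S S P p q" and r: "r \<in> hom E R P" "p \<cdot> r = d0" "q \<cdot> r = d1" "monic E r"
    and ker: "\<And>A s t. A \<in> G \<Longrightarrow> s \<in> hom E A S \<Longrightarrow> t \<in> hom E A S \<Longrightarrow>
      (\<exists>z\<in>hom E A R. d0 \<cdot> z = s \<and> d1 \<cdot> z = t) \<longleftrightarrow> \<theta> s = \<theta> t"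
  shows "is_equivalence_relation E S d0 d1"
proof -
  have pq: "p \<in> hom E P S" "q \<in> hom E P S"
    using product_hom[OF P] by auto
  have factor: "factors_through E t r"
    if t: "t \<in> hom E W P" "p \<cdot> t = a" "q \<cdot> t = b" and eq: "\<And>w. w \<in> points W \<Longrightarrow> \<theta> (a \<cdot> w) = \<theta> (b \<cdot> w)" for t W a b
  proof (rule factors_through_monic_locally[OF r(4,1) t(1)])
    have W: "W \<in> Obj E"
      using hom_Obj[OF t(1)] by blast
    show "small U (points W)" "jointly_epic E W (points W)"
      using W small_points points_jointly_epic by auto
    fix w assume w: "w \<in> points W"
    note w' = points_hom[OF w]
    note tw = Comp_in_hom[OF w' t(1)]
    have ab: "a \<cdot> w = p \<cdot> (t \<cdot> w)" "b \<cdot> w = q \<cdot> (t \<cdot> w)"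
      using Comp_assoc[OF w' t(1) pq(1)] Comp_assoc[OF w' t(1) pq(2)] t(2,3) by simp_all
    obtain z where z: "z \<in> hom E (Dom E w) R" "d0 \<cdot> z = p \<cdot> (t \<cdot> w)" "d1 \<cdot> z = q \<cdot> (t \<cdot> w)"
      using ker[OF points_G[OF w] Comp_in_hom[OF tw pq(1)] Comp_in_hom[OF tw pq(2)]] eq[OF w] ab by auto
    have "r \<cdot> z = t \<cdot> w"
      by (rule product_eq[OF P Comp_in_hom[OF z(1) r(1)] tw])
        (use Comp_assoc[OF z(1) r(1) pq(1)] Comp_assoc[OF z(1) r(1) pq(2)] r z in simp_all)
    then show "\<exists>z\<in>hom E (Dom E w) R. r \<cdot> z = t \<cdot> w"
      using z(1) by blast
  qed
  have ker_d: "\<theta> (d0 \<cdot> w) = \<theta> (d1 \<cdot> w)" if "w \<in> hom E A R" "A \<in> G" for w A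
    using ker[OF that(2) Comp_in_hom[OF that(1) d(1)] Comp_in_hom[OF that(1) d(2)]] that(1) by blast
  have sym: "factors_through E s r" if "s \<in> hom E R P" "p \<cdot> s = d1" "q \<cdot> s = d0" for s
  proof (rule factor[OF that])
    show "\<theta> (d1 \<cdot> w) = \<theta> (d0 \<cdot> w)" if "w \<in> points R" for w
      using ker_d[OF points_hom[OF that] points_G[OF that]] by simp
  qed
  have trans: "factors_through E t r" if T: "is_pullback E d1 d0 T \<pi>0 \<pi>1" and t: "t \<in> hom E T P"
      "p \<cdot> t = d1 \<cdot> \<pi>1" "q \<cdot> t = d0 \<cdot> \<pi>0" for T \<pi>0 \<pi>1 t
  proof (rule factor[OF t])
    note \<pi> = pullback_hom[OF T d(2,1)]
    fix w assume w: "w \<in> points T"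
    note w' = points_hom[OF w]
    note 0 = Comp_in_hom[OF w' \<pi>(1)] and 1 = Comp_in_hom[OF w' \<pi>(2)]
    have "\<theta> (d1 \<cdot> (\<pi>1 \<cdot> w)) = \<theta> (d0 \<cdot> (\<pi>1 \<cdot> w))"
      using ker_d[OF 1 points_G[OF w]] by simp
    also have "d0 \<cdot> (\<pi>1 \<cdot> w) = d1 \<cdot> (\<pi>0 \<cdot> w)"
      using Comp_assoc[OF w' \<pi>(2) d(1)] Comp_assoc[OF w' \<pi>(1) d(2)] \<pi>(3) by simp
    also have "\<theta> (d1 \<cdot> (\<pi>0 \<cdot> w)) = \<theta> (d0 \<cdot> (\<pi>0 \<cdot> w))"
      using ker_d[OF 0 points_G[OF w]] by simp
    finally show "\<theta> ((d1 \<cdot> \<pi>1) \<cdot> w) = \<theta> ((d0 \<cdot> \<pi>0) \<cdot> w)"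
      using Comp_assoc[OF w' \<pi>(2) d(2)] Comp_assoc[OF w' \<pi>(1) d(1)] by simp
  qed
  have refl: "factors_through E \<delta> r" if "\<delta> \<in> hom E S P" "p \<cdot> \<delta> = Id E S" "q \<cdot> \<delta> = Id E S" for \<delta>
    by (rule factor[OF that]) simp
  have "parallel_pair E d0 d1" "Cod E d0 = S" "Dom E d0 = R"
    using d unfolding parallel_pair_def by (auto dest: homD)
  then show ?thesis
    unfolding is_equivalence_relation_def
    by (intro conjI exI[of _ P] exI[of _ p] exI[of _ q] exI[of _ r] ballI allI impI)
      (simp_all add: P r refl sym trans)
qed

lemma lifting_points_singletonE:
  assumes "w \<in> lifting_points g {e}" "g \<in> hom E W X" "e \<in> hom E T Y"
  obtains a where "w \<in> points W" "a \<in> hom E (Dom E w) T" "g \<cdot> w = e \<cdot> a"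
proof -
  have "Dom E g = W" "Dom E e = T"
    using homD[OF assms(2)] homD[OF assms(3)] by auto
  then show ?thesis
    using assms(1) that unfolding lifting_points_def by blast
qed

text \<open>
  The image of \<open>t\<close> is the quotient of \<open>T\<close> by the kernel pair of \<open>t\<close>.  That the induced arrow \<open>m\<close> is
  monic can be tested at points, which locally lift to \<open>T\<close>.
\<close>

lemma image_factorization:
  assumes t: "t \<in> hom E T P"
  obtains R e m where "e \<in> hom E T R" "epic E e" "m \<in> hom E R P" "monic E m" "m \<cdot> e = t"
proof -
  have T: "T \<in> Obj E"
    using hom_Obj[OF t] by blast
  obtain N k0 k1 where N: "is_pullback E t t N k0 k1"
    by (rule pullback_exists[OF finite_limits t t])
  note k = pullback_hom[OF N t t]
  obtain TT p q where TT: "is_product E T T TT p q"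
    by (rule product_exists[OF finite_limits T T])
  have pq: "p \<in> hom E TT T" "q \<in> hom E TT T"
    using product_hom[OF TT] by auto
  obtain r where r: "r \<in> hom E N TT" "p \<cdot> r = k0" "q \<cdot> r = k1"
    by (rule productE[OF TT k(1,2)])
  have "monic E r"
    unfolding monic_def
  proof (intro conjI ballI impI)
    fix W u v assume "u \<in> hom E W (Dom E r)" "v \<in> hom E W (Dom E r)" and eq: "r \<cdot> u = r \<cdot> v"
    then have uv: "u \<in> hom E W N" "v \<in> hom E W N"
      using homD[OF r(1)] by auto
    show "u = v"
      by (rule pullback_eq[OF N uv])
        (use Comp_assoc[OF uv(1) r(1) pq(1)] Comp_assoc[OF uv(1) r(1) pq(2)]
          Comp_assoc[OF uv(2) r(1) pq(1)] Comp_assoc[OF uv(2) r(1) pq(2)] r eq in simp_all)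
  qed (use homD[OF r(1)] in blast)
  moreover have ker: "(\<exists>z\<in>hom E A N. k0 \<cdot> z = a \<and> k1 \<cdot> z = b) \<longleftrightarrow> t \<cdot> a = t \<cdot> b"
    if ab: "a \<in> hom E A T" "b \<in> hom E A T" for A a b
  proof
    assume "\<exists>z\<in>hom E A N. k0 \<cdot> z = a \<and> k1 \<cdot> z = b"
    then obtain z where z: "z \<in> hom E A N" "k0 \<cdot> z = a" "k1 \<cdot> z = b"
      by blast
    then show "t \<cdot> a = t \<cdot> b"
      using Comp_assoc[OF z(1) k(1) t] Comp_assoc[OF z(1) k(2) t] k(3) by simp
  next
    assume "t \<cdot> a = t \<cdot> b"
    then obtain z where "z \<in> hom E A N" "k0 \<cdot> z = a" "k1 \<cdot> z = b"
      by (rule pullbackE[OF N t t ab])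
    then show "\<exists>z\<in>hom E A N. k0 \<cdot> z = a \<and> k1 \<cdot> z = b"
      by blast
  qed
  ultimately have "is_equivalence_relation E T k0 k1"
    by (rule equivalence_relation_of_points[OF k(1,2) TT r])
  then obtain e where e: "is_coequalizer E k0 k1 e"
    using giraud_iii T unfolding giraud_iii_def by blast
  define R where "R = Cod E e"
  have eh: "e \<in> hom E T R" and ek: "e \<cdot> k0 = e \<cdot> k1"
    using e homD[OF k(1)] unfolding is_coequalizer_def R_def hom_def by auto
  obtain m where m: "m \<in> hom E R P" "m \<cdot> e = t"
    by (rule coequalizerE[OF e k(1) eh t k(3)])
  have epi: "small U {e}" "jointly_epic E R {e}"
    by (simp_all add: small_finite[OF universe] epic_jointly_epic[OF coequalizer_epic[OF e] eh])
  have "monic E m"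
    unfolding monic_def
  proof (intro conjI ballI impI)
    fix W \<alpha> \<beta> assume "\<alpha> \<in> hom E W (Dom E m)" "\<beta> \<in> hom E W (Dom E m)" and eq: "m \<cdot> \<alpha> = m \<cdot> \<beta>"
    then have \<alpha>: "\<alpha> \<in> hom E W R" and \<beta>: "\<beta> \<in> hom E W R"
      using homD[OF m(1)] by simp_all
    show "\<alpha> = \<beta>"
    proof (rule jointly_epicD[OF lifting_points_jointly_epic[OF epi \<alpha>] \<alpha> \<beta>])
      fix w assume "w \<in> lifting_points \<alpha> {e}"
      then obtain a where w: "w \<in> points W" and a: "a \<in> hom E (Dom E w) T" "\<alpha> \<cdot> w = e \<cdot> a"
        by (rule lifting_points_singletonE[OF _ \<alpha> eh])
      note w' = points_hom[OF w]
      note \<alpha>w = Comp_in_hom[OF w' \<alpha>] and \<beta>w = Comp_in_hom[OF w' \<beta>]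
      show "\<alpha> \<cdot> w = \<beta> \<cdot> w"
      proof (rule jointly_epicD[OF lifting_points_jointly_epic[OF epi \<beta>w] \<alpha>w \<beta>w])
        fix v assume "v \<in> lifting_points (\<beta> \<cdot> w) {e}"
        then obtain b where v: "v \<in> points (Dom E w)" and b: "b \<in> hom E (Dom E v) T" "(\<beta> \<cdot> w) \<cdot> v = e \<cdot> b"
          by (rule lifting_points_singletonE[OF _ \<beta>w eh])
        note v' = points_hom[OF v]
        note av = Comp_in_hom[OF v' a(1)]
        have \<alpha>wv: "(\<alpha> \<cdot> w) \<cdot> v = e \<cdot> (a \<cdot> v)"
          using Comp_assoc[OF v' a(1) eh] a(2) by simp
        have "t \<cdot> (a \<cdot> v) = m \<cdot> ((\<alpha> \<cdot> w) \<cdot> v)"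
          using Comp_assoc[OF av eh m(1)] m(2) \<alpha>wv by simp
        also have "\<dots> = m \<cdot> ((\<beta> \<cdot> w) \<cdot> v)"
          by (metis eq Comp_assoc[OF v' \<alpha>w m(1)] Comp_assoc[OF v' \<beta>w m(1)] Comp_assoc[OF w' \<alpha> m(1)]
            Comp_assoc[OF w' \<beta> m(1)])
        also have "\<dots> = t \<cdot> b"
          using Comp_assoc[OF b(1) eh m(1)] m(2) b(2) by simp
        finally obtain z where z: "z \<in> hom E (Dom E v) N" "k0 \<cdot> z = a \<cdot> v" "k1 \<cdot> z = b"
          by (rule pullbackE[OF N t t av b(1)])
        then have "e \<cdot> (a \<cdot> v) = e \<cdot> b"
          using Comp_assoc[OF z(1) k(1) eh] Comp_assoc[OF z(1) k(2) eh] ek by simp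
        then show "(\<alpha> \<cdot> w) \<cdot> v = (\<beta> \<cdot> w) \<cdot> v"
          using \<alpha>wv b(2) by simp
      qed
    qed
  qed (use homD[OF m(1)] in blast)
  with eh coequalizer_epic[OF e] m(1) show ?thesis
    using m(2) by (rule that)
qed

text \<open>
  Axiom (iii) does not say that an equivalence relation is the kernel pair of its own quotient \<open>e\<close>.
  It is the kernel pair of some \<open>f\<close>; since \<open>f\<close> factors through \<open>e\<close>, arrows identified by \<open>e\<close> are
  identified by \<open>f\<close> and so are related.
\<close>

lemma effective_quotient:
  assumes R: "is_equivalence_relation E S d0 d1" and d: "d0 \<in> hom E R S" "d1 \<in> hom E R S"
  obtains X e where "e \<in> hom E S X" "epic E e"
    "\<And>W u v. u \<in> hom E W S \<Longrightarrow> v \<in> hom E W S \<Longrightarrow>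
      e \<cdot> u = e \<cdot> v \<longleftrightarrow> (\<exists>z\<in>hom E W R. d0 \<cdot> z = u \<and> d1 \<cdot> z = v)"
proof -
  obtain f e where "is_kernel_pair E d0 d1 f" and e: "is_coequalizer E d0 d1 e"
    using giraud_iii R hom_Obj[OF d(1)] unfolding giraud_iii_def by blast
  then have f: "is_pullback E f f R d0 d1"
    using homD[OF d(1)] unfolding is_kernel_pair_def by simp
  define X Y where "X = Cod E e" and "Y = Cod E f"
  have eh: "e \<in> hom E S X" and ed: "e \<cdot> d0 = e \<cdot> d1"
    using e homD[OF d(1)] unfolding is_coequalizer_def X_def hom_def by auto
  have fh: "f \<in> hom E S Y" and fd: "f \<cdot> d0 = f \<cdot> d1"
    using f homD[OF d(1)] unfolding is_pullback_def Y_def hom_def by auto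
  obtain h where h: "h \<in> hom E X Y" "h \<cdot> e = f"
    by (rule coequalizerE[OF e d(1) eh fh fd])
  have "e \<cdot> u = e \<cdot> v \<longleftrightarrow> (\<exists>z\<in>hom E W R. d0 \<cdot> z = u \<and> d1 \<cdot> z = v)"
    if uv: "u \<in> hom E W S" "v \<in> hom E W S" for W u v
  proof
    assume "e \<cdot> u = e \<cdot> v"
    then have "f \<cdot> u = f \<cdot> v"
      using Comp_assoc[OF uv(1) eh h(1)] Comp_assoc[OF uv(2) eh h(1)] h(2) by simp
    then obtain z where "z \<in> hom E W R" "d0 \<cdot> z = u" "d1 \<cdot> z = v"
      by (rule pullbackE[OF f fh fh uv])
    then show "\<exists>z\<in>hom E W R. d0 \<cdot> z = u \<and> d1 \<cdot> z = v"
      by blast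
  next
    assume "\<exists>z\<in>hom E W R. d0 \<cdot> z = u \<and> d1 \<cdot> z = v"
    then obtain z where z: "z \<in> hom E W R" "d0 \<cdot> z = u" "d1 \<cdot> z = v"
      by blast
    then show "e \<cdot> u = e \<cdot> v"
      using Comp_assoc[OF z(1) d(1) eh] Comp_assoc[OF z(1) d(2) eh] ed by simp
  qed
  with eh coequalizer_epic[OF e] show ?thesis
    by (rule that)
qed

end

section \<open>Sheaves for the canonical topology are represented by objects\<close>

context giraud
begin

context
  fixes F :: "('o, 'a, 'x) presheaf"
  assumes F: "is_sheaf (full_subcat E G) canonical F"
begin

abbreviation restr :: "'a \<Rightarrow> 'x \<Rightarrow> 'x" where
  "restr w a \<equiv> fn (FArr F w) a"

lemma sheaf_functor: "is_functor (op_cat (full_subcat E G)) (set_cat UNIV) F"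
  using F unfolding is_sheaf_def by blast

lemma points_Arr_full_subcat: "w \<in> points A \<Longrightarrow> A \<in> G \<Longrightarrow> w \<in> Arr (full_subcat E G)"
  unfolding points_def by simp

lemma points_Cod: "w \<in> points A \<Longrightarrow> Cod E w = A"
  unfolding points_def by simp

lemma restr_in: "w \<in> points A \<Longrightarrow> A \<in> G \<Longrightarrow> a \<in> FObj F A \<Longrightarrow> restr w a \<in> FObj F (Dom E w)"
  using presheaf_restriction_in[OF sheaf_functor, of w a] points_Arr_full_subcat points_Cod by simp

lemma restr_Comp:
  assumes w: "w \<in> points A" "A \<in> G" and v: "v \<in> points (Dom E w)" and a: "a \<in> FObj F A"
  shows "restr (w \<cdot> v) a = restr v (restr w a)"
  using presheaf_restriction_Comp[OF sheaf_functor, of w v a] points_Arr_full_subcat[OF w]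
    points_Arr_full_subcat[OF v points_G[OF w(1)]] points_Cod[OF w(1)] points_Cod[OF v] a by simp

lemma restr_Id: "A \<in> G \<Longrightarrow> a \<in> FObj F A \<Longrightarrow> restr (Id E A) a = a"
  using presheaf_restriction_Id[OF sheaf_functor, of A a] by simp

lemma sheaf_glue:
  assumes A: "A \<in> G" and S: "S \<subseteq> points A" "jointly_epic E A S"
    and sieve: "\<And>f g. f \<in> S \<Longrightarrow> g \<in> points (Dom E f) \<Longrightarrow> f \<cdot> g \<in> S"
    and x: "\<And>f. f \<in> S \<Longrightarrow> x f \<in> FObj F (Dom E f)"
    and nat: "\<And>f g. f \<in> S \<Longrightarrow> g \<in> points (Dom E f) \<Longrightarrow> restr g (x f) = x (f \<cdot> g)"
  shows "\<exists>!a. a \<in> FObj F A \<and> (\<forall>f\<in>S. restr f a = x f)"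
proof -
  have "S \<in> canonical A"
    using S sieve by (simp add: canonical_def sieve_iff_points[OF A])
  moreover have "matching_family (full_subcat E G) F S x"
    using x nat unfolding matching_family_def points_def by simp
  ultimately show ?thesis
    using F A unfolding is_sheaf_def by simp
qed

text \<open>
  The points at which two sections agree form a sieve, so sections are separated by an arbitrary
  jointly epic set of points.
\<close>

lemma sheaf_separated:
  assumes A: "A \<in> G" and ab: "a \<in> FObj F A" "b \<in> FObj F A" and S: "jointly_epic E A S" "S \<subseteq> points A"
    and eq: "\<And>w. w \<in> S \<Longrightarrow> restr w a = restr w b"
  shows "a = b"
proof -
  let ?S = "{w \<in> points A. restr w a = restr w b}"
  have "\<exists>!c. c \<in> FObj F A \<and> (\<forall>f\<in>?S. restr f c = restr f a)"
  proof (rule sheaf_glue[OF A])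
    show "jointly_epic E A ?S"
      using S eq points_hom by (intro jointly_epic_mono[OF S(1)]) auto
    fix f g assume f: "f \<in> ?S" and g: "g \<in> points (Dom E f)"
    then have fA: "f \<in> points A" "restr f a = restr f b"
      by auto
    then show "f \<cdot> g \<in> ?S"
      using Comp_points[OF g points_hom[OF fA(1)]] restr_Comp[OF fA(1) A g] ab by simp
    show "restr g (restr f a) = restr (f \<cdot> g) a"
      using restr_Comp[OF fA(1) A g ab(1)] by simp
  next
    show "restr f a \<in> FObj F (Dom E f)" if "f \<in> ?S" for f
      using that restr_in[OF _ A ab(1)] by blast
  qed blast
  moreover have "a \<in> FObj F A \<and> (\<forall>f\<in>?S. restr f a = restr f a)" "b \<in> FObj F A \<and> (\<forall>f\<in>?S. restr f b = restr f a)"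
    using ab by auto
  ultimately show ?thesis
    by blast
qed

text \<open>
  To map the points of an object \<open>S\<close> naturally to the sections of a sheaf, it is enough to do so
  locally: on a set of points closed under precomposition into which every point is carried by
  jointly many points of its domain.  The partial map is given as a functional relation \<open>\<Theta>\<close>.
\<close>

lemma extend_to_points:
  assumes dom: "\<And>s a. \<Theta> s a \<Longrightarrow> a \<in> FObj F (Dom E s)"
    and functional: "\<And>s a b. s \<in> points S \<Longrightarrow> \<Theta> s a \<Longrightarrow> \<Theta> s b \<Longrightarrow> a = b"
    and natural: "\<And>s a w. s \<in> points S \<Longrightarrow> \<Theta> s a \<Longrightarrow> w \<in> points (Dom E s) \<Longrightarrow> \<Theta> (s \<cdot> w) (restr w a)"
    and cover: "\<And>s. s \<in> points S \<Longrightarrow> jointly_epic E (Dom E s) {w \<in> points (Dom E s). \<exists>a. \<Theta> (s \<cdot> w) a}"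
  obtains \<phi> where "\<And>s. s \<in> points S \<Longrightarrow> \<phi> s \<in> FObj F (Dom E s)"
    "\<And>s w. s \<in> points S \<Longrightarrow> w \<in> points (Dom E s) \<Longrightarrow> \<phi> (s \<cdot> w) = restr w (\<phi> s)"
    "\<And>s a. s \<in> points S \<Longrightarrow> \<Theta> s a \<Longrightarrow> \<phi> s = a"
proof -
  have "\<exists>a. a \<in> FObj F (Dom E s) \<and> (\<forall>w\<in>points (Dom E s). \<forall>b. \<Theta> (s \<cdot> w) b \<longrightarrow> restr w a = b)"
    if s: "s \<in> points S" for s
  proof -
    note s' = points_hom[OF s]
    let ?T = "{w \<in> points (Dom E s). \<exists>a. \<Theta> (s \<cdot> w) a}"
    define x where "x w = (THE a. \<Theta> (s \<cdot> w) a)" for w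
    have x_eq: "x w = a" if "w \<in> points (Dom E s)" "\<Theta> (s \<cdot> w) a" for w a
      unfolding x_def
      by (rule the_equality, rule that(2)) (rule functional[OF Comp_points[OF that(1) s'] _ that(2)])
    have step: "f \<cdot> g \<in> points (Dom E s)" "\<Theta> (s \<cdot> (f \<cdot> g)) (restr g a)"
      if f: "f \<in> points (Dom E s)" and fa: "\<Theta> (s \<cdot> f) a" and g: "g \<in> points (Dom E f)" for f g a
    proof -
      show "f \<cdot> g \<in> points (Dom E s)"
        by (rule Comp_points[OF g points_hom[OF f]])
      have "\<Theta> ((s \<cdot> f) \<cdot> g) (restr g a)"
        using natural[OF Comp_points[OF f s'] fa] g Dom_Comp_points[OF f s'] by simp
      then show "\<Theta> (s \<cdot> (f \<cdot> g)) (restr g a)"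
        using Comp_assoc[OF points_hom[OF g] points_hom[OF f] s'] by simp
    qed
    have "\<exists>!a. a \<in> FObj F (Dom E s) \<and> (\<forall>f\<in>?T. restr f a = x f)"
    proof (rule sheaf_glue[OF points_G[OF s] _ cover[OF s]])
      fix f assume "f \<in> ?T"
      then obtain a where f: "f \<in> points (Dom E s)" "\<Theta> (s \<cdot> f) a"
        by blast
      show "x f \<in> FObj F (Dom E f)"
        using dom[OF f(2)] x_eq[OF f] Dom_Comp_points[OF f(1) s'] by simp
      fix g assume g: "g \<in> points (Dom E f)"
      show "f \<cdot> g \<in> ?T"
        using step[OF f g] by blast
      show "restr g (x f) = x (f \<cdot> g)"
        using x_eq[OF f] x_eq[OF step[OF f g]] by simp
    qed blast
    then obtain a where "a \<in> FObj F (Dom E s)" "\<forall>f\<in>?T. restr f a = x f"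
      by blast
    then show ?thesis
      using x_eq by (intro exI[of _ a]) auto
  qed
  then obtain \<phi> where \<phi>: "\<And>s. s \<in> points S \<Longrightarrow> \<phi> s \<in> FObj F (Dom E s)"
    and \<phi>_local: "\<And>s w b. s \<in> points S \<Longrightarrow> w \<in> points (Dom E s) \<Longrightarrow> \<Theta> (s \<cdot> w) b \<Longrightarrow> restr w (\<phi> s) = b"
    by metis
  show ?thesis
  proof (rule that[OF \<phi>])
    fix s w assume s: "s \<in> points S" and w: "w \<in> points (Dom E s)"
    note s' = points_hom[OF s] and w' = points_hom[OF w]
    note sw = Comp_points[OF w s'] and Dom_sw = Dom_Comp_points[OF w s']
    show "\<phi> (s \<cdot> w) = restr w (\<phi> s)"
    proof (rule sheaf_separated[OF points_G[OF w]])
      show "\<phi> (s \<cdot> w) \<in> FObj F (Dom E w)"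
        using \<phi>[OF sw] Dom_sw by simp
      show "restr w (\<phi> s) \<in> FObj F (Dom E w)"
        using restr_in[OF w points_G[OF s] \<phi>[OF s]] .
      show "jointly_epic E (Dom E w) {v \<in> points (Dom E w). \<exists>a. \<Theta> ((s \<cdot> w) \<cdot> v) a}"
        using cover[OF sw] Dom_sw by simp
      fix v assume "v \<in> {v \<in> points (Dom E w). \<exists>a. \<Theta> ((s \<cdot> w) \<cdot> v) a}"
      then obtain b where v: "v \<in> points (Dom E w)" and b: "\<Theta> ((s \<cdot> w) \<cdot> v) b"
        by blast
      have b': "\<Theta> (s \<cdot> (w \<cdot> v)) b"
        using b Comp_assoc[OF points_hom[OF v] w' s'] by simp
      have "restr v (\<phi> (s \<cdot> w)) = b"
        using \<phi>_local[OF sw _ b] v Dom_sw by simp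
      also have "b = restr (w \<cdot> v) (\<phi> s)"
        using \<phi>_local[OF s Comp_points[OF v w'] b'] by simp
      also have "\<dots> = restr v (restr w (\<phi> s))"
        by (rule restr_Comp[OF w points_G[OF s] v \<phi>[OF s]])
      finally show "restr v (\<phi> (s \<cdot> w)) = restr v (restr w (\<phi> s))" .
    qed blast
  next
    fix s a assume s: "s \<in> points S" and a: "\<Theta> s a"
    have A: "Dom E s \<in> G" and A': "Dom E s \<in> Obj E"
      using points_G[OF s] G_Obj by auto
    have "restr (Id E (Dom E s)) (\<phi> s) = a"
      using \<phi>_local[OF s pointsI[OF Id_in_hom[OF A'] A]] a Comp_Id_right[OF points_hom[OF s]] by simp
    then show "\<phi> s = a"
      using restr_Id[OF A \<phi>[OF s]] by simp
  qed
qed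

text \<open>
  A sheaf with small values is presented by generators and relations: \<open>S\<close> is the coproduct of one
  copy of \<open>A\<close> for each section over \<open>A\<close>, whose points map to sections by \<open>\<phi>\<close>, and two points
  of \<open>S\<close> are to be identified if \<open>\<phi>\<close> agrees on them.  The subobject \<open>R\<close> of \<open>S \<times> S\<close> imposing these
  relations is the image of the coproduct of all the pairs concerned.  The sheaf property gives that
  no further points of \<open>S \<times> S\<close> lie in \<open>R\<close>, so \<open>R\<close> is an equivalence relation; effectivity of \<open>R\<close>
  makes the map \<open>\<psi>\<close> induced on the points of the quotient injective.
\<close>

lemma sheaf_representable:
  assumes small: "\<And>A. A \<in> G \<Longrightarrow> small U (FObj F A)"
  obtains X \<psi> where "X \<in> Obj E" "\<And>A. A \<in> G \<Longrightarrow> bij_betw \<psi> (hom E A X) (FObj F A)"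
    "\<And>x w. x \<in> points X \<Longrightarrow> w \<in> points (Dom E x) \<Longrightarrow> \<psi> (x \<cdot> w) = restr w (\<psi> x)"
proof -
  define I where "I = Sigma G (FObj F)"
  have smallI: "small U I"
    unfolding I_def using giraud_v small unfolding giraud_v_def by (intro small_Sigma[OF universe]) auto
  have fstI: "fst i \<in> G" "snd i \<in> FObj F (fst i)" if "i \<in> I" for i
    using that by (auto simp: I_def)
  obtain S \<iota> where S: "is_coproduct E I fst S \<iota>"
    by (rule coproduct_exists[OF smallI]) (use fstI(1) G_Obj in blast)+
  have SO: "S \<in> Obj E"
    using coproduct_Obj[OF S] .
  note \<iota> = coproduct_hom[OF S]
  (* A point of S through the summand of a section a over A is a point u of A, and has to be mapped to
     the restriction of a along u. *)
  define \<Theta> where "\<Theta> s a \<longleftrightarrow> s \<in> points S \<and> (\<exists>i\<in>I. \<exists>u\<in>hom E (Dom E s) (fst i). s = \<iota> i \<cdot> u \<and> a = restr u (snd i))"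
    for s a
  obtain \<phi> where \<phi>: "\<And>s. s \<in> points S \<Longrightarrow> \<phi> s \<in> FObj F (Dom E s)"
    and \<phi>_Comp: "\<And>s w. s \<in> points S \<Longrightarrow> w \<in> points (Dom E s) \<Longrightarrow> \<phi> (s \<cdot> w) = restr w (\<phi> s)"
    and \<phi>_\<Theta>: "\<And>s a. s \<in> points S \<Longrightarrow> \<Theta> s a \<Longrightarrow> \<phi> s = a"
  proof (rule extend_to_points[where S = S and \<Theta> = \<Theta>])
    fix s a assume "\<Theta> s a"
    then obtain i u where s: "s \<in> points S" and i: "i \<in> I" and u: "u \<in> hom E (Dom E s) (fst i)"
      and su: "s = \<iota> i \<cdot> u" "a = restr u (snd i)"
      unfolding \<Theta>_def by blast
    have uP: "u \<in> points (fst i)"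
      by (rule pointsI[OF u points_G[OF s]])
    have Dom_u: "Dom E u = Dom E s"
      using homD[OF u] by simp
    show in_F: "a \<in> FObj F (Dom E s)"
      using restr_in[OF uP fstI[OF i]] su Dom_u by simp
    show "\<Theta> (s \<cdot> w) (restr w a)" if w: "w \<in> points (Dom E s)" for w
    proof -
      note w' = points_hom[OF w]
      have "s \<cdot> w = \<iota> i \<cdot> (u \<cdot> w)"
        using Comp_assoc[OF w' u \<iota>[OF i]] su(1) by simp
      moreover have "restr w a = restr (u \<cdot> w) (snd i)"
        using restr_Comp[OF uP fstI(1)[OF i] _ fstI(2)[OF i], of w] w Dom_u su(2) by simp
      ultimately show ?thesis
        unfolding \<Theta>_def using Comp_points[OF w points_hom[OF s]] Dom_Comp_points[OF w points_hom[OF s]]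
          i Comp_in_hom[OF w' u] by auto
    qed
    fix b assume "\<Theta> s b"
    then obtain j v where j: "j \<in> I" and v: "v \<in> hom E (Dom E s) (fst j)" and sv: "s = \<iota> j \<cdot> v" "b = restr v (snd j)"
      unfolding \<Theta>_def by blast
    have vP: "v \<in> points (fst j)"
      by (rule pointsI[OF v points_G[OF s]])
    have b_in: "b \<in> FObj F (Dom E s)"
      using restr_in[OF vP fstI[OF j]] sv homD[OF v] by simp
    (* Either the two presentations coincide, or Dom s is covered by the empty family and F has at most
       one section over it. *)
    have "\<iota> i \<cdot> u = \<iota> j \<cdot> v"
      using su(1) sv(1) by simp
    then consider "i = j" "u = v" | "jointly_epic E (Dom E s) {}"
      using coproduct_injections_disjoint[OF smallI S i j u v] by blast
    then show "a = b"
    proof cases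
      case 1
      then show ?thesis
        using su sv by simp
    next
      case 2
      then show ?thesis
        using sheaf_separated[OF points_G[OF s] in_F b_in] by blast
    qed
  next
    fix s assume s: "s \<in> points S"
    note s' = points_hom[OF s]
    show "jointly_epic E (Dom E s) {w \<in> points (Dom E s). \<exists>a. \<Theta> (s \<cdot> w) a}"
    proof (rule jointly_epic_mono[OF coproduct_points_jointly_epic[OF smallI S s']])
      show "{w \<in> points (Dom E s). \<exists>k\<in>I. \<exists>u\<in>hom E (Dom E w) (fst k). s \<cdot> w = \<iota> k \<cdot> u}
          \<subseteq> {w \<in> points (Dom E s). \<exists>a. \<Theta> (s \<cdot> w) a}"
      proof
        fix w assume "w \<in> {w \<in> points (Dom E s). \<exists>k\<in>I. \<exists>u\<in>hom E (Dom E w) (fst k). s \<cdot> w = \<iota> k \<cdot> u}"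
        then obtain k u where w: "w \<in> points (Dom E s)" and "k \<in> I" "u \<in> hom E (Dom E w) (fst k)" "s \<cdot> w = \<iota> k \<cdot> u"
          by blast
        then have "\<Theta> (s \<cdot> w) (restr u (snd k))"
          unfolding \<Theta>_def using Comp_points[OF w s'] Dom_Comp_points[OF w s'] by auto
        then show "w \<in> {w \<in> points (Dom E s). \<exists>a. \<Theta> (s \<cdot> w) a}"
          using w by blast
      qed
    qed (use points_hom in blast)
  qed blast
  define K where "K = {(s, t). s \<in> points S \<and> t \<in> points S \<and> Dom E s = Dom E t \<and> \<phi> s = \<phi> t}"
  have "K \<subseteq> Sigma (points S) (\<lambda>_. points S)"
    unfolding K_def by auto
  then have smallK: "small U K"
    using small_Sigma[OF universe small_points[OF SO] small_points[OF SO]] small_subset by blast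
  have K: "fst k \<in> hom E (Dom E (fst k)) S" "snd k \<in> hom E (Dom E (fst k)) S"
      "fst k \<in> points S" "snd k \<in> points S" "\<phi> (fst k) = \<phi> (snd k)" if "k \<in> K" for k
    using that points_hom unfolding K_def by force+
  obtain T \<kappa> where T: "is_coproduct E K (\<lambda>k. Dom E (fst k)) T \<kappa>"
    by (rule coproduct_exists[OF smallK, of "\<lambda>k. Dom E (fst k)"]) (use K(1) hom_Obj in blast)+
  note \<kappa> = coproduct_hom[OF T]
  obtain P p q where P: "is_product E S S P p q"
    by (rule product_exists[OF finite_limits SO SO])
  have pq: "p \<in> hom E P S" "q \<in> hom E P S"
    using product_hom[OF P] by auto
  have PO: "P \<in> Obj E"
    using hom_Obj[OF pq(1)] by blast
  have "\<exists>h. h \<in> hom E (Dom E (fst k)) P \<and> p \<cdot> h = fst k \<and> q \<cdot> h = snd k" if "k \<in> K" for k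
    by (rule productE[OF P K(1,2)[OF that]]) blast
  then obtain pair where pair: "\<And>k. k \<in> K \<Longrightarrow> pair k \<in> hom E (Dom E (fst k)) P"
    and p_pair: "\<And>k. k \<in> K \<Longrightarrow> p \<cdot> pair k = fst k" and q_pair: "\<And>k. k \<in> K \<Longrightarrow> q \<cdot> pair k = snd k"
    by metis
  obtain t where t: "t \<in> hom E T P" and t\<kappa>: "\<And>k. k \<in> K \<Longrightarrow> t \<cdot> \<kappa> k = pair k"
    by (rule coproductE[OF T PO, of pair]) (use pair in blast)+
  obtain R e m where e: "e \<in> hom E T R" "epic E e" and m: "m \<in> hom E R P" "monic E m" and me: "m \<cdot> e = t"
    by (rule image_factorization[OF t])
  define d0 where "d0 = p \<cdot> m"
  define d1 where "d1 = q \<cdot> m"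
  have d: "d0 \<in> hom E R S" "d1 \<in> hom E R S"
    unfolding d0_def d1_def using Comp_in_hom[OF m(1)] pq by auto
  define c where "c k = e \<cdot> \<kappa> k" for k
  have c: "c k \<in> hom E (Dom E (fst k)) R" if "k \<in> K" for k
    unfolding c_def using Comp_in_hom[OF \<kappa>[OF that] e(1)] .
  have mc: "m \<cdot> c k = pair k" if "k \<in> K" for k
    unfolding c_def using Comp_assoc[OF \<kappa>[OF that] e(1) m(1)] me t\<kappa>[OF that] by simp
  have dc: "d0 \<cdot> c k = fst k" "d1 \<cdot> c k = snd k" if "k \<in> K" for k
    unfolding d0_def d1_def using Comp_assoc[OF c[OF that] m(1) pq(1)] Comp_assoc[OF c[OF that] m(1) pq(2)]
      mc[OF that] p_pair[OF that] q_pair[OF that] by simp_all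
  (* Every point of R is locally the restriction c k \<cdot> u of one of the generating pairs k. *)
  have c_epic: "jointly_epic E R (c ` K)"
  proof (rule jointly_epic_trans[OF epic_jointly_epic[OF e(2,1)]])
    show "jointly_epic E (Dom E f) (\<kappa> ` K)" if "f \<in> {e}" for f
      using coproduct_injections_jointly_epic[OF T] that homD[OF e(1)] by simp
    show "f \<cdot> l \<in> c ` K" if "f \<in> {e}" "l \<in> \<kappa> ` K" for f l
      using that by (auto simp: c_def)
    show "f \<in> hom E (Dom E f) R" if "f \<in> c ` K" for f
      using that c by (auto intro!: Arr_hom dest: homD simp: hom_def)
  qed
  have ker: "(\<exists>z\<in>hom E A R. d0 \<cdot> z = s \<and> d1 \<cdot> z = s') \<longleftrightarrow> \<phi> s = \<phi> s'"
    if A: "A \<in> G" and s: "s \<in> hom E A S" and s': "s' \<in> hom E A S" for A s s'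
  proof
    assume eq: "\<phi> s = \<phi> s'"
    have k: "(s, s') \<in> K"
      unfolding K_def using eq pointsI[OF s A] pointsI[OF s' A] homD[OF s] homD[OF s'] by simp
    show "\<exists>z\<in>hom E A R. d0 \<cdot> z = s \<and> d1 \<cdot> z = s'"
      using c[OF k] dc[OF k] homD[OF s] by auto
  next
    assume "\<exists>z\<in>hom E A R. d0 \<cdot> z = s \<and> d1 \<cdot> z = s'"
    then obtain z where z: "z \<in> hom E A R" "d0 \<cdot> z = s" "d1 \<cdot> z = s'"
      by blast
    have sP: "s \<in> points S" "s' \<in> points S" and Dom_s: "Dom E s = A" "Dom E s' = A"
      using pointsI[OF s A] pointsI[OF s' A] homD[OF s] homD[OF s'] by auto
    show "\<phi> s = \<phi> s'"
    proof (rule sheaf_separated[OF A _ _ lifting_points_jointly_epic[OF small_image[OF smallK] c_epic z(1)]])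
      show "\<phi> s \<in> FObj F A" "\<phi> s' \<in> FObj F A"
        using \<phi>[OF sP(1)] \<phi>[OF sP(2)] Dom_s by simp_all
      show "lifting_points z (c ` K) \<subseteq> points A"
        using homD[OF z(1)] unfolding lifting_points_def by auto
      fix w assume "w \<in> lifting_points z (c ` K)"
      then obtain k u where w: "w \<in> points A" and k: "k \<in> K" and u: "u \<in> hom E (Dom E w) (Dom E (fst k))"
        and zw: "z \<cdot> w = c k \<cdot> u"
        using homD[OF z(1)] homD[OF c] unfolding lifting_points_def by auto
      note w' = points_hom[OF w]
      have uP: "u \<in> points (Dom E (fst k))"
        by (rule pointsI[OF u points_G[OF w]])
      have Dom_k: "Dom E (snd k) = Dom E (fst k)"
        using homD[OF K(2)[OF k]] by simp
      have "s \<cdot> w = d0 \<cdot> (z \<cdot> w)"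
        using Comp_assoc[OF w' z(1) d(1)] z(2) by simp
      also have "\<dots> = fst k \<cdot> u"
        using Comp_assoc[OF u c[OF k] d(1)] dc(1)[OF k] zw by simp
      finally have 0: "s \<cdot> w = fst k \<cdot> u" .
      have "s' \<cdot> w = d1 \<cdot> (z \<cdot> w)"
        using Comp_assoc[OF w' z(1) d(2)] z(3) by simp
      also have "\<dots> = snd k \<cdot> u"
        using Comp_assoc[OF u c[OF k] d(2)] dc(2)[OF k] zw by simp
      finally have 1: "s' \<cdot> w = snd k \<cdot> u" .
      have "restr w (\<phi> s) = \<phi> (fst k \<cdot> u)"
        using \<phi>_Comp[OF sP(1), of w] w Dom_s 0 by simp
      also have "\<dots> = restr u (\<phi> (fst k))"
        using \<phi>_Comp[OF K(3)[OF k] uP] .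
      also have "\<dots> = restr u (\<phi> (snd k))"
        using K(5)[OF k] by simp
      also have "\<dots> = \<phi> (snd k \<cdot> u)"
        using \<phi>_Comp[OF K(4)[OF k], of u] uP Dom_k by simp
      also have "\<dots> = restr w (\<phi> s')"
        using \<phi>_Comp[OF sP(2), of w] w Dom_s 1 by simp
      finally show "restr w (\<phi> s) = restr w (\<phi> s')" .
    qed
  qed
  have "is_equivalence_relation E S d0 d1"
    by (rule equivalence_relation_of_points[OF d P m(1) d0_def[symmetric] d1_def[symmetric] m(2) ker])
  then obtain X \<pi> where \<pi>: "\<pi> \<in> hom E S X" "epic E \<pi>"
    and \<pi>_eq: "\<And>W u v. u \<in> hom E W S \<Longrightarrow> v \<in> hom E W S \<Longrightarrow>
      \<pi> \<cdot> u = \<pi> \<cdot> v \<longleftrightarrow> (\<exists>z\<in>hom E W R. d0 \<cdot> z = u \<and> d1 \<cdot> z = v)"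
    by (rule effective_quotient[OF _ d]) blast
  have \<pi>_\<phi>: "\<pi> \<cdot> u = \<pi> \<cdot> v \<longleftrightarrow> \<phi> u = \<phi> v" if "u \<in> hom E A S" "v \<in> hom E A S" "A \<in> G" for u v A
    using \<pi>_eq[OF that(1,2)] ker[OF that(3,1,2)] by simp
  have XO: "X \<in> Obj E"
    using hom_Obj[OF \<pi>(1)] by blast
  have \<pi>_epi: "small U {\<pi>}" "jointly_epic E X {\<pi>}"
    by (simp_all add: small_finite[OF universe] epic_jointly_epic[OF \<pi>(2,1)])
  (* Points of X lift locally to S, and by \<pi>_\<phi> the value of \<phi> at the lift is well defined. *)
  define \<Psi> where "\<Psi> x a \<longleftrightarrow> (\<exists>s\<in>points S. x = \<pi> \<cdot> s \<and> a = \<phi> s)" for x a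
  obtain \<psi> where \<psi>: "\<And>x. x \<in> points X \<Longrightarrow> \<psi> x \<in> FObj F (Dom E x)"
    and \<psi>_Comp: "\<And>x w. x \<in> points X \<Longrightarrow> w \<in> points (Dom E x) \<Longrightarrow> \<psi> (x \<cdot> w) = restr w (\<psi> x)"
    and \<psi>_\<Psi>: "\<And>x a. x \<in> points X \<Longrightarrow> \<Psi> x a \<Longrightarrow> \<psi> x = a"
  proof (rule extend_to_points[where S = X and \<Theta> = \<Psi>])
    fix x a assume "\<Psi> x a"
    then obtain s where s: "s \<in> points S" and xs: "x = \<pi> \<cdot> s" "a = \<phi> s"
      unfolding \<Psi>_def by blast
    have Dom_x: "Dom E x = Dom E s"
      using Dom_Comp_points[OF s \<pi>(1)] xs by simp
    show "a \<in> FObj F (Dom E x)"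
      using \<phi>[OF s] xs Dom_x by simp
    show "\<Psi> (x \<cdot> w) (restr w a)" if w: "w \<in> points (Dom E x)" for w
    proof -
      have w: "w \<in> points (Dom E s)"
        using w Dom_x by simp
      have "x \<cdot> w = \<pi> \<cdot> (s \<cdot> w)" "restr w a = \<phi> (s \<cdot> w)"
        using Comp_assoc[OF points_hom[OF w] points_hom[OF s] \<pi>(1)] \<phi>_Comp[OF s w] xs by simp_all
      then show ?thesis
        unfolding \<Psi>_def using Comp_points[OF w points_hom[OF s]] by blast
    qed
    fix b assume "\<Psi> x b"
    then obtain s' where s': "s' \<in> points S" and xs': "x = \<pi> \<cdot> s'" "b = \<phi> s'"
      unfolding \<Psi>_def by blast
    have "Dom E s' = Dom E s"
      using Dom_Comp_points[OF s' \<pi>(1)] xs' Dom_x by simp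
    then have "s' \<in> hom E (Dom E s) S"
      using points_hom[OF s'] by simp
    then have "\<pi> \<cdot> s = \<pi> \<cdot> s' \<longleftrightarrow> \<phi> s = \<phi> s'"
      using \<pi>_\<phi>[OF points_hom[OF s] _ points_G[OF s]] by blast
    then show "a = b"
      using xs xs' by simp
  next
    fix x assume x: "x \<in> points X"
    note x' = points_hom[OF x]
    show "jointly_epic E (Dom E x) {w \<in> points (Dom E x). \<exists>a. \<Psi> (x \<cdot> w) a}"
    proof (rule jointly_epic_mono[OF lifting_points_jointly_epic[OF \<pi>_epi x']])
      show "lifting_points x {\<pi>} \<subseteq> {w \<in> points (Dom E x). \<exists>a. \<Psi> (x \<cdot> w) a}"
      proof
        fix w assume "w \<in> lifting_points x {\<pi>}"
        then obtain s where w: "w \<in> points (Dom E x)" and s: "s \<in> hom E (Dom E w) S" "x \<cdot> w = \<pi> \<cdot> s"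
          by (rule lifting_points_singletonE[OF _ x' \<pi>(1)])
        then show "w \<in> {w \<in> points (Dom E x). \<exists>a. \<Psi> (x \<cdot> w) a}"
          unfolding \<Psi>_def using pointsI[OF s(1) points_G[OF w]] by blast
      qed
    qed (use points_hom in blast)
  qed blast
  have \<psi>_\<pi>: "\<psi> (\<pi> \<cdot> s) = \<phi> s" if "s \<in> points S" for s
    using \<psi>_\<Psi>[OF Comp_points[OF that \<pi>(1)]] that unfolding \<Psi>_def by blast
  have "bij_betw \<psi> (hom E A X) (FObj F A)" if A: "A \<in> G" for A
    unfolding bij_betw_def
  proof (intro conjI inj_onI subset_antisym subsetI)
    fix x y assume x: "x \<in> hom E A X" and y: "y \<in> hom E A X" and eq: "\<psi> x = \<psi> y"
    have xP: "x \<in> points X" "y \<in> points X" and Dom_x: "Dom E x = A" "Dom E y = A"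
      using pointsI[OF x A] pointsI[OF y A] homD[OF x] homD[OF y] by simp_all
    show "x = y"
    proof (rule jointly_epicD[OF lifting_points_jointly_epic[OF \<pi>_epi x] x y])
      fix w assume "w \<in> lifting_points x {\<pi>}"
      then obtain a where w: "w \<in> points A" and a: "a \<in> hom E (Dom E w) S" "x \<cdot> w = \<pi> \<cdot> a"
        by (rule lifting_points_singletonE[OF _ x \<pi>(1)])
      note w' = points_hom[OF w]
      note xw = Comp_in_hom[OF w' x] and yw = Comp_in_hom[OF w' y]
      have xwP: "x \<cdot> w \<in> points X" "y \<cdot> w \<in> points X"
        using pointsI[OF xw points_G[OF w]] pointsI[OF yw points_G[OF w]] by simp_all
      have eq': "\<psi> (x \<cdot> w) = \<psi> (y \<cdot> w)"
        using \<psi>_Comp[OF xP(1), of w] \<psi>_Comp[OF xP(2), of w] w Dom_x eq by simp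
      show "x \<cdot> w = y \<cdot> w"
      proof (rule jointly_epicD[OF lifting_points_jointly_epic[OF \<pi>_epi yw] xw yw])
        fix v assume "v \<in> lifting_points (y \<cdot> w) {\<pi>}"
        then obtain b where v: "v \<in> points (Dom E w)" and b: "b \<in> hom E (Dom E v) S" "(y \<cdot> w) \<cdot> v = \<pi> \<cdot> b"
          by (rule lifting_points_singletonE[OF _ yw \<pi>(1)])
        note v' = points_hom[OF v]
        note av = Comp_in_hom[OF v' a(1)]
        have xwv: "(x \<cdot> w) \<cdot> v = \<pi> \<cdot> (a \<cdot> v)"
          using Comp_assoc[OF v' a(1) \<pi>(1)] a(2) by simp
        have "\<phi> (a \<cdot> v) = \<psi> ((x \<cdot> w) \<cdot> v)"
          using \<psi>_\<pi>[OF pointsI[OF av points_G[OF v]]] xwv by simp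
        also have "\<dots> = \<psi> ((y \<cdot> w) \<cdot> v)"
          using \<psi>_Comp[OF xwP(1), of v] \<psi>_Comp[OF xwP(2), of v] v homD[OF xw] homD[OF yw] eq' by simp
        also have "\<dots> = \<phi> b"
          using \<psi>_\<pi>[OF pointsI[OF b(1) points_G[OF v]]] b(2) by simp
        finally show "(x \<cdot> w) \<cdot> v = (y \<cdot> w) \<cdot> v"
          using \<pi>_\<phi>[OF av b(1) points_G[OF v]] xwv b(2) by simp
      qed
    qed
  next
    fix a assume "a \<in> \<psi> ` hom E A X"
    then obtain x where x: "x \<in> hom E A X" "a = \<psi> x"
      by blast
    then show "a \<in> FObj F A"
      using \<psi>[OF pointsI[OF x(1) A]] homD[OF x(1)] by simp
  next
    fix a assume a: "a \<in> FObj F A"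
    have i: "(A, a) \<in> I"
      using A a by (simp add: I_def)
    define s where "s = \<iota> (A, a)"
    have s: "s \<in> hom E A S"
      using \<iota>[OF i] by (simp add: s_def)
    note sP = pointsI[OF s A]
    have "s = \<iota> (A, a) \<cdot> Id E A"
      using Comp_Id_right[OF s] by (simp add: s_def)
    then have "\<Theta> s a"
      unfolding \<Theta>_def using sP i Id_in_hom[OF G_Obj[OF A]] restr_Id[OF A a] homD[OF s]
      by (intro conjI bexI[of _ "(A, a)"] bexI[of _ "Id E A"]) simp_all
    then have "\<psi> (\<pi> \<cdot> s) = a"
      using \<phi>_\<Theta>[OF sP] \<psi>_\<pi>[OF sP] by simp
    then show "a \<in> \<psi> ` hom E A X"
      using Comp_in_hom[OF s \<pi>(1)] by blast
  qed
  with XO show ?thesis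
    using \<psi>_Comp by (rule that)
qed

end

end

section \<open>The category of sheaves\<close>

text \<open>
  Morphisms of sheaves are handled through families of functions \<open>t A : F(A) \<rightarrow> F'(A)\<close>, given as
  total functions.  Cutting these down to \<open>F(A)\<close> makes equality of morphisms mean equality at all
  sections.
\<close>

definition natural_family ::
    "('o, 'a) category \<Rightarrow> ('o, 'a, 'u) presheaf \<Rightarrow> ('o, 'a, 'u) presheaf \<Rightarrow> ('o \<Rightarrow> 'u \<Rightarrow> 'u) \<Rightarrow> bool" where
  "natural_family C F F' t \<longleftrightarrow>
     (\<forall>A\<in>Obj C. \<forall>a\<in>FObj F A. t A a \<in> FObj F' A) \<and>
     (\<forall>f\<in>Arr C. \<forall>a\<in>FObj F (Cod C f). t (Dom C f) (fn (FArr F f) a) = fn (FArr F' f) (t (Cod C f) a))"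

definition sheaf_map ::
    "('o, 'a) category \<Rightarrow> ('o, 'a, 'u) presheaf \<Rightarrow> ('o, 'a, 'u) presheaf \<Rightarrow> ('o \<Rightarrow> 'u \<Rightarrow> 'u) \<Rightarrow>
     ('o, 'a, 'u) presheaf \<times> ('o, 'a, 'u) presheaf \<times> ('o \<Rightarrow> 'u set \<times> 'u set \<times> ('u \<Rightarrow> 'u))" where
  "sheaf_map C F F' t = (F, F', \<lambda>A\<in>Obj C. (FObj F A, FObj F' A, restrict (t A) (FObj F A)))"

lemma sheaves_functor: "F \<in> sheaves U C J \<Longrightarrow> is_functor (op_cat C) (set_cat (small_sets U)) F"
  unfolding sheaves_def by blast

lemma sheaves_small:
  assumes "F \<in> sheaves U C J" "A \<in> Obj C"
  shows "FObj F A \<in> small_sets U"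
  using sheaves_functor[OF assms(1)] assms(2) unfolding is_functor_def by simp

lemma sheaf_map_eq_iff:
  "sheaf_map C F F' t = sheaf_map C F F' t' \<longleftrightarrow> (\<forall>A\<in>Obj C. \<forall>a\<in>FObj F A. t A a = t' A a)"
proof -
  have "sheaf_map C F F' t = sheaf_map C F F' t' \<longleftrightarrow>
      (\<forall>A\<in>Obj C. restrict (t A) (FObj F A) = restrict (t' A) (FObj F A))"
    unfolding sheaf_map_def by (auto simp: fun_eq_iff restrict_def)
  then show ?thesis
    by (auto simp: fun_eq_iff restrict_def)
qed

lemma sheaf_map_Comp:
  assumes "natural_family C F F' t"
  shows "sheaf_map C F' F'' s \<cdot>\<^bsub>Sh U C J\<^esub> sheaf_map C F F' t = sheaf_map C F F'' (\<lambda>A a. s A (t A a))"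
  using assms unfolding sheaf_map_def Sh_def natural_family_def
  by (auto simp: fun_eq_iff restrict_def)

lemma sheaf_map_Id: "Id (Sh U C J) F = sheaf_map C F F (\<lambda>A a. a)"
  unfolding sheaf_map_def Sh_def by simp

lemma Obj_Sh [simp]: "Obj (Sh U C J) = sheaves U C J"
  unfolding Sh_def by simp

lemma restriction_triple:
  assumes "F \<in> sheaves U C J" "f \<in> Arr C"
  obtains h where "FArr F f = (FObj F (Cod C f), FObj F (Dom C f), h)" "h \<in> FObj F (Cod C f) \<rightarrow>\<^sub>E FObj F (Dom C f)"
proof -
  obtain A B h where "FArr F f = (A, B, h)"
    by (cases "FArr F f") auto
  then show ?thesis
    using that presheaf_restriction_hom[OF sheaves_functor[OF assms(1)] assms(2)] by (simp add: set_cat_hom)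
qed

context category
begin

lemma sheaf_map_hom:
  assumes F: "F \<in> sheaves U C J" "F' \<in> sheaves U C J" and t: "natural_family C F F' t"
  shows "sheaf_map C F F' t \<in> hom (Sh U C J) F F'"
proof -
  let ?\<tau> = "\<lambda>A\<in>Obj C. (FObj F A, FObj F' A, restrict (t A) (FObj F A))"
  have "nat_trans (op_cat C) (set_cat (small_sets U)) F F' ?\<tau>"
    unfolding nat_trans_def
  proof (intro conjI ballI)
    fix A assume "A \<in> Obj (op_cat C)"
    then have A: "A \<in> Obj C"
      by simp
    then show "?\<tau> A \<in> hom (set_cat (small_sets U)) (FObj F A) (FObj F' A)"
      using sheaves_small[OF F(1) A] sheaves_small[OF F(2) A] t
      unfolding natural_family_def by (auto simp: set_cat_hom)
  next
    fix f assume "f \<in> Arr (op_cat C)"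
    then have f: "f \<in> Arr C"
      by simp
    obtain h where h: "FArr F f = (FObj F (Cod C f), FObj F (Dom C f), h)" "h \<in> FObj F (Cod C f) \<rightarrow>\<^sub>E FObj F (Dom C f)"
      by (rule restriction_triple[OF F(1) f])
    obtain h' where h': "FArr F' f = (FObj F' (Cod C f), FObj F' (Dom C f), h')"
      by (rule restriction_triple[OF F(2) f])
    have "t (Dom C f) (h a) = h' (t (Cod C f) a)" if "a \<in> FObj F (Cod C f)" for a
      using t f that h(1) h' unfolding natural_family_def by force
    then show "?\<tau> (Cod (op_cat C) f) \<cdot>\<^bsub>set_cat (small_sets U)\<^esub> FArr F f =
        FArr F' f \<cdot>\<^bsub>set_cat (small_sets U)\<^esub> ?\<tau> (Dom (op_cat C) f)"
      using h h' Dom_in_Obj[OF f] Cod_in_Obj[OF f] PiE_mem[OF h(2)] by (auto intro!: restrict_ext)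
  qed
  then show ?thesis
    using F unfolding sheaf_map_def hom_def Sh_def by simp
qed

lemma sheaf_mapE:
  assumes "m \<in> hom (Sh U C J) F F'"
  obtains t where "F \<in> sheaves U C J" "F' \<in> sheaves U C J" "natural_family C F F' t" "m = sheaf_map C F F' t"
proof -
  obtain \<tau> where m: "m = (F, F', \<tau>)" and F: "F \<in> sheaves U C J" "F' \<in> sheaves U C J"
    and \<tau>: "nat_trans (op_cat C) (set_cat (small_sets U)) F F' \<tau>" "\<tau> \<in> extensional (Obj C)"
    using assms unfolding hom_def Sh_def by auto
  define t where "t A = fn (\<tau> A)" for A
  have \<tau>A: "\<tau> A = (FObj F A, FObj F' A, t A)" "t A \<in> FObj F A \<rightarrow>\<^sub>E FObj F' A" if "A \<in> Obj C" for A
  proof -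
    have "\<tau> A \<in> hom (set_cat (small_sets U)) (FObj F A) (FObj F' A)"
      using \<tau>(1) that unfolding nat_trans_def by simp
    then show "\<tau> A = (FObj F A, FObj F' A, t A)" "t A \<in> FObj F A \<rightarrow>\<^sub>E FObj F' A"
      unfolding set_cat_hom t_def by (auto simp: prod_eq_iff)
  qed
  have "natural_family C F F' t"
    unfolding natural_family_def
  proof (intro conjI ballI)
    show "t A a \<in> FObj F' A" if "A \<in> Obj C" "a \<in> FObj F A" for A a
      using PiE_mem[OF \<tau>A(2)] that by blast
    fix f a assume f: "f \<in> Arr C" and a: "a \<in> FObj F (Cod C f)"
    obtain h where h: "FArr F f = (FObj F (Cod C f), FObj F (Dom C f), h)"
      by (rule restriction_triple[OF F(1) f])
    obtain h' where h': "FArr F' f = (FObj F' (Cod C f), FObj F' (Dom C f), h')"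
      by (rule restriction_triple[OF F(2) f])
    have "\<tau> (Dom C f) \<cdot>\<^bsub>set_cat (small_sets U)\<^esub> FArr F f = FArr F' f \<cdot>\<^bsub>set_cat (small_sets U)\<^esub> \<tau> (Cod C f)"
      using \<tau>(1) f unfolding nat_trans_def by simp
    then have "(\<lambda>x\<in>FObj F (Cod C f). t (Dom C f) (h x)) = (\<lambda>x\<in>FObj F (Cod C f). h' (t (Cod C f) x))"
      using \<tau>A(1) h h' Dom_in_Obj[OF f] Cod_in_Obj[OF f] by simp
    then have "(\<lambda>x\<in>FObj F (Cod C f). t (Dom C f) (h x)) a = (\<lambda>x\<in>FObj F (Cod C f). h' (t (Cod C f) x)) a"
      by simp
    then show "t (Dom C f) (fn (FArr F f) a) = fn (FArr F' f) (t (Cod C f) a)"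
      using a h h' by simp
  qed
  moreover have "\<tau> = (\<lambda>A\<in>Obj C. (FObj F A, FObj F' A, restrict (t A) (FObj F A)))"
  proof (rule extensionalityI[OF \<tau>(2)])
    fix A assume A: "A \<in> Obj C"
    have "restrict (t A) (FObj F A) = t A"
      using \<tau>A(2)[OF A] PiE_restrict by metis
    then show "\<tau> A = (\<lambda>A\<in>Obj C. (FObj F A, FObj F' A, restrict (t A) (FObj F A))) A"
      using \<tau>A(1)[OF A] A by simp
  qed simp
  ultimately show ?thesis
    using that F m unfolding sheaf_map_def by blast
qed

lemma natural_family_Comp:
  "natural_family C F F' t \<Longrightarrow> natural_family C F' F'' s \<Longrightarrow> natural_family C F F'' (\<lambda>A a. s A (t A a))"
  using Cod_in_Obj unfolding natural_family_def by simp

lemma Sh_category: "category (Sh U C J)"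
proof
  fix f assume "f \<in> Arr (Sh U C J)"
  then show "Dom (Sh U C J) f \<in> Obj (Sh U C J)" "Cod (Sh U C J) f \<in> Obj (Sh U C J)"
    unfolding Sh_def by auto
next
  fix F assume "F \<in> Obj (Sh U C J)"
  then show "Id (Sh U C J) F \<in> hom (Sh U C J) F F"
    unfolding sheaf_map_Id by (intro sheaf_map_hom) (auto simp: natural_family_def)
next
  fix f g F G H assume f: "f \<in> hom (Sh U C J) F G" and g: "g \<in> hom (Sh U C J) G H"
  obtain t where t: "F \<in> sheaves U C J" "natural_family C F G t" "f = sheaf_map C F G t"
    by (rule sheaf_mapE[OF f])
  obtain s where s: "H \<in> sheaves U C J" "natural_family C G H s" "g = sheaf_map C G H s"
    by (rule sheaf_mapE[OF g])
  show "g \<cdot>\<^bsub>Sh U C J\<^esub> f \<in> hom (Sh U C J) F H"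
    using sheaf_map_hom[OF t(1) s(1) natural_family_Comp[OF t(2) s(2)]] sheaf_map_Comp[OF t(2)] t(3) s(3) by simp
next
  fix f g h F G H K
  assume f: "f \<in> hom (Sh U C J) F G" and g: "g \<in> hom (Sh U C J) G H" and h: "h \<in> hom (Sh U C J) H K"
  obtain t where t: "natural_family C F G t" "f = sheaf_map C F G t"
    by (rule sheaf_mapE[OF f])
  obtain s where s: "natural_family C G H s" "g = sheaf_map C G H s"
    by (rule sheaf_mapE[OF g])
  obtain r where r: "h = sheaf_map C H K r"
    by (rule sheaf_mapE[OF h])
  show "(h \<cdot>\<^bsub>Sh U C J\<^esub> g) \<cdot>\<^bsub>Sh U C J\<^esub> f = h \<cdot>\<^bsub>Sh U C J\<^esub> (g \<cdot>\<^bsub>Sh U C J\<^esub> f)"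
    using sheaf_map_Comp[OF t(1)] sheaf_map_Comp[OF s(1)] sheaf_map_Comp[OF natural_family_Comp[OF t(1) s(1)]]
      t(2) s(2) r by simp
next
  fix f F G assume f: "f \<in> hom (Sh U C J) F G"
  obtain t where t: "natural_family C F G t" "f = sheaf_map C F G t"
    by (rule sheaf_mapE[OF f])
  have id: "natural_family C F F (\<lambda>A a. a)"
    by (simp add: natural_family_def)
  show "Id (Sh U C J) G \<cdot>\<^bsub>Sh U C J\<^esub> f = f"
    by (simp only: sheaf_map_Id t(2) sheaf_map_Comp[OF t(1)])
  show "f \<cdot>\<^bsub>Sh U C J\<^esub> Id (Sh U C J) F = f"
    by (simp only: sheaf_map_Id t(2) sheaf_map_Comp[OF id])
qed

text \<open>
  The pointwise inverses of a natural family of bijections are again natural.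
\<close>

lemma sheaf_map_iso:
  assumes F: "F \<in> sheaves U C J" "F' \<in> sheaves U C J" and t: "natural_family C F F' t"
    and bij: "\<And>A. A \<in> Obj C \<Longrightarrow> bij_betw (t A) (FObj F A) (FObj F' A)"
  shows "iso (Sh U C J) (sheaf_map C F F' t)"
proof -
  interpret Sh: category "Sh U C J"
    by (rule Sh_category)
  define s where "s A = inv_into (FObj F A) (t A)" for A
  have st: "s A (t A a) = a" if "A \<in> Obj C" "a \<in> FObj F A" for A a
    unfolding s_def by (rule bij_betw_inv_into_left[OF bij[OF that(1)] that(2)])
  have ts: "t A (s A b) = b" "s A b \<in> FObj F A" if "A \<in> Obj C" "b \<in> FObj F' A" for A b
    using bij_betw_inv_into_right[OF bij[OF that(1)] that(2)] bij_betw_inv_into[OF bij[OF that(1)]] that(2)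
    by (auto simp: s_def bij_betw_def)
  have s: "natural_family C F' F s"
    unfolding natural_family_def
  proof (intro conjI ballI)
    show "s A b \<in> FObj F A" if "A \<in> Obj C" "b \<in> FObj F' A" for A b
      using ts(2) that .
    fix f b assume f: "f \<in> Arr C" and b: "b \<in> FObj F' (Cod C f)"
    note D = Dom_in_Obj[OF f] and Co = Cod_in_Obj[OF f]
    define a where "a = s (Cod C f) b"
    have a: "a \<in> FObj F (Cod C f)" "t (Cod C f) a = b"
      using ts[OF Co b] by (auto simp: a_def)
    have fa: "fn (FArr F f) a \<in> FObj F (Dom C f)"
      by (rule presheaf_restriction_in[OF sheaves_functor[OF F(1)] f a(1)])
    have "fn (FArr F' f) b = t (Dom C f) (fn (FArr F f) a)"
      using t f a unfolding natural_family_def by auto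
    then show "s (Dom C f) (fn (FArr F' f) b) = fn (FArr F f) (s (Cod C f) b)"
      using st[OF D fa] by (simp add: a_def)
  qed
  show ?thesis
  proof (rule Sh.isoI[OF sheaf_map_hom[OF F t] sheaf_map_hom[OF F(2,1) s]])
    show "sheaf_map C F' F s \<cdot>\<^bsub>Sh U C J\<^esub> sheaf_map C F F' t = Id (Sh U C J) F"
      unfolding sheaf_map_Comp[OF t] sheaf_map_Id sheaf_map_eq_iff using st by blast
    show "sheaf_map C F F' t \<cdot>\<^bsub>Sh U C J\<^esub> sheaf_map C F' F s = Id (Sh U C J) F'"
      unfolding sheaf_map_Comp[OF s] sheaf_map_Id sheaf_map_eq_iff using ts by blast
  qed
qed

end

subsection \<open>Transporting a sheaf into the universe\<close>

text \<open>
  The objects of the category of sheaves take their values in subsets of \<open>U\<close>, so a representable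
  presheaf, whose sections are arrows, has to be copied along injections \<open>e A\<close> of its values into \<open>U\<close>.
\<close>

definition relabel ::
    "('o, 'a) category \<Rightarrow> ('o \<Rightarrow> 'x \<Rightarrow> 'u) \<Rightarrow> ('o, 'a, 'x) presheaf \<Rightarrow> ('o, 'a, 'u) presheaf" where
  "relabel C e F =
     \<lparr>FObj = (\<lambda>A\<in>Obj C. e A ` FObj F A),
      FArr = (\<lambda>f\<in>Arr C. (e (Cod C f) ` FObj F (Cod C f), e (Dom C f) ` FObj F (Dom C f),
        \<lambda>y\<in>e (Cod C f) ` FObj F (Cod C f).
          e (Dom C f) (fn (FArr F f) (inv_into (FObj F (Cod C f)) (e (Cod C f)) y))))\<rparr>"

lemma FObj_relabel [simp]: "A \<in> Obj C \<Longrightarrow> FObj (relabel C e F) A = e A ` FObj F A"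
  unfolding relabel_def by simp

lemma relabel_restriction:
  assumes "f \<in> Arr C" "inj_on (e (Cod C f)) (FObj F (Cod C f))" "a \<in> FObj F (Cod C f)"
  shows "fn (FArr (relabel C e F) f) (e (Cod C f) a) = e (Dom C f) (fn (FArr F f) a)"
  using assms unfolding relabel_def by simp

context category
begin

lemma relabel_functor:
  assumes F: "is_functor (op_cat C) (set_cat UNIV) F"
    and e: "\<And>A. A \<in> Obj C \<Longrightarrow> inj_on (e A) (FObj F A)" and \<V>: "\<And>A. A \<in> Obj C \<Longrightarrow> e A ` FObj F A \<in> \<V>"
  shows "is_functor (op_cat C) (set_cat \<V>) (relabel C e F)"
  unfolding is_functor_def
proof (intro conjI ballI impI)
  fix A assume "A \<in> Obj (op_cat C)"
  then have A: "A \<in> Obj C"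
    by simp
  then show "FObj (relabel C e F) A \<in> Obj (set_cat \<V>)"
    using \<V> by simp
  have "(\<lambda>y\<in>e A ` FObj F A. e A (fn (FArr F (Id C A)) (inv_into (FObj F A) (e A) y))) = (\<lambda>y\<in>e A ` FObj F A. y)"
    using presheaf_restriction_Id[OF F A] e[OF A] by (intro restrict_ext) auto
  then show "FArr (relabel C e F) (Id (op_cat C) A) = Id (set_cat \<V>) (FObj (relabel C e F) A)"
    using A by (simp add: relabel_def)
next
  fix f assume "f \<in> Arr (op_cat C)"
  then have f: "f \<in> Arr C"
    by simp
  have "e (Dom C f) (fn (FArr F f) (inv_into (FObj F (Cod C f)) (e (Cod C f)) y)) \<in> e (Dom C f) ` FObj F (Dom C f)"
    if "y \<in> e (Cod C f) ` FObj F (Cod C f)" for y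
    using presheaf_restriction_in[OF F f] inv_into_into[OF that] by blast
  then show "FArr (relabel C e F) f \<in> hom (set_cat \<V>)
      (FObj (relabel C e F) (Dom (op_cat C) f)) (FObj (relabel C e F) (Cod (op_cat C) f))"
    using f Dom_in_Obj[OF f] Cod_in_Obj[OF f] \<V> by (auto simp: set_cat_hom relabel_def)
next
  fix f g assume "f \<in> Arr (op_cat C)" "g \<in> Arr (op_cat C)" "Cod (op_cat C) f = Dom (op_cat C) g"
  then have fg: "f \<in> Arr C" "g \<in> Arr C" "Cod C g = Dom C f"
    by auto
  have "e (Dom C g) (fn (FArr F (f \<cdot> g)) (inv_into (FObj F (Cod C f)) (e (Cod C f)) y)) =
      (\<lambda>y\<in>e (Cod C g) ` FObj F (Cod C g). e (Dom C g) (fn (FArr F g) (inv_into (FObj F (Cod C g)) (e (Cod C g)) y)))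
        (e (Dom C f) (fn (FArr F f) (inv_into (FObj F (Cod C f)) (e (Cod C f)) y)))"
    if y: "y \<in> e (Cod C f) ` FObj F (Cod C f)" for y
  proof -
    obtain a where a: "a \<in> FObj F (Cod C f)" "y = e (Cod C f) a"
      using y by blast
    have "fn (FArr F f) a \<in> FObj F (Cod C g)"
      using presheaf_restriction_in[OF F fg(1) a(1)] fg(3) by simp
    then show ?thesis
      using inv_into_f_f[OF e[OF Cod_in_Obj[OF fg(1)]] a(1)] inv_into_f_f[OF e[OF Cod_in_Obj[OF fg(2)]]]
        presheaf_restriction_Comp[OF F fg a(1)] a(2) fg(3) by simp
  qed
  then show "FArr (relabel C e F) (g \<cdot>\<^bsub>op_cat C\<^esub> f) = FArr (relabel C e F) g \<cdot>\<^bsub>set_cat \<V>\<^esub> FArr (relabel C e F) f"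
    using fg by (auto simp: relabel_def intro!: restrict_ext)
qed

lemma relabel_sheaf:
  assumes J: "grothendieck_topology C J" and F: "is_sheaf C J F"
    and e: "\<And>A. A \<in> Obj C \<Longrightarrow> inj_on (e A) (FObj F A)"
    and U: "\<And>A. A \<in> Obj C \<Longrightarrow> e A ` FObj F A \<subseteq> U" "\<And>A. A \<in> Obj C \<Longrightarrow> small U (FObj F A)"
  shows "relabel C e F \<in> sheaves U C J"
proof -
  have F_functor: "is_functor (op_cat C) (set_cat UNIV) F"
    using F unfolding is_sheaf_def by blast
  have small: "e A ` FObj F A \<in> small_sets U" if "A \<in> Obj C" for A
    unfolding small_sets_def using U(1)[OF that] small_image[OF U(2)[OF that]] by simp
  have 1: "is_functor (op_cat C) (set_cat (small_sets U)) (relabel C e F)"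
    by (rule relabel_functor[OF F_functor e small])
  have 2: "is_functor (op_cat C) (set_cat UNIV) (relabel C e F)"
    by (rule relabel_functor[OF F_functor e UNIV_I])
  have "\<exists>!b. b \<in> FObj (relabel C e F) X \<and> (\<forall>f\<in>S. fn (FArr (relabel C e F) f) b = y f)"
    if X: "X \<in> Obj C" and S: "S \<in> J X" and y: "matching_family C (relabel C e F) S y" for X S y
  proof -
    have "sieve C X S"
      using J X S unfolding grothendieck_topology_def by simp
    have f: "f \<in> Arr C" "Cod C f = X" "Dom C f \<in> Obj C" if "f \<in> S" for f
      using \<open>sieve C X S\<close> that Dom_in_Obj[of f] unfolding sieve_def by blast+
    have fg: "f \<cdot> g \<in> S" if "f \<in> S" "g \<in> Arr C" "Cod C g = Dom C f" for f g
      using \<open>sieve C X S\<close> that unfolding sieve_def by blast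
    have "\<exists>a\<in>FObj F (Dom C h). y h = e (Dom C h) a" if "h \<in> S" for h
    proof -
      have "y h \<in> FObj (relabel C e F) (Dom C h)"
        using y that unfolding matching_family_def by blast
      then show ?thesis
        using f(3)[OF that] by auto
    qed
    then obtain x where x: "\<And>h. h \<in> S \<Longrightarrow> x h \<in> FObj F (Dom C h)" "\<And>h. h \<in> S \<Longrightarrow> y h = e (Dom C h) (x h)"
      by metis
    have "matching_family C F S x"
      unfolding matching_family_def
    proof (intro conjI ballI impI x(1))
      fix h g assume h: "h \<in> S" and g: "g \<in> Arr C" "Cod C g = Dom C h"
      have Dom_hg: "Dom C (h \<cdot> g) = Dom C g"
        using f(1)[OF h] g by simp
      have xh: "x h \<in> FObj F (Cod C g)"
        using x(1)[OF h] g(2) by simp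
      have "e (Dom C g) (x (h \<cdot> g)) = y (h \<cdot> g)"
        using x(2)[OF fg[OF h g]] Dom_hg by simp
      also have "\<dots> = fn (FArr (relabel C e F) g) (y h)"
        using y h g unfolding matching_family_def by simp
      also have "\<dots> = e (Dom C g) (fn (FArr F g) (x h))"
        using relabel_restriction[where e = e, OF g(1) e[OF Cod_in_Obj[OF g(1)]] xh] x(2)[OF h] g(2) by simp
      finally have "e (Dom C g) (fn (FArr F g) (x h)) = e (Dom C g) (x (h \<cdot> g))" ..
      then show "fn (FArr F g) (x h) = x (h \<cdot> g)"
      proof (rule inj_onD[OF e[OF Dom_in_Obj[OF g(1)]]])
        show "fn (FArr F g) (x h) \<in> FObj F (Dom C g)"
          by (rule presheaf_restriction_in[OF F_functor g(1) xh])
        show "x (h \<cdot> g) \<in> FObj F (Dom C g)"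
          using x(1)[OF fg[OF h g]] Dom_hg by simp
      qed
    qed
    then have ex1: "\<exists>!a. a \<in> FObj F X \<and> (\<forall>f\<in>S. fn (FArr F f) a = x f)"
      using F X S unfolding is_sheaf_def by blast
    have rel: "fn (FArr (relabel C e F) h) (e X a) = y h \<longleftrightarrow> fn (FArr F h) a = x h"
      if "h \<in> S" "a \<in> FObj F X" for h a
    proof -
      have "fn (FArr (relabel C e F) h) (e X a) = e (Dom C h) (fn (FArr F h) a)"
        using relabel_restriction[OF f(1)[OF that(1)], of e F a] f(2)[OF that(1)] e[OF X] that(2) by simp
      moreover have "fn (FArr F h) a \<in> FObj F (Dom C h)"
        using presheaf_restriction_in[OF F_functor f(1)[OF that(1)], of a] f(2)[OF that(1)] that(2) by simp
      ultimately show ?thesis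
        using x[OF that(1)] inj_on_eq_iff[OF e[OF f(3)[OF that(1)]]] by simp
    qed
    obtain a where a: "a \<in> FObj F X" "\<forall>h\<in>S. fn (FArr F h) a = x h"
      using ex1 by blast
    show ?thesis
    proof (rule ex1I[of _ "e X a"])
      show "e X a \<in> FObj (relabel C e F) X \<and> (\<forall>h\<in>S. fn (FArr (relabel C e F) h) (e X a) = y h)"
        using a X rel by simp
      fix b assume b: "b \<in> FObj (relabel C e F) X \<and> (\<forall>h\<in>S. fn (FArr (relabel C e F) h) b = y h)"
      then obtain a' where a': "a' \<in> FObj F X" "b = e X a'"
        using X by auto
      then have "\<forall>h\<in>S. fn (FArr F h) a' = x h"
        using b rel by blast
      then show "b = e X a"
        using ex1 a a' by blast
    qed
  qed
  then have "is_sheaf C J (relabel C e F)"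
    using 2 unfolding is_sheaf_def by blast
  then show ?thesis
    using 1 unfolding sheaves_def by (simp add: relabel_def)
qed

end

section \<open>The equivalence\<close>

context giraud
begin

lemma full_subcat_category: "category (full_subcat E G)"
proof
  have hom: "f \<in> hom (full_subcat E G) A B \<longleftrightarrow> f \<in> hom E A B \<and> A \<in> G \<and> B \<in> G" for f A B
    by (auto simp: hom_def)
  show "f \<in> hom (full_subcat E G) A B \<Longrightarrow> g \<in> hom (full_subcat E G) B X \<Longrightarrow>
      g \<cdot>\<^bsub>full_subcat E G\<^esub> f \<in> hom (full_subcat E G) A X" for f g A B X
    using Comp_in_hom by (auto simp: hom)
  show "f \<in> hom (full_subcat E G) W X \<Longrightarrow> g \<in> hom (full_subcat E G) X Y \<Longrightarrow> h \<in> hom (full_subcat E G) Y Z \<Longrightarrow>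
      (h \<cdot>\<^bsub>full_subcat E G\<^esub> g) \<cdot>\<^bsub>full_subcat E G\<^esub> f = h \<cdot>\<^bsub>full_subcat E G\<^esub> (g \<cdot>\<^bsub>full_subcat E G\<^esub> f)" for f g h W X Y Z
    using Comp_assoc by (auto simp: hom)
  show "A \<in> Obj (full_subcat E G) \<Longrightarrow> Id (full_subcat E G) A \<in> hom (full_subcat E G) A A" for A
    using Id_in_hom G_Obj by (simp add: hom)
  show "f \<in> hom (full_subcat E G) X Y \<Longrightarrow> Id (full_subcat E G) Y \<cdot>\<^bsub>full_subcat E G\<^esub> f = f"
    "f \<in> hom (full_subcat E G) X Y \<Longrightarrow> f \<cdot>\<^bsub>full_subcat E G\<^esub> Id (full_subcat E G) X = f" for f X Y
    using Comp_Id_left Comp_Id_right by (auto simp: hom)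
qed auto

text \<open>
  By smallness of the hom-sets, \<open>hom(A, X)\<close> embeds into \<open>U\<close> for each \<open>A\<close> and \<open>X\<close> separately.  The
  embeddings need not be related in any way: naturality is a matter of the decoded arrows.
\<close>

definition code :: "'o \<Rightarrow> 'o \<Rightarrow> 'a \<Rightarrow> 'u" where
  "code X A = (SOME f. inj_on f (hom E A X) \<and> f ` hom E A X \<subseteq> U)"

definition decode :: "'o \<Rightarrow> 'o \<Rightarrow> 'u \<Rightarrow> 'a" where
  "decode X A = inv_into (hom E A X) (code X A)"

lemma code:
  assumes "X \<in> Obj E" "A \<in> G"
  shows "inj_on (code X A) (hom E A X)" "code X A ` hom E A X \<subseteq> U" "small U (hom E A X)"
proof -
  show s: "small U (hom E A X)"
    using small_homs assms G_Obj unfolding small_homs_def by blast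
  have "\<exists>f. inj_on f (hom E A X) \<and> f ` hom E A X \<subseteq> U"
    by (rule small_embedding[OF s]) blast
  then have "inj_on (code X A) (hom E A X) \<and> code X A ` hom E A X \<subseteq> U"
    unfolding code_def by (rule someI_ex)
  then show "inj_on (code X A) (hom E A X)" "code X A ` hom E A X \<subseteq> U"
    by auto
qed

lemma decode_code: "A \<in> G \<Longrightarrow> x \<in> hom E A X \<Longrightarrow> decode X A (code X A x) = x"
  unfolding decode_def using code(1) hom_Obj[of x A X] by simp

definition represented :: "'o \<Rightarrow> ('o, 'a, 'u) presheaf" where
  "represented X = relabel (full_subcat E G) (code X) (hom_presheaf E X)"

lemma FObj_represented [simp]: "A \<in> G \<Longrightarrow> FObj (represented X) A = code X A ` hom E A X"
  unfolding represented_def by simp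

lemma represented_restriction:
  assumes "f \<in> Arr (full_subcat E G)" "x \<in> hom E (Cod E f) X"
  shows "fn (FArr (represented X) f) (code X (Cod E f) x) = code X (Dom E f) (x \<cdot> f)"
proof -
  have "inj_on (code X (Cod E f)) (hom E (Cod E f) X)"
    using code(1) hom_Obj[OF assms(2)] assms(1) by simp
  then show ?thesis
    using relabel_restriction[OF assms(1), of "code X" "hom_presheaf E X" x] assms(2)
    unfolding represented_def by simp
qed

lemma represented_sheaf: "X \<in> Obj E \<Longrightarrow> represented X \<in> sheaves U (full_subcat E G) canonical"
  unfolding represented_def
  by (rule category.relabel_sheaf[OF full_subcat_category canonical_topology hom_presheaf_sheaf])
    (simp_all add: code)

definition postcomposition :: "'a \<Rightarrow> 'o \<Rightarrow> 'u \<Rightarrow> 'u" where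
  "postcomposition h A y = code (Cod E h) A (h \<cdot> decode (Dom E h) A y)"

lemma postcomposition_code:
  "A \<in> G \<Longrightarrow> h \<in> hom E X Y \<Longrightarrow> x \<in> hom E A X \<Longrightarrow> postcomposition h A (code X A x) = code Y A (h \<cdot> x)"
  unfolding postcomposition_def using decode_code homD[of h E X Y] by simp

lemma postcomposition_natural:
  assumes h: "h \<in> hom E X Y"
  shows "natural_family (full_subcat E G) (represented X) (represented Y) (postcomposition h)"
  unfolding natural_family_def
proof (intro conjI ballI)
  fix A y assume "A \<in> Obj (full_subcat E G)" "y \<in> FObj (represented X) A"
  then obtain x where x: "A \<in> G" "x \<in> hom E A X" "y = code X A x"
    by auto
  then show "postcomposition h A y \<in> FObj (represented Y) A"
    using postcomposition_code[OF x(1) h x(2)] Comp_in_hom[OF x(2) h] by simp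
next
  fix f y assume f: "f \<in> Arr (full_subcat E G)" and "y \<in> FObj (represented X) (Cod (full_subcat E G) f)"
  then obtain x where x: "x \<in> hom E (Cod E f) X" "y = code X (Cod E f) x"
    by auto
  have f': "f \<in> hom E (Dom E f) (Cod E f)" "Dom E f \<in> G" "Cod E f \<in> G"
    using f by (auto intro: Arr_hom)
  show "postcomposition h (Dom (full_subcat E G) f) (fn (FArr (represented X) f) y) =
      fn (FArr (represented Y) f) (postcomposition h (Cod (full_subcat E G) f) y)"
    using represented_restriction[OF f x(1)] represented_restriction[OF f Comp_in_hom[OF x(1) h]]
      postcomposition_code[OF f'(3) h x(1)] postcomposition_code[OF f'(2) h Comp_in_hom[OF f'(1) x(1)]]
      Comp_assoc[OF f'(1) x(1) h] x(2) by simp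
qed

definition yoneda where
  "yoneda = \<lparr>FObj = represented,
     FArr = (\<lambda>h. sheaf_map (full_subcat E G) (represented (Dom E h)) (represented (Cod E h)) (postcomposition h))\<rparr>"

lemma FArr_yoneda:
  "h \<in> hom E X Y \<Longrightarrow> FArr yoneda h = sheaf_map (full_subcat E G) (represented X) (represented Y) (postcomposition h)"
  unfolding yoneda_def by (auto dest: homD)

lemma FObj_yoneda [simp]: "FObj yoneda = represented"
  unfolding yoneda_def by simp

lemma yoneda_functor: "is_functor E (Sh U (full_subcat E G) canonical) yoneda"
  unfolding is_functor_def
proof (intro conjI ballI impI)
  show "X \<in> Obj E \<Longrightarrow> FObj yoneda X \<in> Obj (Sh U (full_subcat E G) canonical)" for X
    using represented_sheaf by simp
next
  fix h assume "h \<in> Arr E"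
  then have h: "h \<in> hom E (Dom E h) (Cod E h)"
    by (rule Arr_hom)
  show "FArr yoneda h \<in> hom (Sh U (full_subcat E G) canonical) (FObj yoneda (Dom E h)) (FObj yoneda (Cod E h))"
    unfolding FArr_yoneda[OF h] FObj_yoneda
    using category.sheaf_map_hom[OF full_subcat_category] represented_sheaf postcomposition_natural[OF h] hom_Obj[OF h]
    by blast
next
  fix X assume "X \<in> Obj E"
  then have I: "Id E X \<in> hom E X X"
    by (rule Id_in_hom)
  show "FArr yoneda (Id E X) = Id (Sh U (full_subcat E G) canonical) (FObj yoneda X)"
    unfolding FArr_yoneda[OF I] FObj_yoneda sheaf_map_Id sheaf_map_eq_iff
    using postcomposition_code[OF _ I] Comp_Id_left by auto
next
  fix f g assume "f \<in> Arr E" "g \<in> Arr E" "Cod E f = Dom E g"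
  then have f: "f \<in> hom E (Dom E f) (Dom E g)" and g: "g \<in> hom E (Dom E g) (Cod E g)"
    by (auto simp: hom_def)
  note gf = Comp_in_hom[OF f g]
  have "postcomposition (g \<cdot> f) A y = postcomposition g A (postcomposition f A y)"
    if A: "A \<in> G" and y: "y \<in> FObj (represented (Dom E f)) A" for A y
  proof -
    obtain x where x: "x \<in> hom E A (Dom E f)" "y = code (Dom E f) A x"
      using A y by auto
    show ?thesis
      using postcomposition_code[OF A gf x(1)] postcomposition_code[OF A f x(1)]
        postcomposition_code[OF A g Comp_in_hom[OF x(1) f]] Comp_assoc[OF x(1) f g] x(2) by simp
  qed
  then show "FArr yoneda (g \<cdot> f) = FArr yoneda g \<cdot>\<^bsub>Sh U (full_subcat E G) canonical\<^esub> FArr yoneda f"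
    unfolding FArr_yoneda[OF gf] FArr_yoneda[OF f] FArr_yoneda[OF g]
      sheaf_map_Comp[OF postcomposition_natural[OF f]] sheaf_map_eq_iff by simp
qed

lemma yoneda_faithful:
  assumes h: "h \<in> hom E X Y" "k \<in> hom E X Y" and eq: "FArr yoneda h = FArr yoneda k"
  shows "h = k"
proof (rule jointly_epicD[OF points_jointly_epic h])
  show "X \<in> Obj E"
    using hom_Obj[OF h(1)] by blast
  fix w assume w: "w \<in> points X"
  note w' = points_hom[OF w] and A = points_G[OF w]
  have "postcomposition h (Dom E w) (code X (Dom E w) w) = postcomposition k (Dom E w) (code X (Dom E w) w)"
    using eq w' A unfolding FArr_yoneda[OF h(1)] FArr_yoneda[OF h(2)] sheaf_map_eq_iff by simp
  then have "code Y (Dom E w) (h \<cdot> w) = code Y (Dom E w) (k \<cdot> w)"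
    using postcomposition_code[OF A h(1) w'] postcomposition_code[OF A h(2) w'] by simp
  then show "h \<cdot> w = k \<cdot> w"
    using inj_onD[OF code(1)[OF _ A]] hom_Obj[OF h(1)] Comp_in_hom[OF w' h(1)] Comp_in_hom[OF w' h(2)] by blast
qed

text \<open>
  A natural transformation between represented presheaves gives compatible arrows on the points
  of \<open>X\<close>, which glue because the points are jointly epic.
\<close>

lemma yoneda_full:
  assumes X: "X \<in> Obj E" and Y: "Y \<in> Obj E"
    and m: "m \<in> hom (Sh U (full_subcat E G) canonical) (represented X) (represented Y)"
  shows "\<exists>h\<in>hom E X Y. FArr yoneda h = m"
proof -
  obtain t where t: "natural_family (full_subcat E G) (represented X) (represented Y) t"
    and mt: "m = sheaf_map (full_subcat E G) (represented X) (represented Y) t"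
    by (rule category.sheaf_mapE[OF full_subcat_category m])
  define x where "x w = decode Y (Dom E w) (t (Dom E w) (code X (Dom E w) w))" for w
  have x: "x w \<in> hom E (Dom E w) Y" "code Y (Dom E w) (x w) = t (Dom E w) (code X (Dom E w) w)"
    if w: "w \<in> points X" for w
  proof -
    note w' = points_hom[OF w] and A = points_G[OF w]
    have "t (Dom E w) (code X (Dom E w) w) \<in> FObj (represented Y) (Dom E w)"
      using t w' A unfolding natural_family_def by simp
    then obtain y where "y \<in> hom E (Dom E w) Y" "t (Dom E w) (code X (Dom E w) w) = code Y (Dom E w) y"
      using A by auto
    then show "x w \<in> hom E (Dom E w) Y" "code Y (Dom E w) (x w) = t (Dom E w) (code X (Dom E w) w)"
      using decode_code[OF A] by (simp_all add: x_def)
  qed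
  have x_Comp: "x w \<cdot> a = x (w \<cdot> a)" if w: "w \<in> points X" and A: "A \<in> G" and a: "a \<in> hom E A (Dom E w)" for w A a
  proof -
    have wa: "w \<cdot> a \<in> points X" "Dom E (w \<cdot> a) = A"
      using pointsI[OF Comp_in_hom[OF a points_hom[OF w]] A] homD[OF Comp_in_hom[OF a points_hom[OF w]]] by auto
    have aA: "a \<in> Arr (full_subcat E G)" "Cod E a = Dom E w" "Dom E a = A"
      using homD[OF a] A points_G[OF w] by auto
    have w'': "w \<in> hom E (Cod E a) X" and xw: "x w \<in> hom E (Cod E a) Y"
      using points_hom[OF w] x(1)[OF w] aA by simp_all
    have "code Y A (x w \<cdot> a) = fn (FArr (represented Y) a) (t (Cod E a) (code X (Cod E a) w))"
      using represented_restriction[OF aA(1) xw] x(2)[OF w] aA by simp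
    also have "\<dots> = t A (fn (FArr (represented X) a) (code X (Cod E a) w))"
    proof -
      have "code X (Cod E a) w \<in> FObj (represented X) (Cod (full_subcat E G) a)"
        using w'' aA(2) points_G[OF w] by simp
      then show ?thesis
        using t aA(1,3) unfolding natural_family_def by fastforce
    qed
    also have "\<dots> = t A (code X A (w \<cdot> a))"
      using represented_restriction[OF aA(1) w''] aA by simp
    also have "\<dots> = code Y A (x (w \<cdot> a))"
      using x(2)[OF wa(1)] wa(2) by simp
    finally show ?thesis
      using inj_onD[OF code(1)[OF Y A]] Comp_in_hom[OF a x(1)[OF w]] x(1)[OF wa(1)] wa(2) by simp
  qed
  have "\<exists>h\<in>hom E X Y. \<forall>w\<in>points X. h \<cdot> w = x w"
  proof (rule glue_arrows[OF small_points[OF X] points_jointly_epic[OF X] _ Y])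
    show "\<And>w. w \<in> points X \<Longrightarrow> x w \<in> hom E (Dom E w) Y"
      by (rule x(1))
    fix w v A a b assume wv: "w \<in> points X" "v \<in> points X" and A: "A \<in> G"
      and ab: "a \<in> hom E A (Dom E w)" "b \<in> hom E A (Dom E v)" "w \<cdot> a = v \<cdot> b"
    show "x w \<cdot> a = x v \<cdot> b"
      using x_Comp[OF wv(1) A ab(1)] x_Comp[OF wv(2) A ab(2)] ab(3) by simp
  qed blast
  then obtain h where h: "h \<in> hom E X Y" "\<forall>w\<in>points X. h \<cdot> w = x w"
    by blast
  have "postcomposition h A y = t A y" if A: "A \<in> G" and y: "y \<in> FObj (represented X) A" for A y
  proof -
    obtain w where w: "w \<in> hom E A X" "y = code X A w"
      using A y by auto
    then show ?thesis
      using postcomposition_code[OF A h(1) w(1)] h(2) x(2)[OF pointsI[OF w(1) A]] pointsI[OF w(1) A] homD[OF w(1)]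
      by simp
  qed
  then have "FArr yoneda h = m"
    unfolding FArr_yoneda[OF h(1)] mt sheaf_map_eq_iff by simp
  then show ?thesis
    using h(1) by blast
qed

text \<open>
  The bijections \<open>\<psi>\<close> between the points of the representing object and the sections of \<open>F\<close> become an
  isomorphism of sheaves after decoding.
\<close>

lemma yoneda_essentially_surjective:
  assumes F: "F \<in> sheaves U (full_subcat E G) canonical"
  shows "\<exists>X\<in>Obj E. \<exists>m\<in>hom (Sh U (full_subcat E G) canonical) (represented X) F.
    iso (Sh U (full_subcat E G) canonical) m"
proof -
  have sheaf: "is_sheaf (full_subcat E G) canonical F"
    using F unfolding sheaves_def by blast
  have "small U (FObj F A)" if "A \<in> G" for A
    using sheaves_small[OF F, of A] that unfolding small_sets_def by simp
  then obtain X \<psi> where X: "X \<in> Obj E" and bij: "\<And>A. A \<in> G \<Longrightarrow> bij_betw \<psi> (hom E A X) (FObj F A)"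
    and nat: "\<And>x w. x \<in> points X \<Longrightarrow> w \<in> points (Dom E x) \<Longrightarrow> \<psi> (x \<cdot> w) = fn (FArr F w) (\<psi> x)"
    by (rule sheaf_representable[OF sheaf]) blast+
  define t where "t A y = \<psi> (decode X A y)" for A y
  have t_code: "t A (code X A x) = \<psi> x" if "A \<in> G" "x \<in> hom E A X" for A x
    using decode_code[OF that] by (simp add: t_def)
  have t_bij: "bij_betw (t A) (FObj (represented X) A) (FObj F A)" if A: "A \<in> G" for A
  proof -
    have "bij_betw (decode X A) (FObj (represented X) A) (hom E A X)"
      unfolding decode_def using A bij_betw_inv_into[OF inj_on_imp_bij_betw[OF code(1)[OF X A]]] by simp
    then have "bij_betw (\<psi> \<circ> decode X A) (FObj (represented X) A) (FObj F A)"
      using bij[OF A] by (rule bij_betw_trans)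
    then show ?thesis
      by (simp add: t_def[abs_def] comp_def)
  qed
  have t: "natural_family (full_subcat E G) (represented X) F t"
    unfolding natural_family_def
  proof (intro conjI ballI)
    show "t A y \<in> FObj F A" if "A \<in> Obj (full_subcat E G)" "y \<in> FObj (represented X) A" for A y
    proof -
      have "A \<in> G"
        using that(1) by simp
      then show ?thesis
        using bij_betwE[OF t_bij] that(2) by blast
    qed
    fix f y assume f: "f \<in> Arr (full_subcat E G)" and "y \<in> FObj (represented X) (Cod (full_subcat E G) f)"
    then obtain x where x: "x \<in> hom E (Cod E f) X" "y = code X (Cod E f) x"
      by auto
    have f': "f \<in> hom E (Dom E f) (Cod E f)" "Dom E f \<in> G" "Cod E f \<in> G"
      using f by (auto intro: Arr_hom)
    have "\<psi> (x \<cdot> f) = fn (FArr F f) (\<psi> x)"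
      using nat[OF pointsI[OF x(1) f'(3)], of f] pointsI[OF f'(1,2)] homD[OF x(1)] by simp
    then show "t (Dom (full_subcat E G) f) (fn (FArr (represented X) f) y) =
        fn (FArr F f) (t (Cod (full_subcat E G) f) y)"
      using represented_restriction[OF f x(1)] t_code[OF f'(3) x(1)]
        t_code[OF f'(2) Comp_in_hom[OF f'(1) x(1)]] x(2) by simp
  qed
  note sheaf_map = category.sheaf_map_hom[OF full_subcat_category represented_sheaf[OF X] F t]
    category.sheaf_map_iso[OF full_subcat_category represented_sheaf[OF X] F t]
  show ?thesis
    using X sheaf_map(1) sheaf_map(2)[OF t_bij] by auto
qed

theorem yoneda_equivalence: "equivalent_categories E (Sh U (full_subcat E G) canonical)"
proof (rule equivalence_of_fully_faithful_essentially_surjective[OF _ _ yoneda_functor yoneda_faithful])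
  show "category E"
    by (rule category_axioms)
  show "category (Sh U (full_subcat E G) canonical)"
    by (rule category.Sh_category[OF full_subcat_category])
  show "\<exists>f\<in>hom E X Y. FArr yoneda f = t" if "X \<in> Obj E" "Y \<in> Obj E"
      "t \<in> hom (Sh U (full_subcat E G) canonical) (FObj yoneda X) (FObj yoneda Y)" for X Y t
    using yoneda_full that by simp
  show "\<exists>X\<in>Obj E. \<exists>e\<in>hom (Sh U (full_subcat E G) canonical) (FObj yoneda X) Y.
      iso (Sh U (full_subcat E G) canonical) e" if "Y \<in> Obj (Sh U (full_subcat E G) canonical)" for Y
    using yoneda_essentially_surjective that by simp
qed

end

theorem proposition3p14:
  fixes U :: "'u set"
    and E :: "('o, 'a) category"
    and \<C> :: "'o set"
  assumes "universe U"
    and "category E"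
    and "small_homs U E"
    and "has_finite_limits E"
    and "giraud_i U E"
    and "giraud_ii E"
    and "giraud_iii E"
    and "giraud_iv E"
    and "giraud_v U E \<C>"
  shows "\<exists>J. is_canonical_topology_on E \<C> J \<and>
             equivalent_categories E (Sh U (full_subcat E \<C>) J)"
proof -
  interpret giraud E U \<C>
    using assms by (simp add: giraud_def giraud_axioms_def)
  show ?thesis
    using canonical_is_canonical yoneda_equivalence by blast
qed

end
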